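(* Let $A\,|\,B$ be a ring extension with centralizer $R$ and $S=\mathrm{End}({}_BA_B)$, and regard $R$ as a left $S$-module by evaluation $\alpha\cdot r=\alpha(r)$ and as a right $\mathcal{Z}(B)$-module by multiplication. Then: (1) If $A\,|\,B$ is split, then ${}_SR$ is a finitely generated projective module. (2) If $A\,|\,B$ is centrally projective, then ${}_SR$ is a generator. (3) If $A\,|\,B$ is split and centrally projective, then ${}_SR_{\mathcal{Z}(B)}$ is a faithfully balanced progenerator bimodule, and $S$ and $\mathcal{Z}(B)$ are Morita equivalent.
   Context: Rings are associative and unital, modules are unital. A ring extension $A\,|\,B$ means a ring $A$ with a subring $B$ containing $1_A$. The centralizer is $R=C_A(B)=\{r\in A: rb=br\ \forall b\in B\}$, $\mathcal{Z}(B)$ is the center of $B$, and $S=\mathrm{End}({}_BA_B)$ is the ring (under composition) of $B$-$B$-bimodule endomorphisms of $A$. One has $\alpha(r)\in R$ for $\alpha\in S$, $r\in R$, so $R$ is a left $S$-module by evaluation. $A\,|\,B$ is split if the inclusion $B\to A$ is a split monomorphism of $B$-$B$-bimodules. $A\,|\,B$ is centrally projective if the natural bimodule ${}_BA_B$ is isomorphic to a direct summand of a finite direct sum $\oplus^n\,{}_BB_B$ of copies of the natural bimodule $B$. A bimodule ${}_SM_Z$ is faithfully balanced if the natural maps $S\to\mathrm{End}(M_Z)$ and $Z\to\mathrm{End}({}_SM)^{\mathrm{op}}$ are ring isomorphisms. A progenerator is a finitely generated projective generator (here on both sides). *)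

theory Defs
  imports "HOL-Algebra.Module" "HOL-Algebra.QuotRing" "HOL-Algebra.Subrings" "HOL-Library.Infinite_Typeclass"
begin

section \<open>Modules over noncommutative rings\<close>

text \<open>
  The library locale \<^locale>\<open>module\<close> requires a commutative ring of scalars. We keep its record,
  whose fields \<open>mult\<close> and \<open>one\<close> play no role for modules, and drop commutativity.
\<close>

locale left_module = R?: ring R + M?: abelian_group M
  for R :: "('s, 'e) ring_scheme" (structure) and M :: "('s, 'm, 'f) module_scheme" (structure) +
  assumes smult_closed:
      "\<lbrakk>a \<in> carrier R; x \<in> carrier M\<rbrakk> \<Longrightarrow> a \<odot>\<^bsub>M\<^esub> x \<in> carrier M"
    and smult_l_distr:
      "\<lbrakk>a \<in> carrier R; b \<in> carrier R; x \<in> carrier M\<rbrakk> \<Longrightarrow>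
        (a \<oplus>\<^bsub>R\<^esub> b) \<odot>\<^bsub>M\<^esub> x = a \<odot>\<^bsub>M\<^esub> x \<oplus>\<^bsub>M\<^esub> b \<odot>\<^bsub>M\<^esub> x"
    and smult_r_distr:
      "\<lbrakk>a \<in> carrier R; x \<in> carrier M; y \<in> carrier M\<rbrakk> \<Longrightarrow>
        a \<odot>\<^bsub>M\<^esub> (x \<oplus>\<^bsub>M\<^esub> y) = a \<odot>\<^bsub>M\<^esub> x \<oplus>\<^bsub>M\<^esub> a \<odot>\<^bsub>M\<^esub> y"
    and smult_assoc1:
      "\<lbrakk>a \<in> carrier R; b \<in> carrier R; x \<in> carrier M\<rbrakk> \<Longrightarrow>
        (a \<otimes>\<^bsub>R\<^esub> b) \<odot>\<^bsub>M\<^esub> x = a \<odot>\<^bsub>M\<^esub> (b \<odot>\<^bsub>M\<^esub> x)"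
    and smult_one: "x \<in> carrier M \<Longrightarrow> \<one>\<^bsub>R\<^esub> \<odot>\<^bsub>M\<^esub> x = x"

lemma left_module_iff_module: "cring R \<Longrightarrow> left_module R M \<longleftrightarrow> module R M"
  by (auto simp: left_module_def module_def left_module_axioms_def module_axioms_def cring.axioms)

text \<open>
  Homomorphisms are extensional functions, so that equality of homomorphisms is equality of
  functions; composition is accordingly \<^const>\<open>compose\<close>.
\<close>

definition mod_hom ::
    "('s, 'e) ring_scheme \<Rightarrow> ('s, 'm, 'f) module_scheme \<Rightarrow> ('s, 'n, 'g) module_scheme \<Rightarrow> ('m \<Rightarrow> 'n) set"
  where "mod_hom R M N =
    {f \<in> carrier M \<rightarrow>\<^sub>E carrier N.
      (\<forall>x\<in>carrier M. \<forall>y\<in>carrier M. f (x \<oplus>\<^bsub>M\<^esub> y) = f x \<oplus>\<^bsub>N\<^esub> f y) \<and>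
      (\<forall>a\<in>carrier R. \<forall>x\<in>carrier M. f (a \<odot>\<^bsub>M\<^esub> x) = a \<odot>\<^bsub>N\<^esub> f x)}"

definition id_hom :: "('m, 'f) ring_scheme \<Rightarrow> 'm \<Rightarrow> 'm"
  where "id_hom M = (\<lambda>x\<in>carrier M. x)"

definition hom_add ::
    "('m, 'f) ring_scheme \<Rightarrow> ('n, 'g) ring_scheme \<Rightarrow> ('m \<Rightarrow> 'n) \<Rightarrow> ('m \<Rightarrow> 'n) \<Rightarrow> 'm \<Rightarrow> 'n"
  where "hom_add M N f g = (\<lambda>x\<in>carrier M. f x \<oplus>\<^bsub>N\<^esub> g x)"

definition endo_ring :: "('m, 'f) ring_scheme \<Rightarrow> ('m \<Rightarrow> 'm) set \<Rightarrow> ('m \<Rightarrow> 'm) ring"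
  where "endo_ring M E =
    \<lparr>carrier = E, monoid.mult = compose (carrier M), one = id_hom M,
     zero = (\<lambda>x\<in>carrier M. \<zero>\<^bsub>M\<^esub>), add = hom_add M M\<rparr>"

definition mod_End :: "('s, 'e) ring_scheme \<Rightarrow> ('s, 'm, 'f) module_scheme \<Rightarrow> ('m \<Rightarrow> 'm) ring"
  where "mod_End R M = endo_ring M (mod_hom R M M)"

definition opp_ring :: "('s, 'e) ring_scheme \<Rightarrow> ('s, 'e) ring_scheme"
  where "opp_ring R = R\<lparr>monoid.mult := \<lambda>x y. y \<otimes>\<^bsub>R\<^esub> x\<rparr>"


section \<open>Finitely generated, projective and generator modules\<close>

definition fin_gen :: "('s, 'e) ring_scheme \<Rightarrow> ('s, 'm, 'f) module_scheme \<Rightarrow> bool"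
  where "fin_gen R M \<longleftrightarrow> left_module R M \<and>
    (\<exists>X. finite X \<and> X \<subseteq> carrier M \<and>
      (\<forall>m\<in>carrier M. \<exists>c\<in>X \<rightarrow> carrier R. m = (\<Oplus>\<^bsub>M\<^esub>x\<in>X. c x \<odot>\<^bsub>M\<^esub> x)))"

text \<open>
  The notions below quantify over all modules. Since HOL cannot quantify over types inside a
  definition, the modules quantified over have elements in a type \<open>'u\<close>, the universe, which is an
  explicit parameter. A statement that is polymorphic in \<open>'u\<close> covers modules of any size.
\<close>

definition projective_mod ::
    "'u::infinite itself \<Rightarrow> ('s, 'e) ring_scheme \<Rightarrow> ('s, 'm, 'f) module_scheme \<Rightarrow> bool"
  where "projective_mod U R P \<longleftrightarrow> left_module R P \<and>
    (\<forall>(X :: ('s, 'u) module) (Y :: ('s, 'u) module).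
      left_module R X \<longrightarrow> left_module R Y \<longrightarrow>
      (\<forall>g\<in>mod_hom R X Y. g ` carrier X = carrier Y \<longrightarrow>
        (\<forall>f\<in>mod_hom R P Y. \<exists>h\<in>mod_hom R P X. compose (carrier P) g h = f)))"

text \<open>A generator is a module \<open>M\<close> for which the functor \<open>Hom(M, -)\<close> is faithful.\<close>

definition generator_mod ::
    "'u::infinite itself \<Rightarrow> ('s, 'e) ring_scheme \<Rightarrow> ('s, 'm, 'f) module_scheme \<Rightarrow> bool"
  where "generator_mod U R M \<longleftrightarrow> left_module R M \<and>
    (\<forall>(X :: ('s, 'u) module) (Y :: ('s, 'u) module).
      left_module R X \<longrightarrow> left_module R Y \<longrightarrow>
      (\<forall>f\<in>mod_hom R X Y. \<forall>g\<in>mod_hom R X Y. f \<noteq> g \<longrightarrow>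
        (\<exists>h\<in>mod_hom R M X. compose (carrier M) f h \<noteq> compose (carrier M) g h)))"

definition progenerator_mod ::
    "'u::infinite itself \<Rightarrow> ('s, 'e) ring_scheme \<Rightarrow> ('s, 'm, 'f) module_scheme \<Rightarrow> bool"
  where "progenerator_mod U R M \<longleftrightarrow> fin_gen R M \<and> projective_mod U R M \<and> generator_mod U R M"


section \<open>Morita equivalence\<close>

text \<open>
  The category of left \<open>R\<close>-modules with elements in \<open>'u\<close> has as objects the records \<open>M\<close> with
  \<open>left_module R M\<close> and as morphisms the sets \<^const>\<open>mod_hom\<close>. Functors are given by their object
  part \<open>F0\<close> and their morphism part \<open>F1\<close>, the latter taking source and target as arguments.
\<close>

definition additive_functor ::
    "('s, 'e) ring_scheme \<Rightarrow> ('t, 'f) ring_scheme \<Rightarrow>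
     (('s, 'u) module \<Rightarrow> ('t, 'u) module) \<Rightarrow>
     (('s, 'u) module \<Rightarrow> ('s, 'u) module \<Rightarrow> ('u \<Rightarrow> 'u) \<Rightarrow> ('u \<Rightarrow> 'u)) \<Rightarrow> bool"
  where "additive_functor R T F0 F1 \<longleftrightarrow>
    (\<forall>M. left_module R M \<longrightarrow> left_module T (F0 M) \<and> F1 M M (id_hom M) = id_hom (F0 M)) \<and>
    (\<forall>M N. left_module R M \<longrightarrow> left_module R N \<longrightarrow>
      (\<forall>f\<in>mod_hom R M N. F1 M N f \<in> mod_hom T (F0 M) (F0 N)) \<and>
      (\<forall>f\<in>mod_hom R M N. \<forall>g\<in>mod_hom R M N.
        F1 M N (hom_add M N f g) = hom_add (F0 M) (F0 N) (F1 M N f) (F1 M N g))) \<and>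
    (\<forall>M N P. left_module R M \<longrightarrow> left_module R N \<longrightarrow> left_module R P \<longrightarrow>
      (\<forall>f\<in>mod_hom R M N. \<forall>g\<in>mod_hom R N P.
        F1 M P (compose (carrier M) g f) = compose (carrier (F0 M)) (F1 N P g) (F1 M N f)))"

definition nat_iso_to_id ::
    "('s, 'e) ring_scheme \<Rightarrow>
     (('s, 'u) module \<Rightarrow> ('s, 'u) module) \<Rightarrow>
     (('s, 'u) module \<Rightarrow> ('s, 'u) module \<Rightarrow> ('u \<Rightarrow> 'u) \<Rightarrow> ('u \<Rightarrow> 'u)) \<Rightarrow> bool"
  where "nat_iso_to_id R H0 H1 \<longleftrightarrow>
    (\<exists>\<eta> :: ('s, 'u) module \<Rightarrow> 'u \<Rightarrow> 'u.
      (\<forall>M. left_module R M \<longrightarrow>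
        \<eta> M \<in> mod_hom R (H0 M) M \<and> bij_betw (\<eta> M) (carrier (H0 M)) (carrier M)) \<and>
      (\<forall>M N. left_module R M \<longrightarrow> left_module R N \<longrightarrow>
        (\<forall>f\<in>mod_hom R M N.
          compose (carrier (H0 M)) (\<eta> N) (H1 M N f) = compose (carrier (H0 M)) f (\<eta> M))))"

definition morita_equivalent ::
    "'u::infinite itself \<Rightarrow> ('s, 'e) ring_scheme \<Rightarrow> ('t, 'f) ring_scheme \<Rightarrow> bool"
  where "morita_equivalent U R T \<longleftrightarrow> ring R \<and> ring T \<and>
    (\<exists>(F0 :: ('s, 'u) module \<Rightarrow> ('t, 'u) module) F1 (G0 :: ('t, 'u) module \<Rightarrow> ('s, 'u) module) G1.
      additive_functor R T F0 F1 \<and> additive_functor T R G0 G1 \<and>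
      nat_iso_to_id R (\<lambda>M. G0 (F0 M)) (\<lambda>M N f. G1 (F0 M) (F0 N) (F1 M N f)) \<and>
      nat_iso_to_id T (\<lambda>M. F0 (G0 M)) (\<lambda>M N f. F1 (G0 M) (G0 N) (G1 M N f)))"


section \<open>Bimodules\<close>

record ('s, 't, 'm) bimodule = "('s, 'm) module" +
  rsmult :: "'m \<Rightarrow> 't \<Rightarrow> 'm"

text \<open>Right \<open>T\<close>-modules are treated as left modules over the opposite ring of \<open>T\<close>.\<close>

definition right_mod :: "('s, 't, 'm, 'f) bimodule_scheme \<Rightarrow> ('t, 'm) module"
  where "right_mod M =
    \<lparr>carrier = carrier M, monoid.mult = monoid.mult M, one = one M, zero = zero M, add = add M,
     smult = (\<lambda>t x. rsmult M x t)\<rparr>"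

definition is_bimodule ::
    "('s, 'e) ring_scheme \<Rightarrow> ('t, 'f) ring_scheme \<Rightarrow> ('s, 't, 'm, 'g) bimodule_scheme \<Rightarrow> bool"
  where "is_bimodule S T M \<longleftrightarrow>
    left_module S M \<and> ring T \<and> left_module (opp_ring T) (right_mod M) \<and>
    (\<forall>s\<in>carrier S. \<forall>x\<in>carrier M. \<forall>t\<in>carrier T.
      rsmult M (s \<odot>\<^bsub>M\<^esub> x) t = s \<odot>\<^bsub>M\<^esub> rsmult M x t)"

definition bimod_hom ::
    "('s, 'e) ring_scheme \<Rightarrow> ('t, 'f) ring_scheme \<Rightarrow>
     ('s, 't, 'm, 'g) bimodule_scheme \<Rightarrow> ('s, 't, 'n, 'h) bimodule_scheme \<Rightarrow> ('m \<Rightarrow> 'n) set"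
  where "bimod_hom S T M N =
    mod_hom S M N \<inter> mod_hom (opp_ring T) (right_mod M) (right_mod N)"

definition bimod_End ::
    "('s, 'e) ring_scheme \<Rightarrow> ('t, 'f) ring_scheme \<Rightarrow> ('s, 't, 'm, 'g) bimodule_scheme \<Rightarrow> ('m \<Rightarrow> 'm) ring"
  where "bimod_End S T M = endo_ring M (bimod_hom S T M M)"

definition split_mono ::
    "('s, 'e) ring_scheme \<Rightarrow> ('t, 'f) ring_scheme \<Rightarrow>
     ('s, 't, 'm, 'g) bimodule_scheme \<Rightarrow> ('s, 't, 'n, 'h) bimodule_scheme \<Rightarrow> ('m \<Rightarrow> 'n) \<Rightarrow> bool"
  where "split_mono S T M N f \<longleftrightarrow> f \<in> bimod_hom S T M N \<and>
    (\<exists>p\<in>bimod_hom S T N M. compose (carrier M) p f = id_hom M)"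

definition subbimodule ::
    "'m set \<Rightarrow> ('s, 'e) ring_scheme \<Rightarrow> ('t, 'f) ring_scheme \<Rightarrow> ('s, 't, 'm, 'g) bimodule_scheme \<Rightarrow> bool"
  where "subbimodule C S T M \<longleftrightarrow> submodule C S M \<and> submodule C (opp_ring T) (right_mod M)"

definition iso_direct_summand ::
    "('s, 'e) ring_scheme \<Rightarrow> ('t, 'f) ring_scheme \<Rightarrow>
     ('s, 't, 'm, 'g) bimodule_scheme \<Rightarrow> ('s, 't, 'n, 'h) bimodule_scheme \<Rightarrow> bool"
  where "iso_direct_summand S T M N \<longleftrightarrow>
    (\<exists>C D. subbimodule C S T N \<and> subbimodule D S T N \<and>
      C \<inter> D = {\<zero>\<^bsub>N\<^esub>} \<and> C <+>\<^bsub>N\<^esub> D = carrier N \<and>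
      (\<exists>f\<in>bimod_hom S T M (N\<lparr>carrier := C\<rparr>). bij_betw f (carrier M) C))"

definition bimod_power :: "nat \<Rightarrow> ('s, 't, 'm, 'g) bimodule_scheme \<Rightarrow> ('s, 't, nat \<Rightarrow> 'm) bimodule"
  where "bimod_power n M =
    \<lparr>carrier = {..<n} \<rightarrow>\<^sub>E carrier M,
     monoid.mult = (\<lambda>x y. \<lambda>i\<in>{..<n}. x i \<otimes>\<^bsub>M\<^esub> y i), one = (\<lambda>i\<in>{..<n}. \<one>\<^bsub>M\<^esub>),
     zero = (\<lambda>i\<in>{..<n}. \<zero>\<^bsub>M\<^esub>), add = (\<lambda>x y. \<lambda>i\<in>{..<n}. x i \<oplus>\<^bsub>M\<^esub> y i),
     smult = (\<lambda>s x. \<lambda>i\<in>{..<n}. s \<odot>\<^bsub>M\<^esub> x i),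
     rsmult = (\<lambda>x t. \<lambda>i\<in>{..<n}. rsmult M (x i) t)\<rparr>"

definition faithfully_balanced ::
    "('s, 'e) ring_scheme \<Rightarrow> ('t, 'f) ring_scheme \<Rightarrow> ('s, 't, 'm, 'g) bimodule_scheme \<Rightarrow> bool"
  where "faithfully_balanced S T M \<longleftrightarrow> is_bimodule S T M \<and>
    (\<lambda>s. \<lambda>x\<in>carrier M. s \<odot>\<^bsub>M\<^esub> x) \<in> ring_iso S (mod_End (opp_ring T) (right_mod M)) \<and>
    (\<lambda>t. \<lambda>x\<in>carrier M. rsmult M x t) \<in> ring_iso T (opp_ring (mod_End S M))"

definition progenerator_bimod ::
    "'u::infinite itself \<Rightarrow> ('s, 'e) ring_scheme \<Rightarrow> ('t, 'f) ring_scheme \<Rightarrow>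
     ('s, 't, 'm, 'g) bimodule_scheme \<Rightarrow> bool"
  where "progenerator_bimod U S T M \<longleftrightarrow> is_bimodule S T M \<and>
    progenerator_mod U S M \<and> progenerator_mod U (opp_ring T) (right_mod M)"


section \<open>Ring extensions\<close>

text \<open>
  A ring extension is a ring \<open>A\<close> together with a set \<open>B\<close> such that \<open>subring B A\<close>; the ring \<open>B\<close> is
  then \<open>A\<lparr>carrier := B\<rparr>\<close>.
\<close>

definition centralizer :: "('a, 'e) ring_scheme \<Rightarrow> 'a set \<Rightarrow> 'a set"
  where "centralizer A B = {r \<in> carrier A. \<forall>b\<in>B. r \<otimes>\<^bsub>A\<^esub> b = b \<otimes>\<^bsub>A\<^esub> r}"

definition center :: "('a, 'e) ring_scheme \<Rightarrow> ('a, 'e) ring_scheme"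
  where "center A = A\<lparr>carrier := centralizer A (carrier A)\<rparr>"

text \<open>
  \<open>A\<close> with left and right multiplication as actions; the rings that act are not part of the
  record, so the same record serves as the natural bimodule over any subring.
\<close>

definition nat_bimod :: "('a, 'e) ring_scheme \<Rightarrow> ('a, 'a, 'a) bimodule"
  where "nat_bimod A =
    \<lparr>carrier = carrier A, monoid.mult = monoid.mult A, one = one A, zero = zero A, add = add A,
     smult = monoid.mult A, rsmult = monoid.mult A\<rparr>"

definition split_ext :: "('a, 'e) ring_scheme \<Rightarrow> 'a set \<Rightarrow> bool"
  where "split_ext A B \<longleftrightarrow>
    split_mono (A\<lparr>carrier := B\<rparr>) (A\<lparr>carrier := B\<rparr>)
      (nat_bimod (A\<lparr>carrier := B\<rparr>)) (nat_bimod A) (\<lambda>b\<in>B. b)"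

definition centrally_projective :: "('a, 'e) ring_scheme \<Rightarrow> 'a set \<Rightarrow> bool"
  where "centrally_projective A B \<longleftrightarrow>
    (\<exists>n. iso_direct_summand (A\<lparr>carrier := B\<rparr>) (A\<lparr>carrier := B\<rparr>)
      (nat_bimod A) (bimod_power n (nat_bimod (A\<lparr>carrier := B\<rparr>))))"

definition ext_End :: "('a, 'e) ring_scheme \<Rightarrow> 'a set \<Rightarrow> ('a \<Rightarrow> 'a) ring"
  where "ext_End A B = bimod_End (A\<lparr>carrier := B\<rparr>) (A\<lparr>carrier := B\<rparr>) (nat_bimod A)"

text \<open>The centralizer with evaluation on the left and multiplication on the right.\<close>

definition centralizer_bimod :: "('a, 'e) ring_scheme \<Rightarrow> 'a set \<Rightarrow> ('a \<Rightarrow> 'a, 'a, 'a) bimodule"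
  where "centralizer_bimod A B =
    \<lparr>carrier = centralizer A B, monoid.mult = monoid.mult A, one = one A, zero = zero A, add = add A,
     smult = (\<lambda>\<alpha> r. \<alpha> r), rsmult = monoid.mult A\<rparr>"

end

theory Submission
  imports Defs
begin

text \<open>
  Write \<open>S = End(\<^sub>BA\<^sub>B)\<close>, let \<open>R\<close> be the centralizer and \<open>Z\<close> the center of \<open>B\<close>. Call a
  bimodule map \<open>\<phi> : A \<rightarrow> B\<close>, regarded as an element of \<open>S\<close>, a form. For a form \<open>\<phi>\<close> and
  \<open>r \<in> R\<close> the map \<open>outer \<phi> r : x \<mapsto> \<phi> x \<cdot> r\<close> lies in \<open>S\<close>, and left \<open>B\<close>-linearity of
  \<open>\<alpha> \<in> S\<close> gives the one identity on which everything rests: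
  \<open>\<alpha> \<circ> outer \<phi> r = outer \<phi> (\<alpha> r)\<close>. So \<open>outer \<phi> : R \<rightarrow> S\<close> is \<open>S\<close>-linear. A form also
  maps \<open>R\<close> into \<open>Z\<close>, and so restricts to a \<open>Z\<close>-linear functional on \<open>R\<close>.

  If \<open>A | B\<close> is split, there is a form \<open>p\<close> that is the identity on \<open>B\<close>. Then
  \<open>(outer p r) 1 = r\<close>: the one-element family \<open>(1, outer p)\<close> is a dual basis of \<open>\<^sub>SR\<close>. If
  \<open>A | B\<close> is centrally projective, the coordinates of the embedding into \<open>B\<^sup>n\<close> are forms \<open>f i\<close>,
  the images of the unit vectors under the projection are elements \<open>r i\<close> of \<open>R\<close>, and
  \<open>a = (\<Sum>i. f i a \<cdot> r i)\<close> for all \<open>a\<close>. In other words \<open>(\<Sum>i. outer (f i) (r i)) = 1\<close>: the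
  trace of \<open>\<^sub>SR\<close> contains the identity of \<open>S\<close>, and \<open>\<^sub>SR\<close> is a generator.

  Over \<open>Z\<close> the two hypotheses exchange their roles: the \<open>(r i, f i)\<close> are a dual basis of
  \<open>R\<^sub>Z\<close>, and \<open>p 1 = 1\<close> puts the identity of \<open>Z\<close> into the trace of \<open>R\<^sub>Z\<close>. The bimodule is
  faithfully balanced because a \<open>Z\<close>-linear \<open>\<theta> : R \<rightarrow> R\<close> extends to
  \<open>(\<Sum>i. outer (f i) (\<theta> (r i))) \<in> S\<close>, and because an \<open>S\<close>-linear \<open>\<theta> : R \<rightarrow> R\<close> satisfies
  \<open>\<theta> r = \<theta> ((outer p r) 1) = (outer p r) (\<theta> 1) = r \<cdot> p (\<theta> 1)\<close>.

  For the Morita equivalence, \<open>p\<close> is an idempotent of \<open>S\<close>. Its corner \<open>p S p\<close> is isomorphic to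
  \<open>Z\<close> by \<open>z \<mapsto> outer p z\<close>, and \<open>p\<close> is full because \<open>(\<Sum>i. outer p (r i) \<circ> f i) = 1\<close>, where
  the left factors lie in \<open>S p\<close> and the right ones in \<open>p S\<close>. A ring is Morita equivalent to the
  corner at a full idempotent; this is proved for arbitrary rings in the locale \<open>full_corner\<close>,
  with functors that do not leave the given universe of module elements.
\<close>

section \<open>Finite sums and module homomorphisms\<close>

lemma additive_zero:
  assumes "abelian_group M" "abelian_group N" "h \<in> carrier M \<rightarrow> carrier N"
    and "\<And>x y. x \<in> carrier M \<Longrightarrow> y \<in> carrier M \<Longrightarrow> h (x \<oplus>\<^bsub>M\<^esub> y) = h x \<oplus>\<^bsub>N\<^esub> h y"
  shows "h \<zero>\<^bsub>M\<^esub> = \<zero>\<^bsub>N\<^esub>"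
proof -
  interpret M: abelian_group M by fact
  interpret N: abelian_group N by fact
  have c: "h \<zero>\<^bsub>M\<^esub> \<in> carrier N" using assms(3) by auto
  have "h \<zero>\<^bsub>M\<^esub> \<oplus>\<^bsub>N\<^esub> h \<zero>\<^bsub>M\<^esub> = h \<zero>\<^bsub>M\<^esub>"
    using assms(4)[of "\<zero>\<^bsub>M\<^esub>" "\<zero>\<^bsub>M\<^esub>"] by simp
  then show ?thesis using c by (simp only: N.add.l_cancel_one)
qed

lemma additive_finsum:
  assumes "abelian_group M" "abelian_group N" "h \<in> carrier M \<rightarrow> carrier N"
    and "\<And>x y. x \<in> carrier M \<Longrightarrow> y \<in> carrier M \<Longrightarrow> h (x \<oplus>\<^bsub>M\<^esub> y) = h x \<oplus>\<^bsub>N\<^esub> h y"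
    and "g \<in> I \<rightarrow> carrier M"
  shows "h (\<Oplus>\<^bsub>M\<^esub>i\<in>I. g i) = (\<Oplus>\<^bsub>N\<^esub>i\<in>I. h (g i))"
proof -
  interpret M: abelian_group M by fact
  interpret N: abelian_group N by fact
  show ?thesis
    using assms(5)
  proof (induction I rule: infinite_finite_induct)
    case (insert i I)
    have g: "g \<in> I \<rightarrow> carrier M" "g i \<in> carrier M"
      using insert.prems by auto
    moreover have "(\<lambda>i. h (g i)) \<in> I \<rightarrow> carrier N" "h (g i) \<in> carrier N"
      using g assms(3) by auto
    ultimately show ?case
      using insert assms(4) by simp
  qed (simp_all add: additive_zero[OF assms(1-4)])
qed

lemma finsum_swap:
  assumes "abelian_group M" "finite I"
    and "\<And>i j. i \<in> I \<Longrightarrow> j \<in> J \<Longrightarrow> f i j \<in> carrier M"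
  shows "(\<Oplus>\<^bsub>M\<^esub>i\<in>I. \<Oplus>\<^bsub>M\<^esub>j\<in>J. f i j) = (\<Oplus>\<^bsub>M\<^esub>j\<in>J. \<Oplus>\<^bsub>M\<^esub>i\<in>I. f i j)"
proof -
  interpret abelian_group M by fact
  show ?thesis
    using assms(2,3)
  proof (induction I)
    case (insert i I)
    have "(\<lambda>j. f i j) \<in> J \<rightarrow> carrier M" "(\<lambda>i. \<Oplus>\<^bsub>M\<^esub>j\<in>J. f i j) \<in> I \<rightarrow> carrier M"
      "(\<lambda>j. \<Oplus>\<^bsub>M\<^esub>i\<in>I. f i j) \<in> J \<rightarrow> carrier M"
      using insert.prems by (auto intro!: finsum_closed)
    moreover have "(\<Oplus>\<^bsub>M\<^esub>j\<in>J. \<Oplus>\<^bsub>M\<^esub>i\<in>insert i I. f i j)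
        = (\<Oplus>\<^bsub>M\<^esub>j\<in>J. f i j \<oplus>\<^bsub>M\<^esub> (\<Oplus>\<^bsub>M\<^esub>i\<in>I. f i j))"
      using insert by (intro finsum_cong' refl) (auto intro!: finsum_closed)
    ultimately show ?case
      using insert by (simp add: finsum_addf)
  qed simp
qed

lemma finsum_group_by:
  assumes "abelian_group M" "finite I" "f \<in> I \<rightarrow> carrier M"
  shows "(\<Oplus>\<^bsub>M\<^esub>y\<in>m ` I. \<Oplus>\<^bsub>M\<^esub>i\<in>{i \<in> I. m i = y}. f i) = (\<Oplus>\<^bsub>M\<^esub>i\<in>I. f i)"
proof -
  interpret abelian_group M by fact
  have "(\<Union>y\<in>m ` I. {i \<in> I. m i = y}) = I" by auto
  then show ?thesis
    using add.finprod_UN_disjoint[of "m ` I" "\<lambda>y. {i \<in> I. m i = y}" f] assms(2,3)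
    by (simp add: pairwise_def disjnt_def Pi_def disjoint_iff)
qed

lemma left_module_ring: "left_module R M \<Longrightarrow> ring R"
  by (simp add: left_module_def)

lemma left_module_abelian_group: "left_module R M \<Longrightarrow> abelian_group M"
  by (simp add: left_module_def)

lemma finsum_in_carrier:
  assumes "abelian_group M" "\<And>i. i \<in> I \<Longrightarrow> f i \<in> carrier M"
  shows "(\<Oplus>\<^bsub>M\<^esub>i\<in>I. f i) \<in> carrier M"
  using assms by (intro abelian_monoid.finsum_closed abelian_group.axioms(1)) auto

lemma finsum_eqI:
  assumes "abelian_group M" "\<And>i. i \<in> I \<Longrightarrow> g i \<in> carrier M" "\<And>i. i \<in> I \<Longrightarrow> f i = g i"
  shows "(\<Oplus>\<^bsub>M\<^esub>i\<in>I. f i) = (\<Oplus>\<^bsub>M\<^esub>i\<in>I. g i)"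
  using assms by (intro abelian_monoid.finsum_cong' abelian_group.axioms(1)) auto

lemma finsum_add:
  assumes "abelian_group M" "\<And>i. i \<in> I \<Longrightarrow> f i \<in> carrier M" "\<And>i. i \<in> I \<Longrightarrow> g i \<in> carrier M"
  shows "(\<Oplus>\<^bsub>M\<^esub>i\<in>I. f i \<oplus>\<^bsub>M\<^esub> g i) = (\<Oplus>\<^bsub>M\<^esub>i\<in>I. f i) \<oplus>\<^bsub>M\<^esub> (\<Oplus>\<^bsub>M\<^esub>i\<in>I. g i)"
  using assms by (intro abelian_monoid.finsum_addf abelian_group.axioms(1)) auto

lemma smult_finsum:
  assumes M: "left_module R M" and "a \<in> carrier R" "\<And>i. i \<in> I \<Longrightarrow> f i \<in> carrier M"
  shows "a \<odot>\<^bsub>M\<^esub> (\<Oplus>\<^bsub>M\<^esub>i\<in>I. f i) = (\<Oplus>\<^bsub>M\<^esub>i\<in>I. a \<odot>\<^bsub>M\<^esub> f i)"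
  using assms left_module_abelian_group[OF M]
  by (intro additive_finsum) (auto simp: left_module.smult_closed[OF M] left_module.smult_r_distr[OF M])

lemma finsum_smult:
  assumes M: "left_module R M" and "x \<in> carrier M" "\<And>i. i \<in> I \<Longrightarrow> c i \<in> carrier R"
  shows "(\<Oplus>\<^bsub>R\<^esub>i\<in>I. c i) \<odot>\<^bsub>M\<^esub> x = (\<Oplus>\<^bsub>M\<^esub>i\<in>I. c i \<odot>\<^bsub>M\<^esub> x)"
  using assms left_module_abelian_group[OF M] ring.is_abelian_group[OF left_module_ring[OF M]]
  by (intro additive_finsum[where h = "\<lambda>a. a \<odot>\<^bsub>M\<^esub> x"])
    (auto simp: left_module.smult_closed[OF M] left_module.smult_l_distr[OF M])

lemma mod_homI:
  assumes "f \<in> extensional (carrier M)" "\<And>x. x \<in> carrier M \<Longrightarrow> f x \<in> carrier N"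
    and "\<And>x y. x \<in> carrier M \<Longrightarrow> y \<in> carrier M \<Longrightarrow> f (x \<oplus>\<^bsub>M\<^esub> y) = f x \<oplus>\<^bsub>N\<^esub> f y"
    and "\<And>a x. a \<in> carrier R \<Longrightarrow> x \<in> carrier M \<Longrightarrow> f (a \<odot>\<^bsub>M\<^esub> x) = a \<odot>\<^bsub>N\<^esub> f x"
  shows "f \<in> mod_hom R M N"
  using assms by (auto simp: mod_hom_def PiE_def)

lemma mod_hom_extensional: "f \<in> mod_hom R M N \<Longrightarrow> f \<in> extensional (carrier M)"
  and mod_hom_closed: "f \<in> mod_hom R M N \<Longrightarrow> x \<in> carrier M \<Longrightarrow> f x \<in> carrier N"
  and mod_hom_add: "f \<in> mod_hom R M N \<Longrightarrow> x \<in> carrier M \<Longrightarrow> y \<in> carrier M \<Longrightarrow>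
    f (x \<oplus>\<^bsub>M\<^esub> y) = f x \<oplus>\<^bsub>N\<^esub> f y"
  and mod_hom_smult: "f \<in> mod_hom R M N \<Longrightarrow> a \<in> carrier R \<Longrightarrow> x \<in> carrier M \<Longrightarrow>
    f (a \<odot>\<^bsub>M\<^esub> x) = a \<odot>\<^bsub>N\<^esub> f x"
  by (auto simp: mod_hom_def PiE_def)

lemma mod_hom_finsum:
  assumes "left_module R M" "left_module R N" "f \<in> mod_hom R M N"
    and "\<And>i. i \<in> I \<Longrightarrow> g i \<in> carrier M"
  shows "f (\<Oplus>\<^bsub>M\<^esub>i\<in>I. g i) = (\<Oplus>\<^bsub>N\<^esub>i\<in>I. f (g i))"
  using assms by (intro additive_finsum left_module_abelian_group[of R])
    (auto simp: mod_hom_closed mod_hom_add)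

lemma mod_hom_eqI:
  assumes "f \<in> mod_hom R M N" "g \<in> mod_hom R M N" "\<And>x. x \<in> carrier M \<Longrightarrow> f x = g x"
  shows "f = g"
  using assms extensionalityI mod_hom_extensional by metis

lemma nat_bimod_simps [simp]:
  "carrier (nat_bimod R) = carrier R" "monoid.mult (nat_bimod R) = monoid.mult R"
  "one (nat_bimod R) = one R" "zero (nat_bimod R) = zero R" "add (nat_bimod R) = add R"
  "smult (nat_bimod R) = monoid.mult R" "rsmult (nat_bimod R) = monoid.mult R"
  by (simp_all add: nat_bimod_def)

lemma finsum_unit: "abelian_group M \<Longrightarrow> f () \<in> carrier M \<Longrightarrow> (\<Oplus>\<^bsub>M\<^esub>i\<in>{()}. f i) = f ()"
  using abelian_monoid.finsum_insert[of M "{}" "()" f]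
  by (simp add: abelian_group.axioms(1) abelian_monoid.finsum_empty abelian_monoid.r_zero)

section \<open>Dual bases and traces\<close>

lemma hom_smult_const:
  assumes M: "left_module R X" and \<phi>: "\<phi> \<in> mod_hom R M (nat_bimod R)" and x: "x \<in> carrier X"
    and "left_module R M"
  shows "(\<lambda>r\<in>carrier M. \<phi> r \<odot>\<^bsub>X\<^esub> x) \<in> mod_hom R M X"
proof (rule mod_homI)
  interpret M: abelian_group M using assms(4) by (rule left_module_abelian_group)
  have c: "\<phi> r \<in> carrier R" if "r \<in> carrier M" for r
    using mod_hom_closed[OF \<phi> that] by simp
  fix r s a assume r: "r \<in> carrier M"
  show "(\<lambda>r\<in>carrier M. \<phi> r \<odot>\<^bsub>X\<^esub> x) r \<in> carrier X"
    using r x c left_module.smult_closed[OF M] by simp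
  show "(\<lambda>r\<in>carrier M. \<phi> r \<odot>\<^bsub>X\<^esub> x) (r \<oplus>\<^bsub>M\<^esub> s)
      = (\<lambda>r\<in>carrier M. \<phi> r \<odot>\<^bsub>X\<^esub> x) r \<oplus>\<^bsub>X\<^esub> (\<lambda>r\<in>carrier M. \<phi> r \<odot>\<^bsub>X\<^esub> x) s"
    if "s \<in> carrier M"
    using r that x c mod_hom_add[OF \<phi>] left_module.smult_l_distr[OF M] by simp
  show "(\<lambda>r\<in>carrier M. \<phi> r \<odot>\<^bsub>X\<^esub> x) (a \<odot>\<^bsub>M\<^esub> r)
      = a \<odot>\<^bsub>X\<^esub> (\<lambda>r\<in>carrier M. \<phi> r \<odot>\<^bsub>X\<^esub> x) r"
    if "a \<in> carrier R"
    using r that x c mod_hom_smult[OF \<phi>] left_module.smult_assoc1[OF M]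
      left_module.smult_closed[OF assms(4)] by simp
qed simp

lemma hom_finsum_closed:
  assumes M: "left_module R M" and X: "left_module R X"
    and h: "\<And>i. i \<in> I \<Longrightarrow> h i \<in> mod_hom R M X"
  shows "(\<lambda>r\<in>carrier M. \<Oplus>\<^bsub>X\<^esub>i\<in>I. h i r) \<in> mod_hom R M X"
proof -
  interpret M: abelian_group M using M by (rule left_module_abelian_group)
  have X': "abelian_group X" using X by (rule left_module_abelian_group)
  then interpret X: abelian_group X .
  have hc: "h i x \<in> carrier X" if "i \<in> I" "x \<in> carrier M" for i x
    using mod_hom_closed[OF h] that by blast
  show ?thesis
  proof (rule mod_homI, goal_cases)
    case (2 x)
    then show ?case using X' hc by (simp add: finsum_in_carrier)
  next
    case (3 x y)
    then have "(\<Oplus>\<^bsub>X\<^esub>i\<in>I. h i (x \<oplus>\<^bsub>M\<^esub> y)) = (\<Oplus>\<^bsub>X\<^esub>i\<in>I. h i x \<oplus>\<^bsub>X\<^esub> h i y)"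
      using hc by (intro finsum_eqI X') (auto simp: mod_hom_add[OF h])
    also have "\<dots> = (\<Oplus>\<^bsub>X\<^esub>i\<in>I. h i x) \<oplus>\<^bsub>X\<^esub> (\<Oplus>\<^bsub>X\<^esub>i\<in>I. h i y)"
      using 3 hc by (intro finsum_add X') auto
    finally show ?case using 3 by simp
  next
    case (4 a x)
    then have "(\<Oplus>\<^bsub>X\<^esub>i\<in>I. h i (a \<odot>\<^bsub>M\<^esub> x)) = (\<Oplus>\<^bsub>X\<^esub>i\<in>I. a \<odot>\<^bsub>X\<^esub> h i x)"
      using hc by (intro finsum_eqI X') (auto simp: mod_hom_smult[OF h] left_module.smult_closed[OF X])
    also have "\<dots> = a \<odot>\<^bsub>X\<^esub> (\<Oplus>\<^bsub>X\<^esub>i\<in>I. h i x)"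
      using 4 hc by (intro smult_finsum[OF X, symmetric]) auto
    finally show ?case using 4 left_module.smult_closed[OF M] by simp
  qed simp
qed

text \<open>
  The \<open>S\<close>-module \<open>R\<close> and the \<open>Z\<close>-module \<open>R\<close> enter the main theorem through the two criteria
  below: a dual basis makes a module finitely generated projective, and linear functionals whose
  values add up to the identity make it a generator. Linear functionals are homomorphisms into
  \<^term>\<open>nat_bimod R\<close>, whose left action is multiplication in the ring.
\<close>
lemma dual_basis_imp_fin_gen:
  assumes M: "left_module R M" and "finite I" and m: "\<And>i. i \<in> I \<Longrightarrow> m i \<in> carrier M"
    and \<phi>: "\<And>i. i \<in> I \<Longrightarrow> \<phi> i \<in> mod_hom R M (nat_bimod R)"
    and expand: "\<And>x. x \<in> carrier M \<Longrightarrow> (\<Oplus>\<^bsub>M\<^esub>i\<in>I. \<phi> i x \<odot>\<^bsub>M\<^esub> m i) = x"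
  shows "fin_gen R M"
proof -
  have Rg: "abelian_group R" and Mg: "abelian_group M"
    using left_module_abelian_group[OF M] ring.is_abelian_group[OF left_module_ring[OF M]] by auto
  have \<phi>c: "\<phi> i x \<in> carrier R" if "i \<in> I" "x \<in> carrier M" for i x
    using mod_hom_closed[OF \<phi>] that by fastforce
  have "\<exists>c\<in>m ` I \<rightarrow> carrier R. x = (\<Oplus>\<^bsub>M\<^esub>y\<in>m ` I. c y \<odot>\<^bsub>M\<^esub> y)" if x: "x \<in> carrier M" for x
  proof
    \<comment> \<open>The \<open>m i\<close> need not be distinct: coefficients of equal generators are collected.\<close>
    let ?c = "\<lambda>y. \<Oplus>\<^bsub>R\<^esub>i\<in>{i \<in> I. m i = y}. \<phi> i x"
    show "?c \<in> m ` I \<rightarrow> carrier R"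
      using \<phi>c x Rg by (auto intro!: finsum_in_carrier)
    have "(\<Oplus>\<^bsub>M\<^esub>y\<in>m ` I. ?c y \<odot>\<^bsub>M\<^esub> y) =
        (\<Oplus>\<^bsub>M\<^esub>y\<in>m ` I. \<Oplus>\<^bsub>M\<^esub>i\<in>{i \<in> I. m i = y}. \<phi> i x \<odot>\<^bsub>M\<^esub> m i)"
    proof (intro finsum_eqI Mg)
      fix y assume y: "y \<in> m ` I"
      then have "y \<in> carrier M" using m by auto
      then have "?c y \<odot>\<^bsub>M\<^esub> y = (\<Oplus>\<^bsub>M\<^esub>i\<in>{i \<in> I. m i = y}. \<phi> i x \<odot>\<^bsub>M\<^esub> y)"
        using \<phi>c x by (intro finsum_smult[OF M]) auto
      also have "\<dots> = (\<Oplus>\<^bsub>M\<^esub>i\<in>{i \<in> I. m i = y}. \<phi> i x \<odot>\<^bsub>M\<^esub> m i)"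
        using \<phi>c x m by (intro finsum_eqI Mg) (auto intro!: left_module.smult_closed[OF M])
      finally show "?c y \<odot>\<^bsub>M\<^esub> y = \<dots>" .
      show "\<dots> \<in> carrier M"
        using \<phi>c x m by (intro finsum_in_carrier Mg) (auto intro!: left_module.smult_closed[OF M])
    qed
    also have "\<dots> = x"
      using finsum_group_by[OF Mg \<open>finite I\<close>, of "\<lambda>i. \<phi> i x \<odot>\<^bsub>M\<^esub> m i" m] \<phi>c x m expand[OF x]
      by (auto simp: left_module.smult_closed[OF M])
    finally show "x = (\<Oplus>\<^bsub>M\<^esub>y\<in>m ` I. ?c y \<odot>\<^bsub>M\<^esub> y)" by simp
  qed
  then show ?thesis
    using M m \<open>finite I\<close> unfolding fin_gen_def by (intro conjI exI[of _ "m ` I"]) auto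
qed

text \<open>
  To lift \<open>f : M \<rightarrow> Y\<close> along a surjection \<open>X \<rightarrow> Y\<close>, it suffices to choose preimages \<open>x i\<close>
  of the \<open>f (m i)\<close>; the functionals turn them into the homomorphism \<open>r \<mapsto> \<Sum>i. \<phi> i r \<cdot> x i\<close>.
\<close>
lemma dual_basis_imp_projective:
  assumes M: "left_module R M" and m: "\<And>i. i \<in> I \<Longrightarrow> m i \<in> carrier M"
    and \<phi>: "\<And>i. i \<in> I \<Longrightarrow> \<phi> i \<in> mod_hom R M (nat_bimod R)"
    and expand: "\<And>x. x \<in> carrier M \<Longrightarrow> (\<Oplus>\<^bsub>M\<^esub>i\<in>I. \<phi> i x \<odot>\<^bsub>M\<^esub> m i) = x"
  shows "projective_mod TYPE('u::infinite) R M"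
  unfolding projective_mod_def
proof (intro conjI allI impI ballI M)
  fix X Y :: "('a, 'u) module" and g f
  assume X: "left_module R X" and Y: "left_module R Y" and g: "g \<in> mod_hom R X Y"
    and surj: "g ` carrier X = carrier Y" and f: "f \<in> mod_hom R M Y"
  have \<phi>c: "\<phi> i x \<in> carrier R" if "i \<in> I" "x \<in> carrier M" for i x
    using mod_hom_closed[OF \<phi>] that by fastforce
  have "\<forall>i\<in>I. \<exists>x\<in>carrier X. g x = f (m i)"
    using surj mod_hom_closed[OF f m] by (metis imageE)
  then obtain x where x: "\<And>i. i \<in> I \<Longrightarrow> x i \<in> carrier X" "\<And>i. i \<in> I \<Longrightarrow> g (x i) = f (m i)"
    by metis
  let ?h = "\<lambda>r\<in>carrier M. \<Oplus>\<^bsub>X\<^esub>i\<in>I. (\<lambda>r\<in>carrier M. \<phi> i r \<odot>\<^bsub>X\<^esub> x i) r"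
  have h: "?h \<in> mod_hom R M X"
    by (intro hom_finsum_closed M X hom_smult_const \<phi> x(1))
  have "g (?h r) = f r" if r: "r \<in> carrier M" for r
  proof -
    have "g (?h r) = (\<Oplus>\<^bsub>Y\<^esub>i\<in>I. g (\<phi> i r \<odot>\<^bsub>X\<^esub> x i))"
      using r x \<phi>c by (simp add: mod_hom_finsum[OF X Y g] left_module.smult_closed[OF X])
    also have "\<dots> = (\<Oplus>\<^bsub>Y\<^esub>i\<in>I. f (\<phi> i r \<odot>\<^bsub>M\<^esub> m i))"
      using r x \<phi>c m by (intro finsum_eqI left_module_abelian_group[OF Y])
        (auto simp: mod_hom_smult[OF g] mod_hom_smult[OF f] mod_hom_closed[OF f]
          left_module.smult_closed[OF Y])
    also have "\<dots> = f r"
      using r \<phi>c m by (simp add: mod_hom_finsum[OF M Y f, symmetric] left_module.smult_closed[OF M] expand)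
    finally show ?thesis .
  qed
  then have "compose (carrier M) g ?h = f"
    using mod_hom_extensional[OF f] by (intro extensionalityI[of _ "carrier M"]) (auto simp: compose_eq)
  then show "\<exists>h\<in>mod_hom R M X. compose (carrier M) g h = f" using h by blast
qed

text \<open>
  Each \<open>x\<close> is a sum of values of homomorphisms from \<open>M\<close>, namely
  \<open>x = (\<Sum>i. \<phi> i (m i) \<cdot> x)\<close>, and the \<open>i\<close>-th summand is the value at \<open>m i\<close> of
  \<open>r \<mapsto> \<phi> i r \<cdot> x\<close>. Two maps that agree after composition with all of these agree at \<open>x\<close>.
\<close>
lemma unit_trace_imp_generator:
  assumes M: "left_module R M" and m: "\<And>i. i \<in> I \<Longrightarrow> m i \<in> carrier M"
    and \<phi>: "\<And>i. i \<in> I \<Longrightarrow> \<phi> i \<in> mod_hom R M (nat_bimod R)"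
    and trace: "(\<Oplus>\<^bsub>R\<^esub>i\<in>I. \<phi> i (m i)) = \<one>\<^bsub>R\<^esub>"
  shows "generator_mod TYPE('u::infinite) R M"
  unfolding generator_mod_def
proof (intro conjI allI impI ballI M)
  fix X Y :: "('a, 'u) module" and f g
  assume X: "left_module R X" and Y: "left_module R Y" and f: "f \<in> mod_hom R X Y"
    and g: "g \<in> mod_hom R X Y" and "f \<noteq> g"
  show "\<exists>h\<in>mod_hom R M X. compose (carrier M) f h \<noteq> compose (carrier M) g h"
  proof (rule ccontr)
    assume "\<not> ?thesis"
    then have eq: "f (h r) = g (h r)" if "h \<in> mod_hom R M X" "r \<in> carrier M" for h r
      using that by (metis compose_eq)
    have \<phi>c: "\<phi> i (m i) \<in> carrier R" if "i \<in> I" for i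
      using mod_hom_closed[OF \<phi> m] that by fastforce
    have "f x = g x" if x: "x \<in> carrier X" for x
    proof -
      have x': "(\<Oplus>\<^bsub>X\<^esub>i\<in>I. \<phi> i (m i) \<odot>\<^bsub>X\<^esub> x) = x"
        using finsum_smult[OF X x, of I "\<lambda>i. \<phi> i (m i)"] \<phi>c x trace left_module.smult_one[OF X] by simp
      have "(\<Oplus>\<^bsub>Y\<^esub>i\<in>I. f (\<phi> i (m i) \<odot>\<^bsub>X\<^esub> x)) = (\<Oplus>\<^bsub>Y\<^esub>i\<in>I. g (\<phi> i (m i) \<odot>\<^bsub>X\<^esub> x))"
        using eq[OF hom_smult_const[OF X \<phi> x M] m] m \<phi>c x
        by (intro finsum_eqI left_module_abelian_group[OF Y])
          (auto simp: mod_hom_closed[OF g] left_module.smult_closed[OF X])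
      then show ?thesis
        using mod_hom_finsum[OF X Y f, of I "\<lambda>i. \<phi> i (m i) \<odot>\<^bsub>X\<^esub> x"]
          mod_hom_finsum[OF X Y g, of I "\<lambda>i. \<phi> i (m i) \<odot>\<^bsub>X\<^esub> x"] x' \<phi>c x
        by (simp add: left_module.smult_closed[OF X])
    qed
    with \<open>f \<noteq> g\<close> show False using mod_hom_eqI[OF f g] by blast
  qed
qed

section \<open>Morita equivalence given by a full idempotent\<close>

text \<open>
  The inverse functor below produces modules of tuples, while a Morita equivalence is required to
  stay within modules with elements in the universe \<open>'u\<close>. Because \<open>'u\<close> is infinite, finite tuples
  over it can be coded by its elements.
\<close>
lemma finite_tuples_inj:
  assumes "finite I"
  shows "\<exists>c :: ('i \<Rightarrow> 'u::infinite) \<Rightarrow> 'u. inj_on c (I \<rightarrow>\<^sub>E UNIV)"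
  using assms
proof (induction I)
  case empty
  show ?case by auto
next
  case (insert i I)
  then obtain c :: "('i \<Rightarrow> 'u) \<Rightarrow> 'u" where c: "inj_on c (I \<rightarrow>\<^sub>E UNIV)" by blast
  obtain p :: "'u \<times> 'u \<Rightarrow> 'u" where p: "inj p"
    using card_of_Times_same_infinite[of "UNIV :: 'u set"] infinite_UNIV
      card_of_ordLeq[of "UNIV \<times> UNIV :: ('u \<times> 'u) set" "UNIV :: 'u set"]
    by (auto dest: ordIso_imp_ordLeq)
  have "inj_on (\<lambda>x. p (x i, c (restrict x I))) (insert i I \<rightarrow>\<^sub>E UNIV)"
  proof (rule inj_onI)
    fix x y assume x: "x \<in> insert i I \<rightarrow>\<^sub>E UNIV" and y: "y \<in> insert i I \<rightarrow>\<^sub>E UNIV"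
      and eq: "p (x i, c (restrict x I)) = p (y i, c (restrict y I))"
    have "x i = y i" "c (restrict x I) = c (restrict y I)"
      using injD[OF p eq] by auto
    moreover have "restrict x I = restrict y I"
      using calculation(2) by (intro inj_onD[OF c]) auto
    ultimately have "\<forall>j\<in>insert i I. x j = y j" by (metis insertE restrict_apply')
    then show "x = y" using x y by (intro PiE_ext) auto
  qed
  then show ?case by blast
qed

definition tuple_code :: "'i set \<Rightarrow> ('i \<Rightarrow> 'u::infinite) \<Rightarrow> 'u"
  where "tuple_code I = (SOME c. inj_on c (I \<rightarrow>\<^sub>E UNIV))"

definition entry :: "'i set \<Rightarrow> 'u::infinite \<Rightarrow> 'i \<Rightarrow> 'u"
  where "entry I = the_inv_into (I \<rightarrow>\<^sub>E UNIV) (tuple_code I)"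

lemma entry_tuple_code:
  assumes "finite I" "x \<in> extensional I"
  shows "entry I (tuple_code I x) = x"
proof -
  have "inj_on (tuple_code I :: ('a \<Rightarrow> 'b) \<Rightarrow> 'b) (I \<rightarrow>\<^sub>E UNIV)"
    using finite_tuples_inj[OF assms(1)] unfolding tuple_code_def by (rule someI_ex)
  then show ?thesis
    using assms(2) unfolding entry_def by (intro the_inv_into_f_f) (auto simp: PiE_def)
qed

text \<open>
  The map \<open>\<iota>\<close> identifies \<open>T\<close> with the corner \<open>e S e\<close> at \<open>e = \<iota> 1\<close>, and
  \<open>(\<Sum>i. u i \<cdot> v i) = 1\<close> with \<open>u i \<in> S e\<close> and \<open>v i \<in> e S\<close> says that \<open>e\<close> is full, that is,
  \<open>S e S = S\<close>. Keeping \<open>T\<close> separate from the corner lets \<open>T\<close> be any ring isomorphic to it.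
\<close>
locale full_corner = S: ring S + T: ring T
  for S :: "('s, 'e) ring_scheme" and T :: "('t, 'f) ring_scheme" +
  fixes \<iota> :: "'t \<Rightarrow> 's" and I :: "'i set" and u v :: "'i \<Rightarrow> 's"
  assumes \<iota>_closed: "t \<in> carrier T \<Longrightarrow> \<iota> t \<in> carrier S"
    and \<iota>_add: "\<lbrakk>t \<in> carrier T; t' \<in> carrier T\<rbrakk> \<Longrightarrow> \<iota> (t \<oplus>\<^bsub>T\<^esub> t') = \<iota> t \<oplus>\<^bsub>S\<^esub> \<iota> t'"
    and \<iota>_mult: "\<lbrakk>t \<in> carrier T; t' \<in> carrier T\<rbrakk> \<Longrightarrow> \<iota> (t \<otimes>\<^bsub>T\<^esub> t') = \<iota> t \<otimes>\<^bsub>S\<^esub> \<iota> t'"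
    and \<iota>_inj: "inj_on \<iota> (carrier T)"
    and \<iota>_onto: "s \<in> carrier S \<Longrightarrow> \<iota> \<one>\<^bsub>T\<^esub> \<otimes>\<^bsub>S\<^esub> s \<otimes>\<^bsub>S\<^esub> \<iota> \<one>\<^bsub>T\<^esub> \<in> \<iota> ` carrier T"
    and finite_I: "finite I"
    and u_closed: "i \<in> I \<Longrightarrow> u i \<in> carrier S"
    and v_closed: "i \<in> I \<Longrightarrow> v i \<in> carrier S"
    and u_e: "i \<in> I \<Longrightarrow> u i \<otimes>\<^bsub>S\<^esub> \<iota> \<one>\<^bsub>T\<^esub> = u i"
    and e_v: "i \<in> I \<Longrightarrow> \<iota> \<one>\<^bsub>T\<^esub> \<otimes>\<^bsub>S\<^esub> v i = v i"
    and full: "(\<Oplus>\<^bsub>S\<^esub>i\<in>I. u i \<otimes>\<^bsub>S\<^esub> v i) = \<one>\<^bsub>S\<^esub>"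
begin

abbreviation e :: 's
  where "e \<equiv> \<iota> \<one>\<^bsub>T\<^esub>"

lemma e_closed: "e \<in> carrier S"
  and e_\<iota>: "t \<in> carrier T \<Longrightarrow> e \<otimes>\<^bsub>S\<^esub> \<iota> t = \<iota> t"
  and \<iota>_e: "t \<in> carrier T \<Longrightarrow> \<iota> t \<otimes>\<^bsub>S\<^esub> e = \<iota> t"
  by (simp_all add: \<iota>_closed flip: \<iota>_mult)

lemmas closed = \<iota>_closed e_closed u_closed v_closed

definition \<kappa> :: "'s \<Rightarrow> 't"
  where "\<kappa> = the_inv_into (carrier T) \<iota>"

lemma \<kappa>_\<iota>: "t \<in> carrier T \<Longrightarrow> \<kappa> (\<iota> t) = t"
  unfolding \<kappa>_def by (rule the_inv_into_f_f[OF \<iota>_inj])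

lemma
  assumes "s \<in> carrier S" "e \<otimes>\<^bsub>S\<^esub> s = s" "s \<otimes>\<^bsub>S\<^esub> e = s"
  shows \<kappa>_closed: "\<kappa> s \<in> carrier T" and \<iota>_\<kappa>: "\<iota> (\<kappa> s) = s"
proof -
  obtain t where "t \<in> carrier T" "s = \<iota> t"
    using \<iota>_onto[OF assms(1)] assms by auto
  then show "\<kappa> s \<in> carrier T" "\<iota> (\<kappa> s) = s" by (simp_all add: \<kappa>_\<iota>)
qed

lemma \<iota>_finsum:
  assumes "\<And>j. j \<in> J \<Longrightarrow> c j \<in> carrier T"
  shows "\<iota> (\<Oplus>\<^bsub>T\<^esub>j\<in>J. c j) = (\<Oplus>\<^bsub>S\<^esub>j\<in>J. \<iota> (c j))"
  using assms \<iota>_closed \<iota>_add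
  by (intro additive_finsum T.is_abelian_group S.is_abelian_group) auto

text \<open>
  Products \<open>v i \<cdot> s \<cdot> u j\<close> lie in the corner, so every \<open>s\<close> acts on \<open>I\<close>-tuples over a
  \<open>T\<close>-module by the matrix \<open>coef _ s _\<close>. The matrix of \<open>1\<close> is an idempotent, in general not the
  identity; its image on tuples over \<open>N\<close> is a copy of \<open>S e \<otimes>\<^sub>T N\<close>, in which \<open>s \<otimes> n\<close>
  corresponds to the tuple of the \<open>(v i \<cdot> s) \<cdot> n\<close>. In the same way \<open>col\<close> represents \<open>e\<close> as a
  column and \<open>row\<close> is the map \<open>e S e \<otimes>\<^sub>T N \<rightarrow> N\<close>.
\<close>
definition coef :: "'i \<Rightarrow> 's \<Rightarrow> 'i \<Rightarrow> 't"
  where "coef i s j = \<kappa> (v i \<otimes>\<^bsub>S\<^esub> s \<otimes>\<^bsub>S\<^esub> u j)"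

definition col :: "'i \<Rightarrow> 't"
  where "col i = \<kappa> (v i \<otimes>\<^bsub>S\<^esub> e)"

definition row :: "'i \<Rightarrow> 't"
  where "row j = \<kappa> (e \<otimes>\<^bsub>S\<^esub> u j)"

lemma
  assumes "i \<in> I" "j \<in> I" "s \<in> carrier S"
  shows coef_closed: "coef i s j \<in> carrier T"
    and \<iota>_coef: "\<iota> (coef i s j) = v i \<otimes>\<^bsub>S\<^esub> s \<otimes>\<^bsub>S\<^esub> u j"
  unfolding coef_def using assms u_e[of j] e_v[of i] closed
  by (auto intro!: \<kappa>_closed \<iota>_\<kappa>) (simp_all add: S.m_assoc flip: S.m_assoc[of e])

lemma
  assumes "i \<in> I"
  shows col_closed: "col i \<in> carrier T" and \<iota>_col: "\<iota> (col i) = v i \<otimes>\<^bsub>S\<^esub> e"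
    and row_closed: "row i \<in> carrier T" and \<iota>_row: "\<iota> (row i) = e \<otimes>\<^bsub>S\<^esub> u i"
  unfolding col_def row_def using assms u_e[of i] e_v[of i] closed \<iota>_e[of "\<one>\<^bsub>T\<^esub>"]
  by (auto intro!: \<kappa>_closed \<iota>_\<kappa>) (simp_all add: S.m_assoc flip: S.m_assoc[of e])

lemmas closed' = closed coef_closed col_closed row_closed

lemma \<iota>_eqI: "\<lbrakk>t \<in> carrier T; t' \<in> carrier T; \<iota> t = \<iota> t'\<rbrakk> \<Longrightarrow> t = t'"
  using inj_onD[OF \<iota>_inj] by blast

lemma coef_add:
  assumes "i \<in> I" "j \<in> I" "s \<in> carrier S" "s' \<in> carrier S"
  shows "coef i (s \<oplus>\<^bsub>S\<^esub> s') j = coef i s j \<oplus>\<^bsub>T\<^esub> coef i s' j"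
  using assms by (intro \<iota>_eqI) (simp_all add: closed' \<iota>_add \<iota>_coef S.l_distr S.r_distr)

lemma coef_\<iota>:
  assumes "i \<in> I" "j \<in> I" "t \<in> carrier T"
  shows "coef i (\<iota> t) j = col i \<otimes>\<^bsub>T\<^esub> t \<otimes>\<^bsub>T\<^esub> row j"
proof (rule \<iota>_eqI)
  have "\<iota> (col i \<otimes>\<^bsub>T\<^esub> t \<otimes>\<^bsub>T\<^esub> row j) = v i \<otimes>\<^bsub>S\<^esub> e \<otimes>\<^bsub>S\<^esub> \<iota> t \<otimes>\<^bsub>S\<^esub> (e \<otimes>\<^bsub>S\<^esub> u j)"
    using assms by (simp add: closed' \<iota>_mult \<iota>_col \<iota>_row)
  also have "\<dots> = v i \<otimes>\<^bsub>S\<^esub> (e \<otimes>\<^bsub>S\<^esub> \<iota> t \<otimes>\<^bsub>S\<^esub> e) \<otimes>\<^bsub>S\<^esub> u j"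
    using assms by (simp add: closed' S.m_assoc)
  finally show "\<iota> (coef i (\<iota> t) j) = \<iota> (col i \<otimes>\<^bsub>T\<^esub> t \<otimes>\<^bsub>T\<^esub> row j)"
    using assms by (simp add: closed' \<iota>_coef e_\<iota> \<iota>_e)
qed (use assms in \<open>simp_all add: closed'\<close>)

text \<open>
  Inserting \<open>(\<Sum>j. u j \<cdot> v j) = 1\<close> between two factors makes \<open>coef\<close> multiplicative, with matrix
  product on one side and the product of \<open>S\<close> on the other.
\<close>
lemma sum_through_full:
  assumes a: "a \<in> carrier S" and b: "b \<in> carrier S"
  shows "(\<Oplus>\<^bsub>S\<^esub>j\<in>I. (a \<otimes>\<^bsub>S\<^esub> u j) \<otimes>\<^bsub>S\<^esub> (v j \<otimes>\<^bsub>S\<^esub> b)) = a \<otimes>\<^bsub>S\<^esub> b"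
proof -
  have "(\<Oplus>\<^bsub>S\<^esub>j\<in>I. (a \<otimes>\<^bsub>S\<^esub> u j) \<otimes>\<^bsub>S\<^esub> (v j \<otimes>\<^bsub>S\<^esub> b)) = (\<Oplus>\<^bsub>S\<^esub>j\<in>I. a \<otimes>\<^bsub>S\<^esub> (u j \<otimes>\<^bsub>S\<^esub> v j) \<otimes>\<^bsub>S\<^esub> b)"
    using a b by (intro finsum_eqI S.is_abelian_group) (simp_all add: closed S.m_assoc)
  also have "\<dots> = a \<otimes>\<^bsub>S\<^esub> (\<Oplus>\<^bsub>S\<^esub>j\<in>I. u j \<otimes>\<^bsub>S\<^esub> v j) \<otimes>\<^bsub>S\<^esub> b"
    using a b closed finite_I by (simp add: S.finsum_ldistr S.finsum_rdistr Pi_def)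
  finally show ?thesis using a b full by simp
qed

lemma coef_mult:
  assumes "i \<in> I" "k \<in> I" "s \<in> carrier S" "s' \<in> carrier S"
  shows "(\<Oplus>\<^bsub>T\<^esub>j\<in>I. coef i s j \<otimes>\<^bsub>T\<^esub> coef j s' k) = coef i (s \<otimes>\<^bsub>S\<^esub> s') k"
proof (rule \<iota>_eqI)
  have "\<iota> (\<Oplus>\<^bsub>T\<^esub>j\<in>I. coef i s j \<otimes>\<^bsub>T\<^esub> coef j s' k)
      = (\<Oplus>\<^bsub>S\<^esub>j\<in>I. (v i \<otimes>\<^bsub>S\<^esub> s \<otimes>\<^bsub>S\<^esub> u j) \<otimes>\<^bsub>S\<^esub> (v j \<otimes>\<^bsub>S\<^esub> (s' \<otimes>\<^bsub>S\<^esub> u k)))"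
    using assms by (subst \<iota>_finsum)
      (auto simp: closed' \<iota>_mult \<iota>_coef S.m_assoc intro!: finsum_eqI S.is_abelian_group)
  also have "\<dots> = v i \<otimes>\<^bsub>S\<^esub> s \<otimes>\<^bsub>S\<^esub> (s' \<otimes>\<^bsub>S\<^esub> u k)"
    using assms by (intro sum_through_full) (simp_all add: closed)
  finally show "\<iota> (\<Oplus>\<^bsub>T\<^esub>j\<in>I. coef i s j \<otimes>\<^bsub>T\<^esub> coef j s' k) = \<iota> (coef i (s \<otimes>\<^bsub>S\<^esub> s') k)"
    using assms by (simp add: closed \<iota>_coef S.m_assoc)
qed (use assms in \<open>auto intro!: finsum_in_carrier T.is_abelian_group simp: closed'\<close>)

lemma coef_col:
  assumes "i \<in> I"
  shows "(\<Oplus>\<^bsub>T\<^esub>j\<in>I. coef i \<one>\<^bsub>S\<^esub> j \<otimes>\<^bsub>T\<^esub> col j) = col i"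
proof (rule \<iota>_eqI)
  have "\<iota> (\<Oplus>\<^bsub>T\<^esub>j\<in>I. coef i \<one>\<^bsub>S\<^esub> j \<otimes>\<^bsub>T\<^esub> col j)
      = (\<Oplus>\<^bsub>S\<^esub>j\<in>I. (v i \<otimes>\<^bsub>S\<^esub> u j) \<otimes>\<^bsub>S\<^esub> (v j \<otimes>\<^bsub>S\<^esub> e))"
    using assms by (subst \<iota>_finsum)
      (auto simp: closed' \<iota>_mult \<iota>_coef \<iota>_col intro!: finsum_eqI S.is_abelian_group)
  then show "\<iota> (\<Oplus>\<^bsub>T\<^esub>j\<in>I. coef i \<one>\<^bsub>S\<^esub> j \<otimes>\<^bsub>T\<^esub> col j) = \<iota> (col i)"
    using assms by (simp add: closed \<iota>_col sum_through_full)
qed (use assms in \<open>auto intro!: finsum_in_carrier T.is_abelian_group simp: closed'\<close>)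

lemma row_col: "(\<Oplus>\<^bsub>T\<^esub>j\<in>I. row j \<otimes>\<^bsub>T\<^esub> col j) = \<one>\<^bsub>T\<^esub>"
proof (rule \<iota>_eqI)
  have "\<iota> (\<Oplus>\<^bsub>T\<^esub>j\<in>I. row j \<otimes>\<^bsub>T\<^esub> col j)
      = (\<Oplus>\<^bsub>S\<^esub>j\<in>I. (e \<otimes>\<^bsub>S\<^esub> u j) \<otimes>\<^bsub>S\<^esub> (v j \<otimes>\<^bsub>S\<^esub> e))"
    by (subst \<iota>_finsum)
      (auto simp: closed' \<iota>_mult \<iota>_row \<iota>_col intro!: finsum_eqI S.is_abelian_group)
  then show "\<iota> (\<Oplus>\<^bsub>T\<^esub>j\<in>I. row j \<otimes>\<^bsub>T\<^esub> col j) = e"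
    by (simp add: closed sum_through_full \<iota>_e)
qed (auto intro!: finsum_in_carrier T.is_abelian_group simp: closed')

lemma matrix_vector_assoc:
  assumes N: "left_module T N" and "finite J" and "\<And>j. j \<in> J \<Longrightarrow> c j \<in> carrier T"
    and "\<And>j k. j \<in> J \<Longrightarrow> k \<in> K \<Longrightarrow> d j k \<in> carrier T" and "\<And>k. k \<in> K \<Longrightarrow> x k \<in> carrier N"
  shows "(\<Oplus>\<^bsub>N\<^esub>j\<in>J. c j \<odot>\<^bsub>N\<^esub> (\<Oplus>\<^bsub>N\<^esub>k\<in>K. d j k \<odot>\<^bsub>N\<^esub> x k))
    = (\<Oplus>\<^bsub>N\<^esub>k\<in>K. (\<Oplus>\<^bsub>T\<^esub>j\<in>J. c j \<otimes>\<^bsub>T\<^esub> d j k) \<odot>\<^bsub>N\<^esub> x k)"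
proof -
  note N' = left_module_abelian_group[OF N]
  have "(\<Oplus>\<^bsub>N\<^esub>j\<in>J. c j \<odot>\<^bsub>N\<^esub> (\<Oplus>\<^bsub>N\<^esub>k\<in>K. d j k \<odot>\<^bsub>N\<^esub> x k))
      = (\<Oplus>\<^bsub>N\<^esub>j\<in>J. \<Oplus>\<^bsub>N\<^esub>k\<in>K. (c j \<otimes>\<^bsub>T\<^esub> d j k) \<odot>\<^bsub>N\<^esub> x k)"
    using assms by (intro finsum_eqI finsum_in_carrier N')
      (auto simp: smult_finsum[OF N] left_module.smult_closed[OF N] left_module.smult_assoc1[OF N]
        intro!: finsum_eqI N')
  also have "\<dots> = (\<Oplus>\<^bsub>N\<^esub>k\<in>K. \<Oplus>\<^bsub>N\<^esub>j\<in>J. (c j \<otimes>\<^bsub>T\<^esub> d j k) \<odot>\<^bsub>N\<^esub> x k)"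
    using assms by (intro finsum_swap N') (auto simp: left_module.smult_closed[OF N])
  also have "\<dots> = (\<Oplus>\<^bsub>N\<^esub>k\<in>K. (\<Oplus>\<^bsub>T\<^esub>j\<in>J. c j \<otimes>\<^bsub>T\<^esub> d j k) \<odot>\<^bsub>N\<^esub> x k)"
    using assms by (intro finsum_eqI N')
      (auto simp: finsum_smult[OF N] N' intro!: left_module.smult_closed[OF N] finsum_in_carrier T.is_abelian_group)
  finally show ?thesis .
qed

text \<open>
  The functor from \<open>S\<close>-modules to \<open>T\<close>-modules is \<open>M \<mapsto> e M\<close>. As \<open>e\<close> is idempotent, \<open>e M\<close>
  consists of the elements fixed by \<open>e\<close>.
\<close>
definition corner :: "('s, 'm) module \<Rightarrow> ('t, 'm) module"
  where "corner M =
    \<lparr>carrier = {x \<in> carrier M. e \<odot>\<^bsub>M\<^esub> x = x}, monoid.mult = monoid.mult M, one = one M,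
     zero = zero M, add = add M, smult = (\<lambda>t x. \<iota> t \<odot>\<^bsub>M\<^esub> x)\<rparr>"

lemma corner_simps [simp]:
  "x \<in> carrier (corner M) \<longleftrightarrow> x \<in> carrier M \<and> e \<odot>\<^bsub>M\<^esub> x = x"
  "zero (corner M) = zero M" "add (corner M) = add M"
  "smult (corner M) t x = \<iota> t \<odot>\<^bsub>M\<^esub> x"
  by (simp_all add: corner_def)

lemma left_module_corner:
  assumes M: "left_module S M"
  shows "left_module T (corner M)"
proof -
  interpret M: abelian_group M by (rule left_module_abelian_group[OF M])
  note sm = left_module.smult_closed[OF M] left_module.smult_r_distr[OF M]
    left_module.smult_assoc1[OF M, symmetric] left_module.smult_l_distr[OF M]
  have e0: "e \<odot>\<^bsub>M\<^esub> \<zero>\<^bsub>M\<^esub> = \<zero>\<^bsub>M\<^esub>"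
    using additive_zero[OF M.abelian_group_axioms M.abelian_group_axioms, of "\<lambda>x. e \<odot>\<^bsub>M\<^esub> x"]
    by (auto simp: sm closed)
  have "abelian_group (corner M)"
  proof (rule abelian_groupI)
    fix x assume x: "x \<in> carrier (corner M)"
    have "e \<odot>\<^bsub>M\<^esub> (\<ominus>\<^bsub>M\<^esub> x) \<oplus>\<^bsub>M\<^esub> x = e \<odot>\<^bsub>M\<^esub> (\<ominus>\<^bsub>M\<^esub> x \<oplus>\<^bsub>M\<^esub> x)"
      using x by (simp add: sm closed)
    also have "\<dots> = \<zero>\<^bsub>M\<^esub>" using x by (simp add: M.l_neg e0)
    finally have "e \<odot>\<^bsub>M\<^esub> (\<ominus>\<^bsub>M\<^esub> x) = \<ominus>\<^bsub>M\<^esub> x"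
      using x by (metis M.a_inv_closed M.minus_equality corner_simps(1) e_closed sm(1))
    then show "\<exists>y\<in>carrier (corner M). y \<oplus>\<^bsub>corner M\<^esub> x = \<zero>\<^bsub>corner M\<^esub>"
      using x by (intro bexI[of _ "\<ominus>\<^bsub>M\<^esub> x"]) (simp_all add: M.l_neg)
  qed (auto simp: sm closed e0 M.a_ac)
  then show ?thesis
    using T.ring_axioms
    by (auto simp: left_module_def left_module_axioms_def sm closed \<iota>_add \<iota>_mult e_\<iota>)
qed

lemma finsum_corner:
  assumes M: "left_module S M" and "\<And>j. j \<in> J \<Longrightarrow> x j \<in> carrier (corner M)"
  shows "(\<Oplus>\<^bsub>corner M\<^esub>j\<in>J. x j) = (\<Oplus>\<^bsub>M\<^esub>j\<in>J. x j)"
  using assms by (intro additive_finsum[where h = "\<lambda>x. x"]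
      left_module_abelian_group[OF M] left_module_abelian_group[OF left_module_corner[OF M]]) auto

definition corner_map :: "('s, 'm) module \<Rightarrow> ('s, 'n) module \<Rightarrow> ('m \<Rightarrow> 'n) \<Rightarrow> 'm \<Rightarrow> 'n"
  where "corner_map M N f = restrict f (carrier (corner M))"

lemma corner_map_closed:
  assumes "f \<in> mod_hom S M N" "x \<in> carrier (corner M)"
  shows "f x \<in> carrier (corner N)"
  using assms mod_hom_smult[OF assms(1) e_closed, of x] by (auto simp: mod_hom_closed)

lemma additive_functor_corner: "additive_functor S T corner corner_map"
  unfolding additive_functor_def
proof (intro conjI allI impI ballI)
  fix M :: "('s, 'u) module" assume M: "left_module S M"
  show "left_module T (corner M)" by (rule left_module_corner[OF M])
  show "corner_map M M (id_hom M) = id_hom (corner M)"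
    by (auto simp: corner_map_def id_hom_def)
next
  fix M N :: "('s, 'u) module" and f
  assume M: "left_module S M" and N: "left_module S N" and f: "f \<in> mod_hom S M N"
  show "corner_map M N f \<in> mod_hom T (corner M) (corner N)"
  proof (rule mod_homI)
    note C = left_module.smult_closed[OF left_module_corner[OF M]]
      abelian_monoid.a_closed[OF abelian_group.axioms(1)[OF left_module_abelian_group[OF left_module_corner[OF M]]]]
    show "corner_map M N f x \<in> carrier (corner N)" if "x \<in> carrier (corner M)" for x
      using that corner_map_closed[OF f that] by (simp add: corner_map_def)
    show "corner_map M N f (x \<oplus>\<^bsub>corner M\<^esub> y) = corner_map M N f x \<oplus>\<^bsub>corner N\<^esub> corner_map M N f y"
      if "x \<in> carrier (corner M)" "y \<in> carrier (corner M)" for x y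
      using that mod_hom_add[OF f, of x y] C(2)[OF that] by (simp add: corner_map_def)
    show "corner_map M N f (t \<odot>\<^bsub>corner M\<^esub> x) = t \<odot>\<^bsub>corner N\<^esub> corner_map M N f x"
      if "t \<in> carrier T" "x \<in> carrier (corner M)" for t x
      using that mod_hom_smult[OF f, of "\<iota> t" x] C(1)[OF that] by (simp add: corner_map_def closed)
  qed (simp add: corner_map_def)
  fix g assume "g \<in> mod_hom S M N"
  show "corner_map M N (hom_add M N f g)
      = hom_add (corner M) (corner N) (corner_map M N f) (corner_map M N g)"
    by (auto simp: corner_map_def hom_add_def)
next
  fix M N P :: "('s, 'u) module" and f g
  assume "f \<in> mod_hom S M N"
  then show "corner_map M P (compose (carrier M) g f)
      = compose (carrier (corner M)) (corner_map N P g) (corner_map M N f)"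
    using corner_map_closed by (fastforce simp: corner_map_def compose_def)
qed

definition act :: "('t, 'm, 'g) module_scheme \<Rightarrow> 's \<Rightarrow> ('i \<Rightarrow> 'm) \<Rightarrow> 'i \<Rightarrow> 'm"
  where "act N s x = (\<lambda>i\<in>I. \<Oplus>\<^bsub>N\<^esub>j\<in>I. coef i s j \<odot>\<^bsub>N\<^esub> x j)"

text \<open>The image of the idempotent matrix of \<open>1\<close>, again as a set of fixed points.\<close>
definition tuples :: "('t, 'm, 'g) module_scheme \<Rightarrow> ('i \<Rightarrow> 'm) set"
  where "tuples N = {x \<in> I \<rightarrow>\<^sub>E carrier N. act N \<one>\<^bsub>S\<^esub> x = x}"

lemma act_closed:
  assumes N: "left_module T N" and "s \<in> carrier S" "x \<in> I \<rightarrow>\<^sub>E carrier N"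
  shows "act N s x \<in> I \<rightarrow>\<^sub>E carrier N"
  using assms PiE_mem[OF assms(3)] by (auto simp: act_def closed' left_module.smult_closed[OF N]
      intro!: finsum_in_carrier left_module_abelian_group[OF N])

lemma act_act:
  assumes N: "left_module T N" and "s \<in> carrier S" "s' \<in> carrier S" "x \<in> I \<rightarrow>\<^sub>E carrier N"
  shows "act N s (act N s' x) = act N (s \<otimes>\<^bsub>S\<^esub> s') x"
proof (rule extensionalityI[of _ I])
  note N' = left_module_abelian_group[OF N]
  fix i assume i: "i \<in> I"
  have "act N s (act N s' x) i
      = (\<Oplus>\<^bsub>N\<^esub>j\<in>I. coef i s j \<odot>\<^bsub>N\<^esub> (\<Oplus>\<^bsub>N\<^esub>k\<in>I. coef j s' k \<odot>\<^bsub>N\<^esub> x k))"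
    using assms i unfolding act_def
    by (auto intro!: finsum_eqI finsum_in_carrier left_module.smult_closed[OF N] N' simp: closed')
  also have "\<dots> = (\<Oplus>\<^bsub>N\<^esub>k\<in>I. (\<Oplus>\<^bsub>T\<^esub>j\<in>I. coef i s j \<otimes>\<^bsub>T\<^esub> coef j s' k) \<odot>\<^bsub>N\<^esub> x k)"
    using assms i by (intro matrix_vector_assoc N finite_I) (auto simp: closed')
  also have "\<dots> = act N (s \<otimes>\<^bsub>S\<^esub> s') x i"
    using assms i unfolding act_def
    by (auto intro!: finsum_eqI left_module.smult_closed[OF N] N' simp: closed' coef_mult)
  finally show "act N s (act N s' x) i = act N (s \<otimes>\<^bsub>S\<^esub> s') x i" .
qed (simp_all add: act_def)

lemma act_in_tuples:
  assumes "left_module T N" "s \<in> carrier S" "x \<in> I \<rightarrow>\<^sub>E carrier N"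
  shows "act N s x \<in> tuples N"
  using assms by (simp add: tuples_def act_closed act_act)

lemma act_map:
  assumes N: "left_module T N" and P: "left_module T P" and f: "f \<in> mod_hom T N P"
    and s: "s \<in> carrier S" and x: "x \<in> I \<rightarrow>\<^sub>E carrier N"
  shows "act P s (\<lambda>i\<in>I. f (x i)) = (\<lambda>i\<in>I. f (act N s x i))"
proof (rule extensionalityI[of _ I])
  fix i assume i: "i \<in> I"
  have "f (\<Oplus>\<^bsub>N\<^esub>j\<in>I. coef i s j \<odot>\<^bsub>N\<^esub> x j) = (\<Oplus>\<^bsub>P\<^esub>j\<in>I. f (coef i s j \<odot>\<^bsub>N\<^esub> x j))"
    using assms i PiE_mem[OF x] by (intro mod_hom_finsum) (auto simp: closed' left_module.smult_closed[OF N])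
  also have "\<dots> = (\<Oplus>\<^bsub>P\<^esub>j\<in>I. coef i s j \<odot>\<^bsub>P\<^esub> (\<lambda>i\<in>I. f (x i)) j)"
    using i s PiE_mem[OF x] mod_hom_closed[OF f]
    by (intro finsum_eqI left_module_abelian_group[OF P])
      (auto simp: closed' mod_hom_smult[OF f] left_module.smult_closed[OF P])
  finally show "act P s (\<lambda>i\<in>I. f (x i)) i = (\<lambda>i\<in>I. f (act N s x i)) i"
    using i by (simp add: act_def)
qed (simp_all add: act_def)

lemma act_pointwise_add:
  assumes N: "left_module T N" and s: "s \<in> carrier S"
    and x: "x \<in> I \<rightarrow>\<^sub>E carrier N" and y: "y \<in> I \<rightarrow>\<^sub>E carrier N"
  shows "act N s (\<lambda>i\<in>I. x i \<oplus>\<^bsub>N\<^esub> y i) = (\<lambda>i\<in>I. act N s x i \<oplus>\<^bsub>N\<^esub> act N s y i)"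
proof (rule extensionalityI[of _ I])
  note N' = left_module_abelian_group[OF N]
  interpret N: abelian_group N by (rule N')
  fix i assume i: "i \<in> I"
  have "(\<Oplus>\<^bsub>N\<^esub>j\<in>I. coef i s j \<odot>\<^bsub>N\<^esub> (\<lambda>i\<in>I. x i \<oplus>\<^bsub>N\<^esub> y i) j)
      = (\<Oplus>\<^bsub>N\<^esub>j\<in>I. coef i s j \<odot>\<^bsub>N\<^esub> x j \<oplus>\<^bsub>N\<^esub> coef i s j \<odot>\<^bsub>N\<^esub> y j)"
    using i s PiE_mem[OF x] PiE_mem[OF y] by (intro finsum_eqI N')
      (auto simp: closed' left_module.smult_closed[OF N] left_module.smult_r_distr[OF N])
  also have "\<dots> = (\<Oplus>\<^bsub>N\<^esub>j\<in>I. coef i s j \<odot>\<^bsub>N\<^esub> x j) \<oplus>\<^bsub>N\<^esub> (\<Oplus>\<^bsub>N\<^esub>j\<in>I. coef i s j \<odot>\<^bsub>N\<^esub> y j)"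
    using i s PiE_mem[OF x] PiE_mem[OF y] by (intro finsum_add N') (auto simp: closed' left_module.smult_closed[OF N])
  finally show "act N s (\<lambda>i\<in>I. x i \<oplus>\<^bsub>N\<^esub> y i) i = (\<lambda>i\<in>I. act N s x i \<oplus>\<^bsub>N\<^esub> act N s y i) i"
    using i by (simp add: act_def)
qed (simp_all add: act_def)

lemma act_add:
  assumes N: "left_module T N" and s: "s \<in> carrier S" and s': "s' \<in> carrier S"
    and x: "x \<in> I \<rightarrow>\<^sub>E carrier N"
  shows "act N (s \<oplus>\<^bsub>S\<^esub> s') x = (\<lambda>i\<in>I. act N s x i \<oplus>\<^bsub>N\<^esub> act N s' x i)"
proof (rule extensionalityI[of _ I])
  note N' = left_module_abelian_group[OF N]
  interpret N: abelian_group N by (rule N')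
  fix i assume i: "i \<in> I"
  have "(\<Oplus>\<^bsub>N\<^esub>j\<in>I. coef i (s \<oplus>\<^bsub>S\<^esub> s') j \<odot>\<^bsub>N\<^esub> x j)
      = (\<Oplus>\<^bsub>N\<^esub>j\<in>I. coef i s j \<odot>\<^bsub>N\<^esub> x j \<oplus>\<^bsub>N\<^esub> coef i s' j \<odot>\<^bsub>N\<^esub> x j)"
    using i s s' PiE_mem[OF x] by (intro finsum_eqI N')
      (auto simp: closed' coef_add left_module.smult_closed[OF N] left_module.smult_l_distr[OF N])
  also have "\<dots> = (\<Oplus>\<^bsub>N\<^esub>j\<in>I. coef i s j \<odot>\<^bsub>N\<^esub> x j) \<oplus>\<^bsub>N\<^esub> (\<Oplus>\<^bsub>N\<^esub>j\<in>I. coef i s' j \<odot>\<^bsub>N\<^esub> x j)"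
    using i s s' PiE_mem[OF x] by (intro finsum_add N') (auto simp: closed' left_module.smult_closed[OF N])
  finally show "act N (s \<oplus>\<^bsub>S\<^esub> s') x i = (\<lambda>i\<in>I. act N s x i \<oplus>\<^bsub>N\<^esub> act N s' x i) i"
    using i by (simp add: act_def)
qed (simp_all add: act_def)

text \<open>
  The inverse functor \<open>N \<mapsto> S e \<otimes>\<^sub>T N\<close>. The multiplicative fields of a module record carry
  no information.
\<close>
definition induced :: "('t, 'u::infinite) module \<Rightarrow> ('s, 'u) module"
  where "induced N =
    \<lparr>carrier = tuple_code I ` tuples N, monoid.mult = undefined, one = undefined,
     zero = tuple_code I (\<lambda>i\<in>I. \<zero>\<^bsub>N\<^esub>),
     add = (\<lambda>x y. tuple_code I (\<lambda>i\<in>I. entry I x i \<oplus>\<^bsub>N\<^esub> entry I y i)),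
     smult = (\<lambda>s x. tuple_code I (act N s (entry I x)))\<rparr>"

lemma entry_code_tuples: "x \<in> tuples N \<Longrightarrow> entry I (tuple_code I x) = x"
  by (rule entry_tuple_code[OF finite_I]) (auto simp: tuples_def PiE_def)

lemma carrier_induced: "x \<in> carrier (induced N) \<longleftrightarrow> (\<exists>y\<in>tuples N. x = tuple_code I y)"
  by (auto simp: induced_def)

lemma code_in_induced: "x \<in> tuples N \<Longrightarrow> tuple_code I x \<in> carrier (induced N)"
  by (auto simp: carrier_induced)

lemma entry_in_tuples: "x \<in> carrier (induced N) \<Longrightarrow> entry I x \<in> tuples N"
  by (auto simp: carrier_induced entry_code_tuples)

lemma entry_closed: "x \<in> carrier (induced N) \<Longrightarrow> i \<in> I \<Longrightarrow> entry I x i \<in> carrier N"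
  using entry_in_tuples by (auto simp: tuples_def)

text \<open>
  Elements of an induced module are compared entry by entry. The bounded quantifier keeps the rule
  from applying to the equations between entries that it produces.
\<close>
lemma induced_eqI:
  assumes "x \<in> carrier (induced N)" "y \<in> carrier (induced N)"
    and "\<forall>i\<in>I. entry I x i = entry I y i"
  shows "x = y"
proof -
  have "entry I x = entry I y"
    using entry_in_tuples[OF assms(1)] entry_in_tuples[OF assms(2)] assms(3)
    by (intro PiE_ext[of _ I "\<lambda>_. carrier N"]) (auto simp: tuples_def)
  then show ?thesis
    using assms(1,2) by (auto simp: carrier_induced entry_code_tuples)
qed

context
  fixes N :: "('t, 'u::infinite) module"
  assumes N: "left_module T N"
begin

interpretation N: abelian_group N
  by (rule left_module_abelian_group[OF N])

lemma zero_in_tuples: "(\<lambda>i\<in>I. \<zero>\<^bsub>N\<^esub>) \<in> tuples N"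
proof -
  have "coef i \<one>\<^bsub>S\<^esub> j \<odot>\<^bsub>N\<^esub> \<zero>\<^bsub>N\<^esub> = \<zero>\<^bsub>N\<^esub>" if "i \<in> I" "j \<in> I" for i j
    using that additive_zero[OF N.abelian_group_axioms N.abelian_group_axioms, of "\<lambda>x. coef i \<one>\<^bsub>S\<^esub> j \<odot>\<^bsub>N\<^esub> x"]
    by (auto simp: closed' left_module.smult_closed[OF N] left_module.smult_r_distr[OF N])
  then have "(\<Oplus>\<^bsub>N\<^esub>j\<in>I. coef i \<one>\<^bsub>S\<^esub> j \<odot>\<^bsub>N\<^esub> (\<lambda>i\<in>I. \<zero>\<^bsub>N\<^esub>) j) = \<zero>\<^bsub>N\<^esub>" if "i \<in> I" for i
    using that finsum_eqI[OF N.abelian_group_axioms, of I "\<lambda>_. \<zero>\<^bsub>N\<^esub>" "\<lambda>j. coef i \<one>\<^bsub>S\<^esub> j \<odot>\<^bsub>N\<^esub> (\<lambda>i\<in>I. \<zero>\<^bsub>N\<^esub>) j"] by simp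
  then show ?thesis by (auto simp: tuples_def act_def)
qed

lemma add_in_tuples: "x \<in> tuples N \<Longrightarrow> y \<in> tuples N \<Longrightarrow> (\<lambda>i\<in>I. x i \<oplus>\<^bsub>N\<^esub> y i) \<in> tuples N"
  by (auto simp: tuples_def act_pointwise_add[OF N])

lemma
  assumes x: "x \<in> carrier (induced N)" and y: "y \<in> carrier (induced N)"
  shows add_in_induced: "x \<oplus>\<^bsub>induced N\<^esub> y \<in> carrier (induced N)"
    and entry_add: "i \<in> I \<Longrightarrow> entry I (x \<oplus>\<^bsub>induced N\<^esub> y) i = entry I x i \<oplus>\<^bsub>N\<^esub> entry I y i"
  using add_in_tuples[OF entry_in_tuples[OF x] entry_in_tuples[OF y]]
  by (simp_all add: induced_def entry_code_tuples)

lemma zero_in_induced: "\<zero>\<^bsub>induced N\<^esub> \<in> carrier (induced N)"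
  and entry_zero: "i \<in> I \<Longrightarrow> entry I \<zero>\<^bsub>induced N\<^esub> i = \<zero>\<^bsub>N\<^esub>"
  using zero_in_tuples by (simp_all add: induced_def entry_code_tuples)

lemma
  assumes s: "s \<in> carrier S" and x: "x \<in> carrier (induced N)"
  shows smult_in_induced: "s \<odot>\<^bsub>induced N\<^esub> x \<in> carrier (induced N)"
    and entry_smult: "entry I (s \<odot>\<^bsub>induced N\<^esub> x) = act N s (entry I x)"
  using act_in_tuples[OF N s, of "entry I x"] entry_in_tuples[OF x]
  by (simp_all add: induced_def entry_code_tuples tuples_def)

lemma left_module_induced: "left_module S (induced N)"
proof -
  note c = add_in_induced zero_in_induced smult_in_induced
  note en = entry_add entry_zero entry_smult entry_closed
  have tup: "entry I x \<in> I \<rightarrow>\<^sub>E carrier N" if "x \<in> carrier (induced N)" for x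
    using entry_in_tuples[OF that] by (simp add: tuples_def)
  have "abelian_group (induced N)"
  proof (rule abelian_groupI)
    fix x assume x: "x \<in> carrier (induced N)"
    \<comment> \<open>Negation is the action of \<open>-1\<close>, as \<open>act N s\<close> is additive in \<open>s\<close>.\<close>
    let ?y = "(\<ominus>\<^bsub>S\<^esub> \<one>\<^bsub>S\<^esub>) \<odot>\<^bsub>induced N\<^esub> x"
    have "?y \<oplus>\<^bsub>induced N\<^esub> x = \<zero>\<^bsub>induced N\<^esub>"
    proof (rule induced_eqI[where N = N, OF _ _ ballI])
      fix i assume i: "i \<in> I"
      have sum: "act N (s \<oplus>\<^bsub>S\<^esub> s') (entry I x) i = act N s (entry I x) i \<oplus>\<^bsub>N\<^esub> act N s' (entry I x) i"
        if "s \<in> carrier S" "s' \<in> carrier S" for s s'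
        using fun_cong[OF act_add[OF N that tup[OF x]], of i] i by (simp only: restrict_apply')
      have "entry I (?y \<oplus>\<^bsub>induced N\<^esub> x) i = act N (\<ominus>\<^bsub>S\<^esub> \<one>\<^bsub>S\<^esub>) (entry I x) i \<oplus>\<^bsub>N\<^esub> act N \<one>\<^bsub>S\<^esub> (entry I x) i"
        using i x entry_in_tuples[OF x] by (simp add: c en tuples_def)
      also have "\<dots> = act N \<zero>\<^bsub>S\<^esub> (entry I x) i"
        using sum[of "\<ominus>\<^bsub>S\<^esub> \<one>\<^bsub>S\<^esub>" "\<one>\<^bsub>S\<^esub>"] by (simp add: S.l_neg)
      also have "\<dots> = \<zero>\<^bsub>N\<^esub>"
      proof -
        have "act N \<zero>\<^bsub>S\<^esub> (entry I x) i \<oplus>\<^bsub>N\<^esub> act N \<zero>\<^bsub>S\<^esub> (entry I x) i = act N \<zero>\<^bsub>S\<^esub> (entry I x) i"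
          using sum[of "\<zero>\<^bsub>S\<^esub>" "\<zero>\<^bsub>S\<^esub>"] by simp
        moreover have "act N \<zero>\<^bsub>S\<^esub> (entry I x) i \<in> carrier N"
          using act_closed[OF N _ tup[OF x], of "\<zero>\<^bsub>S\<^esub>"] i by auto
        ultimately show ?thesis by simp
      qed
      finally show "entry I (?y \<oplus>\<^bsub>induced N\<^esub> x) i = entry I \<zero>\<^bsub>induced N\<^esub> i"
        using i by (simp add: en)
    qed (use x in \<open>simp_all add: c\<close>)
    then show "\<exists>y\<in>carrier (induced N). y \<oplus>\<^bsub>induced N\<^esub> x = \<zero>\<^bsub>induced N\<^esub>"
      using x by (intro bexI[of _ ?y]) (simp_all add: c)
  next
    fix x y z
    assume x: "x \<in> carrier (induced N)" and y: "y \<in> carrier (induced N)"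
    show "x \<oplus>\<^bsub>induced N\<^esub> y = y \<oplus>\<^bsub>induced N\<^esub> x"
      using x y by (intro induced_eqI[where N = N]) (simp_all add: c en N.a_comm)
    assume z: "z \<in> carrier (induced N)"
    show "x \<oplus>\<^bsub>induced N\<^esub> y \<oplus>\<^bsub>induced N\<^esub> z = x \<oplus>\<^bsub>induced N\<^esub> (y \<oplus>\<^bsub>induced N\<^esub> z)"
      using x y z by (intro induced_eqI[where N = N]) (simp_all add: c en N.a_assoc)
  next
    fix x assume x: "x \<in> carrier (induced N)"
    then show "\<zero>\<^bsub>induced N\<^esub> \<oplus>\<^bsub>induced N\<^esub> x = x"
      by (intro induced_eqI[where N = N]) (simp_all add: c en)
  qed (simp_all add: c)
  moreover have "left_module_axioms S (induced N)"
  proof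
    fix s s' x y
    assume s: "s \<in> carrier S" and x: "x \<in> carrier (induced N)"
    show "s \<odot>\<^bsub>induced N\<^esub> x \<in> carrier (induced N)" using s x by (rule c)
    show "s \<odot>\<^bsub>induced N\<^esub> (x \<oplus>\<^bsub>induced N\<^esub> y) = s \<odot>\<^bsub>induced N\<^esub> x \<oplus>\<^bsub>induced N\<^esub> s \<odot>\<^bsub>induced N\<^esub> y"
      if y: "y \<in> carrier (induced N)"
    proof (rule induced_eqI[where N = N, OF _ _ ballI])
      have "entry I (x \<oplus>\<^bsub>induced N\<^esub> y) = (\<lambda>i\<in>I. entry I x i \<oplus>\<^bsub>N\<^esub> entry I y i)"
        using x y tup[OF c(1)[OF x y]] by (intro extensionalityI[of _ I]) (auto simp: en PiE_def)
      then show "entry I (s \<odot>\<^bsub>induced N\<^esub> (x \<oplus>\<^bsub>induced N\<^esub> y)) i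
          = entry I (s \<odot>\<^bsub>induced N\<^esub> x \<oplus>\<^bsub>induced N\<^esub> s \<odot>\<^bsub>induced N\<^esub> y) i" if "i \<in> I" for i
        using s x y that by (simp add: c en act_pointwise_add[OF N] tup)
    qed (use s x y in \<open>simp_all add: c\<close>)
    show "(s \<oplus>\<^bsub>S\<^esub> s') \<odot>\<^bsub>induced N\<^esub> x = s \<odot>\<^bsub>induced N\<^esub> x \<oplus>\<^bsub>induced N\<^esub> s' \<odot>\<^bsub>induced N\<^esub> x"
      if "s' \<in> carrier S"
      using s x that by (intro induced_eqI[where N = N]) (simp_all add: c en act_add[OF N] tup)
    show "(s \<otimes>\<^bsub>S\<^esub> s') \<odot>\<^bsub>induced N\<^esub> x = s \<odot>\<^bsub>induced N\<^esub> (s' \<odot>\<^bsub>induced N\<^esub> x)"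
      if "s' \<in> carrier S"
      using s x that by (intro induced_eqI[where N = N]) (simp_all add: c en act_act[OF N] tup)
  next
    fix x assume x: "x \<in> carrier (induced N)"
    then show "\<one>\<^bsub>S\<^esub> \<odot>\<^bsub>induced N\<^esub> x = x"
      using entry_in_tuples[OF x] by (intro induced_eqI[where N = N]) (simp_all add: c en tuples_def)
  qed
  ultimately show ?thesis using S.ring_axioms by (simp add: left_module_def)
qed

end

definition induced_map ::
    "('t, 'u::infinite) module \<Rightarrow> ('t, 'u) module \<Rightarrow> ('u \<Rightarrow> 'u) \<Rightarrow> 'u \<Rightarrow> 'u"
  where "induced_map N P f =
    (\<lambda>x\<in>carrier (induced N). tuple_code I (\<lambda>i\<in>I. f (entry I x i)))"

lemma
  assumes N: "left_module T N" and P: "left_module T P" and f: "f \<in> mod_hom T N P"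
    and x: "x \<in> carrier (induced N)"
  shows induced_map_closed: "induced_map N P f x \<in> carrier (induced P)"
    and entry_induced_map: "entry I (induced_map N P f x) = (\<lambda>i\<in>I. f (entry I x i))"
proof -
  have "(\<lambda>i\<in>I. f (entry I x i)) \<in> tuples P"
    using entry_in_tuples[OF x] act_map[OF N P f S.one_closed, of "entry I x"] mod_hom_closed[OF f]
    by (auto simp: tuples_def)
  then show "induced_map N P f x \<in> carrier (induced P)"
    and "entry I (induced_map N P f x) = (\<lambda>i\<in>I. f (entry I x i))"
    using x by (simp_all add: induced_map_def code_in_induced entry_code_tuples)
qed

lemma additive_functor_induced:
  "additive_functor T S (induced :: ('t, 'u::infinite) module \<Rightarrow> _) induced_map"
  unfolding additive_functor_def
proof (intro conjI allI impI ballI)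
  fix N :: "('t, 'u) module" assume N: "left_module T N"
  show "left_module S (induced N)" by (rule left_module_induced[OF N])
  have id: "id_hom N \<in> mod_hom T N N"
    using left_module_abelian_group[OF N, THEN abelian_group.axioms(1)] left_module.smult_closed[OF N]
    by (intro mod_homI) (auto simp: id_hom_def abelian_monoid.a_closed)
  show "induced_map N N (id_hom N) = id_hom (induced N)"
  proof (rule extensionalityI[of _ "carrier (induced N)"])
    fix x assume x: "x \<in> carrier (induced N)"
    show "induced_map N N (id_hom N) x = id_hom (induced N) x"
      using x induced_map_closed[OF N N id x]
      by (intro induced_eqI[where N = N]) (simp_all add: id_hom_def entry_induced_map[OF N N id x, unfolded id_hom_def] entry_closed)
  qed (simp_all add: induced_map_def id_hom_def)
next
  fix N P :: "('t, 'u) module" and f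
  assume N: "left_module T N" and P: "left_module T P" and f: "f \<in> mod_hom T N P"
  note c = induced_map_closed[OF N P] add_in_induced[OF N] smult_in_induced[OF N]
    add_in_induced[OF P] smult_in_induced[OF P]
  note en = entry_induced_map[OF N P] entry_add[OF N] entry_smult[OF N] entry_add[OF P] entry_smult[OF P]
    entry_closed
  show "induced_map N P f \<in> mod_hom S (induced N) (induced P)"
  proof (rule mod_homI)
    fix x assume x: "x \<in> carrier (induced N)"
    show "induced_map N P f x \<in> carrier (induced P)" using f x by (rule c)
    show "induced_map N P f (x \<oplus>\<^bsub>induced N\<^esub> y) = induced_map N P f x \<oplus>\<^bsub>induced P\<^esub> induced_map N P f y"
      if "y \<in> carrier (induced N)" for y
      using x that f by (intro induced_eqI[where N = P]) (simp_all add: c en mod_hom_add[OF f])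
    show "induced_map N P f (s \<odot>\<^bsub>induced N\<^esub> x) = s \<odot>\<^bsub>induced P\<^esub> induced_map N P f x"
      if "s \<in> carrier S" for s
      using x that f act_map[OF N P f that, of "entry I x"] entry_in_tuples[OF x]
      by (intro induced_eqI[where N = P]) (simp_all add: c en tuples_def)
  qed (simp add: induced_map_def)
  fix g assume g: "g \<in> mod_hom T N P"
  interpret P: abelian_group P by (rule left_module_abelian_group[OF P])
  have fg: "hom_add N P f g \<in> mod_hom T N P"
  proof -
    interpret N: abelian_group N by (rule left_module_abelian_group[OF N])
    show ?thesis
      using f g left_module.smult_closed[OF N] by (intro mod_homI)
      (auto simp: hom_add_def mod_hom_closed mod_hom_add mod_hom_smult P.a_ac
        left_module.smult_r_distr[OF P])
  qed
  show "induced_map N P (hom_add N P f g)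
      = hom_add (induced N) (induced P) (induced_map N P f) (induced_map N P g)"
  proof (rule extensionalityI[of _ "carrier (induced N)"])
    fix x assume x: "x \<in> carrier (induced N)"
    show "induced_map N P (hom_add N P f g) x
        = hom_add (induced N) (induced P) (induced_map N P f) (induced_map N P g) x"
      using x f g fg
      by (intro induced_eqI[where N = P]) (simp_all add: c en hom_add_def[of "induced N"], simp_all add: hom_add_def en)
  qed (simp_all add: induced_map_def hom_add_def)
next
  fix N P Q :: "('t, 'u) module" and f g
  assume N: "left_module T N" and P: "left_module T P" and Q: "left_module T Q"
    and f: "f \<in> mod_hom T N P" and g: "g \<in> mod_hom T P Q"
  have gf: "compose (carrier N) g f \<in> mod_hom T N Q"
  proof -
    interpret N: abelian_group N by (rule left_module_abelian_group[OF N])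
    show ?thesis
      using mod_hom_closed[OF f] mod_hom_closed[OF g] left_module.smult_closed[OF N]
      by (intro mod_homI) (simp_all add: compose_eq mod_hom_add[OF f] mod_hom_add[OF g]
          mod_hom_smult[OF f] mod_hom_smult[OF g])
  qed
  show "induced_map N Q (compose (carrier N) g f)
      = compose (carrier (induced N)) (induced_map P Q g) (induced_map N P f)"
  proof (rule extensionalityI[of _ "carrier (induced N)"])
    fix x assume x: "x \<in> carrier (induced N)"
    note y = induced_map_closed[OF N P f x]
    show "induced_map N Q (compose (carrier N) g f) x
        = compose (carrier (induced N)) (induced_map P Q g) (induced_map N P f) x"
      unfolding compose_eq[OF x]
      by (rule induced_eqI[OF induced_map_closed[OF N Q gf x] induced_map_closed[OF P Q g y]])
       (simp add: entry_induced_map[OF N Q gf x] entry_induced_map[OF P Q g y]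
          entry_induced_map[OF N P f x] compose_eq entry_closed[OF x])
  qed (simp_all add: induced_map_def)
qed

lemma row_col_action:
  assumes N: "left_module T N" and n: "n \<in> carrier N"
  shows "(\<Oplus>\<^bsub>N\<^esub>j\<in>I. row j \<odot>\<^bsub>N\<^esub> (col j \<odot>\<^bsub>N\<^esub> n)) = n"
proof -
  have "(\<Oplus>\<^bsub>N\<^esub>j\<in>I. row j \<odot>\<^bsub>N\<^esub> (col j \<odot>\<^bsub>N\<^esub> n)) = (\<Oplus>\<^bsub>N\<^esub>j\<in>I. (row j \<otimes>\<^bsub>T\<^esub> col j) \<odot>\<^bsub>N\<^esub> n)"
    using n by (intro finsum_eqI left_module_abelian_group[OF N])
      (simp_all add: closed' left_module.smult_assoc1[OF N] left_module.smult_closed[OF N])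
  also have "\<dots> = n"
    using n by (simp add: finsum_smult[OF N, symmetric] closed' row_col left_module.smult_one[OF N])
  finally show ?thesis .
qed

lemma u_v_action:
  assumes M: "left_module S M" and m: "m \<in> carrier M"
  shows "(\<Oplus>\<^bsub>M\<^esub>i\<in>I. u i \<odot>\<^bsub>M\<^esub> (v i \<odot>\<^bsub>M\<^esub> m)) = m"
proof -
  have "(\<Oplus>\<^bsub>M\<^esub>i\<in>I. u i \<odot>\<^bsub>M\<^esub> (v i \<odot>\<^bsub>M\<^esub> m)) = (\<Oplus>\<^bsub>M\<^esub>i\<in>I. (u i \<otimes>\<^bsub>S\<^esub> v i) \<odot>\<^bsub>M\<^esub> m)"
    using m by (intro finsum_eqI left_module_abelian_group[OF M])
      (simp_all add: closed left_module.smult_assoc1[OF M] left_module.smult_closed[OF M])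
  also have "\<dots> = m"
    using m by (simp add: finsum_smult[OF M, symmetric] closed full left_module.smult_one[OF M])
  finally show ?thesis .
qed

text \<open>
  The first natural isomorphism \<open>S e \<otimes>\<^sub>T e M \<rightarrow> M\<close>. Its inverse is \<open>m \<mapsto> (v i \<cdot> m)\<^sub>i\<close>,
  and because \<open>m\<close> is determined by the \<open>v i \<cdot> m\<close> (\<open>eq_by_v\<close> below), linearity and naturality of
  \<open>assemble\<close> can be checked after multiplication by the \<open>v i\<close>.
\<close>
definition assemble :: "('s, 'u::infinite) module \<Rightarrow> 'u \<Rightarrow> 'u"
  where "assemble M =
    (\<lambda>x\<in>carrier (induced (corner M)). \<Oplus>\<^bsub>M\<^esub>i\<in>I. u i \<odot>\<^bsub>M\<^esub> entry I x i)"

context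
  fixes M :: "('s, 'u::infinite) module"
  assumes M: "left_module S M"
begin

lemma assemble_closed:
  assumes "x \<in> carrier (induced (corner M))"
  shows "assemble M x \<in> carrier M"
  using assms entry_closed[OF assms] unfolding assemble_def
  by (auto simp: closed left_module.smult_closed[OF M]
      intro!: finsum_in_carrier left_module_abelian_group[OF M])

lemma v_smult_assemble:
  assumes x: "x \<in> carrier (induced (corner M))" and i: "i \<in> I" and s: "s \<in> carrier S"
  shows "v i \<odot>\<^bsub>M\<^esub> (s \<odot>\<^bsub>M\<^esub> assemble M x) = act (corner M) s (entry I x) i"
proof -
  note M' = left_module_abelian_group[OF M]
  note C = left_module_corner[OF M]
  have xc: "entry I x j \<in> carrier (corner M)" if "j \<in> I" for j
    using entry_closed[OF x that] .
  have "v i \<odot>\<^bsub>M\<^esub> (s \<odot>\<^bsub>M\<^esub> assemble M x) = (v i \<otimes>\<^bsub>S\<^esub> s) \<odot>\<^bsub>M\<^esub> (\<Oplus>\<^bsub>M\<^esub>j\<in>I. u j \<odot>\<^bsub>M\<^esub> entry I x j)"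
    using i s assemble_closed[OF x] x
    by (simp add: closed left_module.smult_assoc1[OF M] assemble_def)
  also have "\<dots> = (\<Oplus>\<^bsub>M\<^esub>j\<in>I. (v i \<otimes>\<^bsub>S\<^esub> s) \<odot>\<^bsub>M\<^esub> (u j \<odot>\<^bsub>M\<^esub> entry I x j))"
    using i s xc by (intro smult_finsum[OF M]) (simp_all add: closed left_module.smult_closed[OF M])
  also have "\<dots> = (\<Oplus>\<^bsub>M\<^esub>j\<in>I. coef i s j \<odot>\<^bsub>corner M\<^esub> entry I x j)"
    using i s xc by (intro finsum_eqI M')
      (simp_all add: closed' \<iota>_coef left_module.smult_assoc1[OF M] left_module.smult_closed[OF M])
  also have "\<dots> = (\<Oplus>\<^bsub>corner M\<^esub>j\<in>I. coef i s j \<odot>\<^bsub>corner M\<^esub> entry I x j)"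
    using i s xc by (intro finsum_corner[OF M, symmetric] left_module.smult_closed[OF C]) (auto simp: closed')
  finally show ?thesis using i by (simp add: act_def)
qed

lemma v_assemble:
  assumes x: "x \<in> carrier (induced (corner M))" and i: "i \<in> I"
  shows "v i \<odot>\<^bsub>M\<^esub> assemble M x = entry I x i"
  using v_smult_assemble[OF x i S.one_closed] entry_in_tuples[OF x] assemble_closed[OF x]
  by (simp add: left_module.smult_one[OF M] tuples_def)

lemma eq_by_v:
  assumes "m \<in> carrier M" "m' \<in> carrier M" "\<forall>i\<in>I. v i \<odot>\<^bsub>M\<^esub> m = v i \<odot>\<^bsub>M\<^esub> m'"
  shows "m = m'"
proof -
  have "(\<Oplus>\<^bsub>M\<^esub>i\<in>I. u i \<odot>\<^bsub>M\<^esub> (v i \<odot>\<^bsub>M\<^esub> m)) = (\<Oplus>\<^bsub>M\<^esub>i\<in>I. u i \<odot>\<^bsub>M\<^esub> (v i \<odot>\<^bsub>M\<^esub> m'))"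
    using assms by (intro finsum_eqI left_module_abelian_group[OF M])
      (simp_all add: closed left_module.smult_closed[OF M])
  then show ?thesis using assms by (simp add: u_v_action[OF M])
qed

lemma v_tuple:
  assumes m: "m \<in> carrier M"
  shows "(\<lambda>i\<in>I. v i \<odot>\<^bsub>M\<^esub> m) \<in> tuples (corner M)"
proof -
  note M' = left_module_abelian_group[OF M]
  note C = left_module_corner[OF M]
  have c: "v i \<odot>\<^bsub>M\<^esub> m \<in> carrier (corner M)" if "i \<in> I" for i
    using that m by (simp add: closed e_v left_module.smult_closed[OF M] left_module.smult_assoc1[OF M, symmetric])
  have "(\<Oplus>\<^bsub>corner M\<^esub>j\<in>I. coef i \<one>\<^bsub>S\<^esub> j \<odot>\<^bsub>corner M\<^esub> (\<lambda>i\<in>I. v i \<odot>\<^bsub>M\<^esub> m) j) = v i \<odot>\<^bsub>M\<^esub> m"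
    if i: "i \<in> I" for i
  proof -
    have "(\<Oplus>\<^bsub>corner M\<^esub>j\<in>I. coef i \<one>\<^bsub>S\<^esub> j \<odot>\<^bsub>corner M\<^esub> (\<lambda>i\<in>I. v i \<odot>\<^bsub>M\<^esub> m) j)
        = (\<Oplus>\<^bsub>M\<^esub>j\<in>I. coef i \<one>\<^bsub>S\<^esub> j \<odot>\<^bsub>corner M\<^esub> (\<lambda>i\<in>I. v i \<odot>\<^bsub>M\<^esub> m) j)"
      using i c by (intro finsum_corner[OF M] left_module.smult_closed[OF C]) (auto simp: closed')
    also have "\<dots> = (\<Oplus>\<^bsub>M\<^esub>j\<in>I. v i \<odot>\<^bsub>M\<^esub> (u j \<odot>\<^bsub>M\<^esub> (v j \<odot>\<^bsub>M\<^esub> m)))"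
      using i m by (intro finsum_eqI M')
        (simp_all add: closed' \<iota>_coef left_module.smult_assoc1[OF M] left_module.smult_closed[OF M])
    also have "\<dots> = v i \<odot>\<^bsub>M\<^esub> (\<Oplus>\<^bsub>M\<^esub>j\<in>I. u j \<odot>\<^bsub>M\<^esub> (v j \<odot>\<^bsub>M\<^esub> m))"
      using i m by (intro smult_finsum[OF M, symmetric]) (simp_all add: closed left_module.smult_closed[OF M])
    finally show ?thesis using m by (simp add: u_v_action[OF M])
  qed
  then show ?thesis using c by (auto simp: tuples_def act_def)
qed

lemma assemble_hom: "assemble M \<in> mod_hom S (induced (corner M)) M"
proof (rule mod_homI)
  note C = left_module_corner[OF M]
  interpret M: abelian_group M by (rule left_module_abelian_group[OF M])
  note c = assemble_closed add_in_induced[OF C] smult_in_induced[OF C]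
    left_module.smult_closed[OF M]
  fix x assume x: "x \<in> carrier (induced (corner M))"
  show "assemble M x \<in> carrier M" by (rule assemble_closed[OF x])
  show "assemble M (x \<oplus>\<^bsub>induced (corner M)\<^esub> y) = assemble M x \<oplus>\<^bsub>M\<^esub> assemble M y"
    if y: "y \<in> carrier (induced (corner M))" for y
    using x y by (intro eq_by_v)
      (simp_all add: c closed v_assemble entry_add[OF C] left_module.smult_r_distr[OF M])
  show "assemble M (s \<odot>\<^bsub>induced (corner M)\<^esub> x) = s \<odot>\<^bsub>M\<^esub> assemble M x" if s: "s \<in> carrier S" for s
    using x s by (intro eq_by_v)
      (simp_all add: c closed v_assemble v_smult_assemble entry_smult[OF C])
qed (simp add: assemble_def)

lemma assemble_bij: "bij_betw (assemble M) (carrier (induced (corner M))) (carrier M)"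
proof (rule bij_betwI'[of _ "assemble M"])
  fix x y assume "x \<in> carrier (induced (corner M))" "y \<in> carrier (induced (corner M))"
  then show "assemble M x = assemble M y \<longleftrightarrow> x = y"
    by (metis induced_eqI v_assemble)
next
  fix m assume m: "m \<in> carrier M"
  let ?x = "tuple_code I (\<lambda>i\<in>I. v i \<odot>\<^bsub>M\<^esub> m)"
  have x: "?x \<in> carrier (induced (corner M))"
    using v_tuple[OF m] by (rule code_in_induced)
  then have "m = assemble M ?x"
    using m v_tuple[OF m] by (intro eq_by_v) (simp_all add: assemble_closed v_assemble entry_code_tuples)
  then show "\<exists>x\<in>carrier (induced (corner M)). m = assemble M x" using x by blast
qed (rule assemble_closed)

end

lemma induced_corner_iso_id:
  "nat_iso_to_id S (\<lambda>M :: ('s, 'u::infinite) module. induced (corner M))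
    (\<lambda>M N f. induced_map (corner M) (corner N) (corner_map M N f))"
  unfolding nat_iso_to_id_def
proof (intro exI[of _ assemble] conjI allI impI ballI)
  fix M N :: "('s, 'u) module" and f
  assume M: "left_module S M" and N: "left_module S N" and f: "f \<in> mod_hom S M N"
  let ?g = "induced_map (corner M) (corner N) (corner_map M N f)"
  have g: "corner_map M N f \<in> mod_hom T (corner M) (corner N)"
    using additive_functor_corner M N f unfolding additive_functor_def by blast
  show "compose (carrier (induced (corner M))) (assemble N) ?g
      = compose (carrier (induced (corner M))) f (assemble M)"
  proof (rule extensionalityI[of _ "carrier (induced (corner M))"])
    fix x assume x: "x \<in> carrier (induced (corner M))"
    have gx: "?g x \<in> carrier (induced (corner N))"
      and en0: "entry I (?g x) = (\<lambda>i\<in>I. corner_map M N f (entry I x i))"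
      using induced_map_closed[OF left_module_corner[OF M] left_module_corner[OF N] g x]
        entry_induced_map[OF left_module_corner[OF M] left_module_corner[OF N] g x] by auto
    have en: "entry I (?g x) i = f (entry I x i)" if "i \<in> I" for i
      unfolding en0 using that entry_closed[OF x that] by (simp add: corner_map_def)
    have "v i \<odot>\<^bsub>N\<^esub> f (assemble M x) = f (entry I x i)" if "i \<in> I" for i
      using that mod_hom_smult[OF f, of "v i" "assemble M x"] assemble_closed[OF M x] v_assemble[OF M x]
      by (simp add: closed)
    then have "assemble N (?g x) = f (assemble M x)"
      using gx assemble_closed[OF M x] mod_hom_closed[OF f] entry_closed[OF x]
      by (intro eq_by_v[OF N]) (simp_all add: assemble_closed[OF N] v_assemble[OF N] en)
    then show "compose (carrier (induced (corner M))) (assemble N) ?g x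
        = compose (carrier (induced (corner M))) f (assemble M) x"
      using x by (simp add: compose_eq)
  qed simp_all
qed (simp_all add: assemble_hom assemble_bij)

text \<open>
  The second natural isomorphism \<open>e (S e \<otimes>\<^sub>T N) \<rightarrow> N\<close>, with inverse
  \<open>n \<mapsto> (col i \<cdot> n)\<^sub>i\<close>. The roles of \<open>u\<close> and \<open>v\<close> above are taken by \<open>row\<close> and \<open>col\<close>.
\<close>
definition contract :: "('t, 'u::infinite) module \<Rightarrow> 'u \<Rightarrow> 'u"
  where "contract N =
    (\<lambda>x\<in>carrier (corner (induced N)). \<Oplus>\<^bsub>N\<^esub>j\<in>I. row j \<odot>\<^bsub>N\<^esub> entry I x j)"

context
  fixes N :: "('t, 'u::infinite) module"
  assumes N: "left_module T N"
begin

lemma contract_closed: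
  assumes "x \<in> carrier (corner (induced N))"
  shows "contract N x \<in> carrier N"
  using assms entry_closed[of x N] unfolding contract_def
  by (auto simp: closed' left_module.smult_closed[OF N]
      intro!: finsum_in_carrier left_module_abelian_group[OF N])

lemma col_smult_contract:
  assumes x: "x \<in> carrier (corner (induced N))" and i: "i \<in> I" and t: "t \<in> carrier T"
  shows "col i \<odot>\<^bsub>N\<^esub> (t \<odot>\<^bsub>N\<^esub> contract N x) = act N (\<iota> t) (entry I x) i"
proof -
  note N' = left_module_abelian_group[OF N]
  have xc: "entry I x j \<in> carrier N" if "j \<in> I" for j
    using x entry_closed[of x N, OF _ that] by simp
  have "col i \<odot>\<^bsub>N\<^esub> (t \<odot>\<^bsub>N\<^esub> contract N x) = (col i \<otimes>\<^bsub>T\<^esub> t) \<odot>\<^bsub>N\<^esub> (\<Oplus>\<^bsub>N\<^esub>j\<in>I. row j \<odot>\<^bsub>N\<^esub> entry I x j)"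
    using i t contract_closed[OF x] x
    by (simp add: closed' left_module.smult_assoc1[OF N] contract_def del: corner_simps(1))
  also have "\<dots> = (\<Oplus>\<^bsub>N\<^esub>j\<in>I. (col i \<otimes>\<^bsub>T\<^esub> t) \<odot>\<^bsub>N\<^esub> (row j \<odot>\<^bsub>N\<^esub> entry I x j))"
    using i t xc by (intro smult_finsum[OF N]) (simp_all add: closed' left_module.smult_closed[OF N])
  also have "\<dots> = (\<Oplus>\<^bsub>N\<^esub>j\<in>I. coef i (\<iota> t) j \<odot>\<^bsub>N\<^esub> entry I x j)"
    using i t xc by (intro finsum_eqI N')
      (simp_all add: closed' coef_\<iota> left_module.smult_assoc1[OF N] left_module.smult_closed[OF N])
  finally show ?thesis using i by (simp add: act_def)
qed

lemma col_contract:
  assumes x: "x \<in> carrier (corner (induced N))" and i: "i \<in> I"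
  shows "col i \<odot>\<^bsub>N\<^esub> contract N x = entry I x i"
proof -
  have "act N e (entry I x) = entry I x"
    using x entry_smult[OF N e_closed, of x] by simp
  then show ?thesis
    using col_smult_contract[OF x i T.one_closed] contract_closed[OF x]
    by (simp add: left_module.smult_one[OF N])
qed

lemma eq_by_col:
  assumes "n \<in> carrier N" "n' \<in> carrier N" "\<forall>i\<in>I. col i \<odot>\<^bsub>N\<^esub> n = col i \<odot>\<^bsub>N\<^esub> n'"
  shows "n = n'"
proof -
  have "(\<Oplus>\<^bsub>N\<^esub>i\<in>I. row i \<odot>\<^bsub>N\<^esub> (col i \<odot>\<^bsub>N\<^esub> n)) = (\<Oplus>\<^bsub>N\<^esub>i\<in>I. row i \<odot>\<^bsub>N\<^esub> (col i \<odot>\<^bsub>N\<^esub> n'))"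
    using assms by (intro finsum_eqI left_module_abelian_group[OF N])
      (simp_all add: closed' left_module.smult_closed[OF N])
  then show ?thesis using assms by (simp add: row_col_action[OF N])
qed

lemma act_col_tuple:
  assumes n: "n \<in> carrier N"
  shows "act N \<one>\<^bsub>S\<^esub> (\<lambda>i\<in>I. col i \<odot>\<^bsub>N\<^esub> n) = (\<lambda>i\<in>I. col i \<odot>\<^bsub>N\<^esub> n)"
    and "act N e (\<lambda>i\<in>I. col i \<odot>\<^bsub>N\<^esub> n) = (\<lambda>i\<in>I. col i \<odot>\<^bsub>N\<^esub> n)"
proof -
  note N' = left_module_abelian_group[OF N]
  note cl = closed' left_module.smult_closed[OF N]
  have "(\<Oplus>\<^bsub>N\<^esub>j\<in>I. coef i \<one>\<^bsub>S\<^esub> j \<odot>\<^bsub>N\<^esub> (\<lambda>i\<in>I. col i \<odot>\<^bsub>N\<^esub> n) j) = col i \<odot>\<^bsub>N\<^esub> n" if i: "i \<in> I" for i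
  proof -
    have "(\<Oplus>\<^bsub>N\<^esub>j\<in>I. coef i \<one>\<^bsub>S\<^esub> j \<odot>\<^bsub>N\<^esub> (\<lambda>i\<in>I. col i \<odot>\<^bsub>N\<^esub> n) j)
        = (\<Oplus>\<^bsub>N\<^esub>j\<in>I. (coef i \<one>\<^bsub>S\<^esub> j \<otimes>\<^bsub>T\<^esub> col j) \<odot>\<^bsub>N\<^esub> n)"
      using i n by (intro finsum_eqI N') (simp_all add: cl left_module.smult_assoc1[OF N])
    then show ?thesis
      using i n finsum_smult[OF N n, of I "\<lambda>j. coef i \<one>\<^bsub>S\<^esub> j \<otimes>\<^bsub>T\<^esub> col j"] by (simp add: cl coef_col)
  qed
  then show "act N \<one>\<^bsub>S\<^esub> (\<lambda>i\<in>I. col i \<odot>\<^bsub>N\<^esub> n) = (\<lambda>i\<in>I. col i \<odot>\<^bsub>N\<^esub> n)"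
    by (auto simp: act_def)
  have "(\<Oplus>\<^bsub>N\<^esub>j\<in>I. coef i e j \<odot>\<^bsub>N\<^esub> (\<lambda>i\<in>I. col i \<odot>\<^bsub>N\<^esub> n) j) = col i \<odot>\<^bsub>N\<^esub> n" if i: "i \<in> I" for i
  proof -
    have "(\<Oplus>\<^bsub>N\<^esub>j\<in>I. coef i e j \<odot>\<^bsub>N\<^esub> (\<lambda>i\<in>I. col i \<odot>\<^bsub>N\<^esub> n) j)
        = (\<Oplus>\<^bsub>N\<^esub>j\<in>I. col i \<odot>\<^bsub>N\<^esub> (row j \<odot>\<^bsub>N\<^esub> (col j \<odot>\<^bsub>N\<^esub> n)))"
      using i n by (intro finsum_eqI N') (simp_all add: cl coef_\<iota> left_module.smult_assoc1[OF N])
    also have "\<dots> = col i \<odot>\<^bsub>N\<^esub> (\<Oplus>\<^bsub>N\<^esub>j\<in>I. row j \<odot>\<^bsub>N\<^esub> (col j \<odot>\<^bsub>N\<^esub> n))"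
      using i n by (intro smult_finsum[OF N, symmetric]) (simp_all add: cl)
    finally show ?thesis using n by (simp add: row_col_action[OF N])
  qed
  then show "act N e (\<lambda>i\<in>I. col i \<odot>\<^bsub>N\<^esub> n) = (\<lambda>i\<in>I. col i \<odot>\<^bsub>N\<^esub> n)"
    by (auto simp: act_def)
qed

lemma contract_hom: "contract N \<in> mod_hom T (corner (induced N)) N"
proof (rule mod_homI)
  note C = left_module_corner[OF left_module_induced[OF N]]
  interpret N: abelian_group N by (rule left_module_abelian_group[OF N])
  interpret C: abelian_group "corner (induced N)" by (rule left_module_abelian_group[OF C])
  note c = contract_closed C.a_closed left_module.smult_closed[OF C] left_module.smult_closed[OF N]
  fix x assume x: "x \<in> carrier (corner (induced N))"
  show "contract N x \<in> carrier N" by (rule contract_closed[OF x])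
  have en: "entry I (x \<oplus>\<^bsub>corner (induced N)\<^esub> y) i = entry I x i \<oplus>\<^bsub>N\<^esub> entry I y i"
    if "i \<in> I" "y \<in> carrier (corner (induced N))" for i y
    using x that by (simp add: entry_add[OF N])
  have es: "entry I (t \<odot>\<^bsub>corner (induced N)\<^esub> x) = act N (\<iota> t) (entry I x)" if "t \<in> carrier T" for t
    using x that by (simp add: entry_smult[OF N] closed)
  show "contract N (x \<oplus>\<^bsub>corner (induced N)\<^esub> y) = contract N x \<oplus>\<^bsub>N\<^esub> contract N y"
    if y: "y \<in> carrier (corner (induced N))" for y
    using x y by (intro eq_by_col)
      (simp_all add: c closed' col_contract en left_module.smult_r_distr[OF N] del: corner_simps)
  show "contract N (t \<odot>\<^bsub>corner (induced N)\<^esub> x) = t \<odot>\<^bsub>N\<^esub> contract N x" if t: "t \<in> carrier T" for t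
    using x t by (intro eq_by_col)
      (simp_all add: c closed' col_contract col_smult_contract es del: corner_simps)
qed (simp add: contract_def)

lemma contract_bij: "bij_betw (contract N) (carrier (corner (induced N))) (carrier N)"
proof (rule bij_betwI'[of _ "contract N"])
  fix x y assume "x \<in> carrier (corner (induced N))" "y \<in> carrier (corner (induced N))"
  then show "contract N x = contract N y \<longleftrightarrow> x = y"
    by (metis induced_eqI col_contract corner_simps(1))
next
  fix n assume n: "n \<in> carrier N"
  let ?x = "tuple_code I (\<lambda>i\<in>I. col i \<odot>\<^bsub>N\<^esub> n)"
  have tup: "(\<lambda>i\<in>I. col i \<odot>\<^bsub>N\<^esub> n) \<in> tuples N"
    using n by (auto simp: tuples_def act_col_tuple closed' left_module.smult_closed[OF N])
  then have x: "?x \<in> carrier (corner (induced N))"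
    using n by (simp add: code_in_induced, simp add: induced_def entry_code_tuples act_col_tuple)
  then have "n = contract N ?x"
    using n tup by (intro eq_by_col) (simp_all add: contract_closed col_contract entry_code_tuples del: corner_simps)
  then show "\<exists>x\<in>carrier (corner (induced N)). n = contract N x" using x by blast
qed (rule contract_closed)

end

lemma corner_induced_iso_id:
  "nat_iso_to_id T (\<lambda>N :: ('t, 'u::infinite) module. corner (induced N))
    (\<lambda>N P f. corner_map (induced N) (induced P) (induced_map N P f))"
  unfolding nat_iso_to_id_def
proof (intro exI[of _ contract] conjI allI impI ballI)
  fix N P :: "('t, 'u) module" and f
  assume N: "left_module T N" and P: "left_module T P" and f: "f \<in> mod_hom T N P"
  let ?C = "carrier (corner (induced N))" and ?g = "induced_map N P f"
  have g: "?g \<in> mod_hom S (induced N) (induced P)"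
    using additive_functor_induced N P f unfolding additive_functor_def by blast
  show "compose ?C (contract P) (corner_map (induced N) (induced P) ?g) = compose ?C f (contract N)"
  proof (rule extensionalityI[of _ ?C])
    fix x assume x: "x \<in> ?C"
    have gx: "?g x \<in> carrier (corner (induced P))" by (rule corner_map_closed[OF g x])
    have "entry I (?g x) = (\<lambda>i\<in>I. f (entry I x i))"
      using entry_induced_map[OF N P f, of x] x by simp
    moreover have "col i \<odot>\<^bsub>P\<^esub> f (contract N x) = f (entry I x i)" if "i \<in> I" for i
      using that mod_hom_smult[OF f, of "col i" "contract N x"] contract_closed[OF N x] col_contract[OF N x]
      by (simp add: closed')
    ultimately have "contract P (?g x) = f (contract N x)"
      using gx contract_closed[OF N x] mod_hom_closed[OF f]
      by (intro eq_by_col[OF P]) (simp_all add: contract_closed[OF P] col_contract[OF P] del: corner_simps)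
    then show "compose ?C (contract P) (corner_map (induced N) (induced P) ?g) x
        = compose ?C f (contract N) x"
      using x by (simp add: compose_eq corner_map_def del: corner_simps)
  qed simp_all
qed (simp_all add: contract_hom contract_bij)

theorem morita_equivalent: "morita_equivalent TYPE('u::infinite) S T"
  unfolding morita_equivalent_def
  using S.ring_axioms T.ring_axioms additive_functor_corner additive_functor_induced
    induced_corner_iso_id corner_induced_iso_id by blast

end

section \<open>Bimodules, endomorphism rings and direct summands\<close>

lemma right_mod_simps [simp]:
  "carrier (right_mod M) = carrier M" "zero (right_mod M) = zero M" "add (right_mod M) = add M"
  "smult (right_mod M) t x = rsmult M x t"
  by (simp_all add: right_mod_def)

lemma opp_ring_simps [simp]:
  "carrier (opp_ring R) = carrier R" "zero (opp_ring R) = zero R" "add (opp_ring R) = add R"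
  "one (opp_ring R) = one R" "x \<otimes>\<^bsub>opp_ring R\<^esub> y = y \<otimes>\<^bsub>R\<^esub> x"
  by (simp_all add: opp_ring_def)

lemma endo_ring_simps [simp]:
  "carrier (endo_ring M E) = E" "zero (endo_ring M E) = (\<lambda>x\<in>carrier M. \<zero>\<^bsub>M\<^esub>)"
  "add (endo_ring M E) = hom_add M M" "one (endo_ring M E) = id_hom M"
  "monoid.mult (endo_ring M E) = compose (carrier M)"
  by (simp_all add: endo_ring_def)

lemma ring_opp_ring:
  assumes "ring R"
  shows "ring (opp_ring R)"
proof -
  interpret ring R by fact
  show ?thesis
    by (rule ringI, rule abelian_groupI, insert l_neg a_inv_closed)
      (auto intro!: monoidI simp: m_assoc a_ac l_distr r_distr)
qed

text \<open>
  The record of the additive monoid has a field of unspecified value whose type depends on the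
  record type, so this transfer between record types is not a matter of unfolding.
\<close>
lemma abelian_group_cong:
  assumes "abelian_group M" "carrier M' = carrier M" "add M' = add M" "zero M' = zero M"
  shows "abelian_group M'"
proof -
  interpret abelian_group M by fact
  show ?thesis
    by (rule abelian_groupI, insert l_neg a_inv_closed) (auto simp: assms(2-4) a_ac)
qed

lemma ring_endo_ring:
  assumes M: "abelian_group M" and E: "E \<subseteq> carrier M \<rightarrow>\<^sub>E carrier M"
    and additive: "\<And>f x y. f \<in> E \<Longrightarrow> x \<in> carrier M \<Longrightarrow> y \<in> carrier M \<Longrightarrow> f (x \<oplus>\<^bsub>M\<^esub> y) = f x \<oplus>\<^bsub>M\<^esub> f y"
    and zero: "(\<lambda>x\<in>carrier M. \<zero>\<^bsub>M\<^esub>) \<in> E" and one: "id_hom M \<in> E"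
    and add: "\<And>f g. f \<in> E \<Longrightarrow> g \<in> E \<Longrightarrow> hom_add M M f g \<in> E"
    and neg: "\<And>f. f \<in> E \<Longrightarrow> (\<lambda>x\<in>carrier M. \<ominus>\<^bsub>M\<^esub> f x) \<in> E"
    and comp: "\<And>f g. f \<in> E \<Longrightarrow> g \<in> E \<Longrightarrow> compose (carrier M) f g \<in> E"
  shows "ring (endo_ring M E)"
proof -
  interpret M: abelian_group M by fact
  have c: "f x \<in> carrier M" if "f \<in> E" "x \<in> carrier M" for f x
    using E that by auto
  have ext: "f = g" if "f \<in> E" "g \<in> E" "\<forall>x\<in>carrier M. f x = g x" for f g
    using E that by (intro PiE_ext[of _ "carrier M" "\<lambda>_. carrier M"]) auto
  note ev = compose_eq hom_add_def id_hom_def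
  show ?thesis
  proof (rule ringI)
    show "abelian_group (endo_ring M E)"
    proof (rule abelian_groupI)
      fix f assume f: "f \<in> carrier (endo_ring M E)"
      show "\<exists>g\<in>carrier (endo_ring M E). g \<oplus>\<^bsub>endo_ring M E\<^esub> f = \<zero>\<^bsub>endo_ring M E\<^esub>"
        using f unfolding endo_ring_simps
        by (intro bexI[of _ "\<lambda>x\<in>carrier M. \<ominus>\<^bsub>M\<^esub> f x"] ext ballI add neg zero)
          (auto simp: ev c M.l_neg)
    next
      fix f g h assume fg: "f \<in> carrier (endo_ring M E)" "g \<in> carrier (endo_ring M E)"
      show "f \<oplus>\<^bsub>endo_ring M E\<^esub> g = g \<oplus>\<^bsub>endo_ring M E\<^esub> f"
        using fg unfolding endo_ring_simps by (intro ext add ballI) (auto simp: ev c M.a_comm)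
      assume h: "h \<in> carrier (endo_ring M E)"
      show "f \<oplus>\<^bsub>endo_ring M E\<^esub> g \<oplus>\<^bsub>endo_ring M E\<^esub> h = f \<oplus>\<^bsub>endo_ring M E\<^esub> (g \<oplus>\<^bsub>endo_ring M E\<^esub> h)"
        using fg h unfolding endo_ring_simps by (intro ext add ballI) (auto simp: ev c M.a_assoc)
    next
      fix f assume f: "f \<in> carrier (endo_ring M E)"
      show "\<zero>\<^bsub>endo_ring M E\<^esub> \<oplus>\<^bsub>endo_ring M E\<^esub> f = f"
        using f unfolding endo_ring_simps by (intro ext add zero ballI) (auto simp: ev c)
    qed (use zero add in auto)
    show "monoid (endo_ring M E)"
    proof (rule monoidI)
      fix f g h
      assume fgh: "f \<in> carrier (endo_ring M E)" "g \<in> carrier (endo_ring M E)" "h \<in> carrier (endo_ring M E)"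
      show "f \<otimes>\<^bsub>endo_ring M E\<^esub> g \<otimes>\<^bsub>endo_ring M E\<^esub> h = f \<otimes>\<^bsub>endo_ring M E\<^esub> (g \<otimes>\<^bsub>endo_ring M E\<^esub> h)"
        using fgh unfolding endo_ring_simps by (intro ext comp ballI) (auto simp: ev c)
    next
      fix f assume f: "f \<in> carrier (endo_ring M E)"
      show "\<one>\<^bsub>endo_ring M E\<^esub> \<otimes>\<^bsub>endo_ring M E\<^esub> f = f" "f \<otimes>\<^bsub>endo_ring M E\<^esub> \<one>\<^bsub>endo_ring M E\<^esub> = f"
        using f unfolding endo_ring_simps by ((intro ext comp one ballI; auto simp: ev c)+)
    qed (use one comp in auto)
  next
    fix f g h
    assume fgh: "f \<in> carrier (endo_ring M E)" "g \<in> carrier (endo_ring M E)" "h \<in> carrier (endo_ring M E)"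
    show "(f \<oplus>\<^bsub>endo_ring M E\<^esub> g) \<otimes>\<^bsub>endo_ring M E\<^esub> h
        = f \<otimes>\<^bsub>endo_ring M E\<^esub> h \<oplus>\<^bsub>endo_ring M E\<^esub> g \<otimes>\<^bsub>endo_ring M E\<^esub> h"
      using fgh unfolding endo_ring_simps by (intro ext comp add ballI) (auto simp: ev c)
    show "h \<otimes>\<^bsub>endo_ring M E\<^esub> (f \<oplus>\<^bsub>endo_ring M E\<^esub> g)
        = h \<otimes>\<^bsub>endo_ring M E\<^esub> f \<oplus>\<^bsub>endo_ring M E\<^esub> h \<otimes>\<^bsub>endo_ring M E\<^esub> g"
      using fgh unfolding endo_ring_simps by (intro ext comp add ballI) (auto simp: ev c additive)
  qed
qed

lemma bimod_power_simps [simp]: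
  "carrier (bimod_power n M) = {..<n} \<rightarrow>\<^sub>E carrier M"
  "zero (bimod_power n M) = (\<lambda>i\<in>{..<n}. \<zero>\<^bsub>M\<^esub>)"
  "add (bimod_power n M) x y = (\<lambda>i\<in>{..<n}. x i \<oplus>\<^bsub>M\<^esub> y i)"
  "smult (bimod_power n M) s x = (\<lambda>i\<in>{..<n}. s \<odot>\<^bsub>M\<^esub> x i)"
  "rsmult (bimod_power n M) x t = (\<lambda>i\<in>{..<n}. rsmult M (x i) t)"
  by (simp_all add: bimod_power_def)

lemma abelian_group_bimod_power:
  assumes "abelian_group M"
  shows "abelian_group (bimod_power n M)"
proof -
  interpret abelian_group M by fact
  show ?thesis
  proof (rule abelian_groupI)
    fix x assume x: "x \<in> carrier (bimod_power n M)"
    then have xc: "x i \<in> carrier M" if "i < n" for i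
      using that by auto
    show "\<exists>y\<in>carrier (bimod_power n M). y \<oplus>\<^bsub>bimod_power n M\<^esub> x = \<zero>\<^bsub>bimod_power n M\<^esub>"
      using xc by (intro bexI[of _ "\<lambda>i\<in>{..<n}. \<ominus>\<^bsub>M\<^esub> x i"])
        (simp_all add: l_neg cong: restrict_cong)
    have "\<zero>\<^bsub>bimod_power n M\<^esub> \<oplus>\<^bsub>bimod_power n M\<^esub> x = restrict x {..<n}"
      using xc by (simp cong: restrict_cong)
    then show "\<zero>\<^bsub>bimod_power n M\<^esub> \<oplus>\<^bsub>bimod_power n M\<^esub> x = x"
      using PiE_restrict[of x "{..<n}" "\<lambda>_. carrier M"] x by simp
  next
    fix x y z assume x: "x \<in> carrier (bimod_power n M)" and y: "y \<in> carrier (bimod_power n M)"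
    then have c: "x i \<in> carrier M" "y i \<in> carrier M" if "i < n" for i
      using that by auto
    show "x \<oplus>\<^bsub>bimod_power n M\<^esub> y \<in> carrier (bimod_power n M)"
      using c by simp
    show "x \<oplus>\<^bsub>bimod_power n M\<^esub> y = y \<oplus>\<^bsub>bimod_power n M\<^esub> x"
      using c by (simp add: a_comm cong: restrict_cong)
    assume "z \<in> carrier (bimod_power n M)"
    then have "z i \<in> carrier M" if "i < n" for i
      using that by auto
    with c show "x \<oplus>\<^bsub>bimod_power n M\<^esub> y \<oplus>\<^bsub>bimod_power n M\<^esub> z = x \<oplus>\<^bsub>bimod_power n M\<^esub> (y \<oplus>\<^bsub>bimod_power n M\<^esub> z)"
      by (simp add: a_assoc cong: restrict_cong)
  qed simp
qed

lemma is_bimodule_nat_bimod: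
  assumes "ring A" "subring B A"
  shows "is_bimodule (A\<lparr>carrier := B\<rparr>) (A\<lparr>carrier := B\<rparr>) (nat_bimod A)"
proof -
  interpret ring A by fact
  have B: "ring (A\<lparr>carrier := B\<rparr>)" by (rule subring_is_ring[OF assms(2)])
  have "abelian_group (nat_bimod A)" "abelian_group (right_mod (nat_bimod A))"
    by (rule abelian_group_cong[OF abelian_group_axioms]; simp)+
  moreover have "b \<in> carrier A" if "b \<in> B" for b
    using subringE(1)[OF assms(2)] that by auto
  ultimately show ?thesis
    using B ring_opp_ring[OF B]
    by (simp add: is_bimodule_def left_module_def left_module_axioms_def m_assoc l_distr r_distr)
qed

lemma is_bimodule_power:
  assumes M: "is_bimodule S T M"
  shows "is_bimodule S T (bimod_power n M)"
proof -
  have L: "left_module S M" and Rt: "left_module (opp_ring T) (right_mod M)"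
    and comm: "\<And>s x t. s \<in> carrier S \<Longrightarrow> x \<in> carrier M \<Longrightarrow> t \<in> carrier T \<Longrightarrow>
      rsmult M (s \<odot>\<^bsub>M\<^esub> x) t = s \<odot>\<^bsub>M\<^esub> rsmult M x t" and "ring T"
    using M by (auto simp: is_bimodule_def)
  have P: "abelian_group (bimod_power n M)"
    by (rule abelian_group_bimod_power[OF left_module_abelian_group[OF L]])
  then have P': "abelian_group (right_mod (bimod_power n M))"
    by (rule abelian_group_cong) simp_all
  have c: "x i \<in> carrier M" if "x \<in> {..<n} \<rightarrow>\<^sub>E carrier M" "i < n" for x i
    using that by auto
  have id: "(\<lambda>i\<in>{..<n}. x i) = x" if "x \<in> {..<n} \<rightarrow>\<^sub>E carrier M" for x
    using that by (rule PiE_restrict)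
  note l = left_module.smult_closed[OF L] left_module.smult_l_distr[OF L]
    left_module.smult_r_distr[OF L] left_module.smult_assoc1[OF L] left_module.smult_one[OF L]
  note r = left_module.smult_closed[OF Rt] left_module.smult_l_distr[OF Rt]
    left_module.smult_r_distr[OF Rt] left_module.smult_assoc1[OF Rt] left_module.smult_one[OF Rt]
  have "left_module S (bimod_power n M)"
    unfolding left_module_def left_module_axioms_def
    using P left_module_ring[OF L] by (simp add: c l id cong: restrict_cong)
  moreover have "left_module (opp_ring T) (right_mod (bimod_power n M))"
    unfolding left_module_def left_module_axioms_def
    using P' left_module_ring[OF Rt] by (simp add: c r[simplified] id cong: restrict_cong)
  ultimately show ?thesis
    using \<open>ring T\<close> by (simp add: is_bimodule_def c comm cong: restrict_cong)
qed

lemma submodule_closed: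
  assumes "submodule D S N"
  shows "d \<in> D \<Longrightarrow> d \<in> carrier N" "\<zero>\<^bsub>N\<^esub> \<in> D" "d \<in> D \<Longrightarrow> \<ominus>\<^bsub>N\<^esub> d \<in> D"
    "d \<in> D \<Longrightarrow> d' \<in> D \<Longrightarrow> d \<oplus>\<^bsub>N\<^esub> d' \<in> D" "s \<in> carrier S \<Longrightarrow> d \<in> D \<Longrightarrow> s \<odot>\<^bsub>N\<^esub> d \<in> D"
proof -
  have "subgroup D (add_monoid N)" using assms by (simp add: submodule_def)
  then show "d \<in> D \<Longrightarrow> d \<in> carrier N" "\<zero>\<^bsub>N\<^esub> \<in> D" "d \<in> D \<Longrightarrow> \<ominus>\<^bsub>N\<^esub> d \<in> D"
    "d \<in> D \<Longrightarrow> d' \<in> D \<Longrightarrow> d \<oplus>\<^bsub>N\<^esub> d' \<in> D"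
    using subgroup.mem_carrier[of D "add_monoid N"] subgroup.one_closed[of D "add_monoid N"]
      subgroup.m_inv_closed[of D "add_monoid N"] subgroup.m_closed[of D "add_monoid N"]
    by (auto simp: a_inv_def)
  show "s \<in> carrier S \<Longrightarrow> d \<in> D \<Longrightarrow> s \<odot>\<^bsub>N\<^esub> d \<in> D"
    using assms by (rule submodule.smult_closed)
qed

text \<open>
  With \<open>N = C \<oplus> D\<close> and \<open>F : M \<cong> C\<close>, each element of \<open>N\<close> is \<open>F a + d\<close> for unique
  \<open>a \<in> M\<close> and \<open>d \<in> D\<close>, and the retraction takes it to \<open>a\<close>.
\<close>
lemma direct_summand_retract:
  assumes M: "is_bimodule S T M" and N: "is_bimodule S T N"
    and summand: "iso_direct_summand S T M N"
  obtains F G where "F \<in> bimod_hom S T M N" "G \<in> bimod_hom S T N M"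
    "\<And>x. x \<in> carrier M \<Longrightarrow> G (F x) = x"
proof -
  have lM: "left_module S M" and rM: "left_module (opp_ring T) (right_mod M)"
    and lN: "left_module S N" and rN: "left_module (opp_ring T) (right_mod N)"
    using M N by (auto simp: is_bimodule_def)
  interpret M: abelian_group M by (rule left_module_abelian_group[OF lM])
  interpret N: abelian_group N by (rule left_module_abelian_group[OF lN])
  obtain C D F where C: "submodule C S N"
    and lD: "submodule D S N" and rD: "submodule D (opp_ring T) (right_mod N)"
    and CD: "C \<inter> D = {\<zero>\<^bsub>N\<^esub>}" and sum: "C <+>\<^bsub>N\<^esub> D = carrier N"
    and F: "F \<in> bimod_hom S T M (N\<lparr>carrier := C\<rparr>)" and bij: "bij_betw F (carrier M) C"
    using summand by (auto simp: iso_direct_summand_def subbimodule_def)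
  note Cc = submodule_closed[OF C] and Dc = submodule_closed[OF lD]
  have FC: "F a \<in> C" if "a \<in> carrier M" for a
    using that bij by (auto simp: bij_betw_def)
  then have FN: "F a \<in> carrier N" if "a \<in> carrier M" for a
    using that Cc(1) by blast
  have F_add: "F (a \<oplus>\<^bsub>M\<^esub> a') = F a \<oplus>\<^bsub>N\<^esub> F a'" if "a \<in> carrier M" "a' \<in> carrier M" for a a'
    using F that by (auto simp: bimod_hom_def mod_hom_def)
  have F_left: "F (s \<odot>\<^bsub>M\<^esub> a) = s \<odot>\<^bsub>N\<^esub> F a" if "s \<in> carrier S" "a \<in> carrier M" for s a
    using F that by (auto simp: bimod_hom_def mod_hom_def)
  have F_right: "F (rsmult M a t) = rsmult N (F a) t" if "t \<in> carrier T" "a \<in> carrier M" for t a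
    using F that by (auto simp: bimod_hom_def mod_hom_def)
  have F_N: "F \<in> bimod_hom S T M N"
    using F FN by (auto simp: bimod_hom_def mod_hom_def)
  have decompose: "\<exists>a\<in>carrier M. \<exists>d\<in>D. x = F a \<oplus>\<^bsub>N\<^esub> d" if "x \<in> carrier N" for x
  proof -
    have "x \<in> C <+>\<^bsub>N\<^esub> D" using that sum by simp
    then show ?thesis using bij by (auto simp: set_add_def' bij_betw_def)
  qed
  have unique: "a = a'"
    if "F a \<oplus>\<^bsub>N\<^esub> d = F a' \<oplus>\<^bsub>N\<^esub> d'" "a \<in> carrier M" "a' \<in> carrier M" "d \<in> D" "d' \<in> D" for a a' d d'
  proof -
    note c = FN[OF that(2)] FN[OF that(3)] Dc(1)[OF that(4)] Dc(1)[OF that(5)]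
    have "F a \<oplus>\<^bsub>N\<^esub> \<ominus>\<^bsub>N\<^esub> F a' = (F a \<oplus>\<^bsub>N\<^esub> \<ominus>\<^bsub>N\<^esub> F a') \<oplus>\<^bsub>N\<^esub> (d \<oplus>\<^bsub>N\<^esub> \<ominus>\<^bsub>N\<^esub> d)"
      using c by (simp add: N.r_neg)
    also have "\<dots> = (F a \<oplus>\<^bsub>N\<^esub> d) \<oplus>\<^bsub>N\<^esub> (\<ominus>\<^bsub>N\<^esub> F a' \<oplus>\<^bsub>N\<^esub> \<ominus>\<^bsub>N\<^esub> d)"
      using c by (simp add: N.a_ac)
    also have "\<dots> = (d' \<oplus>\<^bsub>N\<^esub> \<ominus>\<^bsub>N\<^esub> d) \<oplus>\<^bsub>N\<^esub> (F a' \<oplus>\<^bsub>N\<^esub> \<ominus>\<^bsub>N\<^esub> F a')"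
      unfolding that(1) using c by (simp add: N.a_ac)
    also have "\<dots> = d' \<oplus>\<^bsub>N\<^esub> \<ominus>\<^bsub>N\<^esub> d"
      using c by (simp add: N.r_neg)
    finally have eq: "F a \<oplus>\<^bsub>N\<^esub> \<ominus>\<^bsub>N\<^esub> F a' = d' \<oplus>\<^bsub>N\<^esub> \<ominus>\<^bsub>N\<^esub> d" .
    have "F a \<oplus>\<^bsub>N\<^esub> \<ominus>\<^bsub>N\<^esub> F a' \<in> C" by (intro Cc(3,4) FC that)
    moreover have "F a \<oplus>\<^bsub>N\<^esub> \<ominus>\<^bsub>N\<^esub> F a' \<in> D" unfolding eq by (intro Dc(3,4) that)
    ultimately have "F a \<oplus>\<^bsub>N\<^esub> \<ominus>\<^bsub>N\<^esub> F a' = \<zero>\<^bsub>N\<^esub>" using CD by blast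
    then have "F a = F a'"
      using c by (metis N.a_inv_closed N.minus_equality N.minus_minus)
    then show "a = a'" using that bij by (auto simp: bij_betw_def inj_on_def)
  qed
  define G where "G = (\<lambda>x\<in>carrier N. THE a. a \<in> carrier M \<and> (\<exists>d\<in>D. x = F a \<oplus>\<^bsub>N\<^esub> d))"
  have G: "G (F a \<oplus>\<^bsub>N\<^esub> d) = a" if "a \<in> carrier M" "d \<in> D" for a d
  proof -
    have "(THE a'. a' \<in> carrier M \<and> (\<exists>d'\<in>D. F a \<oplus>\<^bsub>N\<^esub> d = F a' \<oplus>\<^bsub>N\<^esub> d')) = a"
      using that unique by (intro the_equality) blast+
    then show ?thesis using that FN Dc(1) by (simp add: G_def)
  qed
  have G_left: "G \<in> mod_hom S N M"
  proof (rule mod_homI)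
    fix x assume "x \<in> carrier N"
    then obtain a d where x: "a \<in> carrier M" "d \<in> D" "x = F a \<oplus>\<^bsub>N\<^esub> d" using decompose by blast
    show "G x \<in> carrier M" using x G by simp
    show "G (x \<oplus>\<^bsub>N\<^esub> y) = G x \<oplus>\<^bsub>M\<^esub> G y" if y: "y \<in> carrier N" for y
    proof -
      obtain a' d' where y: "a' \<in> carrier M" "d' \<in> D" "y = F a' \<oplus>\<^bsub>N\<^esub> d'" using decompose[OF y] by blast
      have "x \<oplus>\<^bsub>N\<^esub> y = F (a \<oplus>\<^bsub>M\<^esub> a') \<oplus>\<^bsub>N\<^esub> (d \<oplus>\<^bsub>N\<^esub> d')"
        using x y FN Dc by (simp add: F_add N.a_ac)
      then show ?thesis using x y Dc by (simp add: G)
    qed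
    show "G (s \<odot>\<^bsub>N\<^esub> x) = s \<odot>\<^bsub>M\<^esub> G x" if s: "s \<in> carrier S" for s
    proof -
      have "s \<odot>\<^bsub>N\<^esub> x = F (s \<odot>\<^bsub>M\<^esub> a) \<oplus>\<^bsub>N\<^esub> s \<odot>\<^bsub>N\<^esub> d"
        using x s FN Dc by (simp add: F_left left_module.smult_r_distr[OF lN])
      then show ?thesis using x s Dc by (simp add: G left_module.smult_closed[OF lM])
    qed
  qed (simp add: G_def)
  have "G \<in> mod_hom (opp_ring T) (right_mod N) (right_mod M)"
  proof (rule mod_homI)
    fix t x assume t: "t \<in> carrier (opp_ring T)" and "x \<in> carrier (right_mod N)"
    then obtain a d where x: "a \<in> carrier M" "d \<in> D" "x = F a \<oplus>\<^bsub>N\<^esub> d"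
      using decompose[of x] by auto
    have "rsmult N x t = F (rsmult M a t) \<oplus>\<^bsub>N\<^esub> rsmult N d t"
      using x t FN Dc left_module.smult_r_distr[OF rN, of t "F a" d] by (simp add: F_right)
    then show "G (t \<odot>\<^bsub>right_mod N\<^esub> x) = t \<odot>\<^bsub>right_mod M\<^esub> G x"
      using x t submodule_closed(5)[OF rD t x(2)] left_module.smult_closed[OF rM, of t a] by (simp add: G)
  qed (use mod_hom_extensional[OF G_left] mod_hom_closed[OF G_left] mod_hom_add[OF G_left] in simp_all)
  then have "G \<in> bimod_hom S T N M" using G_left by (simp add: bimod_hom_def)
  moreover have "G (F x) = x" if "x \<in> carrier M" for x
    using G[OF that Dc(2)] FN[OF that] by simp
  ultimately show thesis using that F_N by blast
qed

section \<open>The centralizer of a ring extension\<close>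

locale ring_extension = ring A for A :: "('a, 'e) ring_scheme" (structure) +
  fixes B :: "'a set"
  assumes subring_B: "subring B A"
begin

lemma B_carrier: "b \<in> B \<Longrightarrow> b \<in> carrier A"
  using subringE(1)[OF subring_B] by auto

lemmas B_closed = subringE(2,3,5,6,7)[OF subring_B]

abbreviation S :: "('a \<Rightarrow> 'a) ring"
  where "S \<equiv> ext_End A B"

abbreviation R :: "'a set"
  where "R \<equiv> centralizer A B"

abbreviation Z :: "('a, 'e) ring_scheme"
  where "Z \<equiv> center (A\<lparr>carrier := B\<rparr>)"

abbreviation RM :: "('a \<Rightarrow> 'a, 'a, 'a) bimodule"
  where "RM \<equiv> centralizer_bimod A B"

lemma bimod_hom_nat_iff:
  "f \<in> bimod_hom (A\<lparr>carrier := B\<rparr>) (A\<lparr>carrier := B\<rparr>) (nat_bimod A) M \<longleftrightarrow>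
    f \<in> carrier A \<rightarrow>\<^sub>E carrier M \<and>
    (\<forall>x\<in>carrier A. \<forall>y\<in>carrier A. f (x \<oplus> y) = f x \<oplus>\<^bsub>M\<^esub> f y) \<and>
    (\<forall>b\<in>B. \<forall>x\<in>carrier A. f (b \<otimes> x) = b \<odot>\<^bsub>M\<^esub> f x) \<and>
    (\<forall>b\<in>B. \<forall>x\<in>carrier A. f (x \<otimes> b) = rsmult M (f x) b)"
  by (auto simp: bimod_hom_def mod_hom_def)

lemma S_iff: "\<alpha> \<in> carrier S \<longleftrightarrow> \<alpha> \<in> carrier A \<rightarrow>\<^sub>E carrier A \<and>
    (\<forall>x\<in>carrier A. \<forall>y\<in>carrier A. \<alpha> (x \<oplus> y) = \<alpha> x \<oplus> \<alpha> y) \<and>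
    (\<forall>b\<in>B. \<forall>x\<in>carrier A. \<alpha> (b \<otimes> x) = b \<otimes> \<alpha> x) \<and>
    (\<forall>b\<in>B. \<forall>x\<in>carrier A. \<alpha> (x \<otimes> b) = \<alpha> x \<otimes> b)"
  by (simp add: ext_End_def bimod_End_def bimod_hom_nat_iff)

lemma S_I:
  assumes "\<alpha> \<in> extensional (carrier A)" "\<And>x. x \<in> carrier A \<Longrightarrow> \<alpha> x \<in> carrier A"
    and "\<And>x y. x \<in> carrier A \<Longrightarrow> y \<in> carrier A \<Longrightarrow> \<alpha> (x \<oplus> y) = \<alpha> x \<oplus> \<alpha> y"
    and "\<And>b x. b \<in> B \<Longrightarrow> x \<in> carrier A \<Longrightarrow> \<alpha> (b \<otimes> x) = b \<otimes> \<alpha> x"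
    and "\<And>b x. b \<in> B \<Longrightarrow> x \<in> carrier A \<Longrightarrow> \<alpha> (x \<otimes> b) = \<alpha> x \<otimes> b"
  shows "\<alpha> \<in> carrier S"
  using assms by (auto simp: S_iff PiE_def)

lemma S_closed: "\<alpha> \<in> carrier S \<Longrightarrow> x \<in> carrier A \<Longrightarrow> \<alpha> x \<in> carrier A"
  and S_add: "\<alpha> \<in> carrier S \<Longrightarrow> x \<in> carrier A \<Longrightarrow> y \<in> carrier A \<Longrightarrow> \<alpha> (x \<oplus> y) = \<alpha> x \<oplus> \<alpha> y"
  and S_left: "\<alpha> \<in> carrier S \<Longrightarrow> b \<in> B \<Longrightarrow> x \<in> carrier A \<Longrightarrow> \<alpha> (b \<otimes> x) = b \<otimes> \<alpha> x"
  and S_right: "\<alpha> \<in> carrier S \<Longrightarrow> b \<in> B \<Longrightarrow> x \<in> carrier A \<Longrightarrow> \<alpha> (x \<otimes> b) = \<alpha> x \<otimes> b"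
  by (auto simp: S_iff)

lemma S_eqI:
  assumes "\<alpha> \<in> carrier S" "\<beta> \<in> carrier S" "\<forall>x\<in>carrier A. \<alpha> x = \<beta> x"
  shows "\<alpha> = \<beta>"
  using assms by (intro PiE_ext[of _ "carrier A" "\<lambda>_. carrier A"]) (auto simp: S_iff)

lemma S_mult [simp]: "\<alpha> \<otimes>\<^bsub>S\<^esub> \<beta> = compose (carrier A) \<alpha> \<beta>"
  and S_plus [simp]: "\<alpha> \<oplus>\<^bsub>S\<^esub> \<beta> = (\<lambda>x\<in>carrier A. \<alpha> x \<oplus> \<beta> x)"
  and S_one [simp]: "\<one>\<^bsub>S\<^esub> = (\<lambda>x\<in>carrier A. x)"
  and S_zero [simp]: "\<zero>\<^bsub>S\<^esub> = (\<lambda>x\<in>carrier A. \<zero>)"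
  by (simp_all add: ext_End_def bimod_End_def hom_add_def id_hom_def)

lemma ring_S: "ring S"
proof -
  have nat: "abelian_group (nat_bimod A)"
    by (rule abelian_group_cong[of A]) (simp_all add: abelian_group_axioms)
  have E: "carrier S = bimod_hom (A\<lparr>carrier := B\<rparr>) (A\<lparr>carrier := B\<rparr>) (nat_bimod A) (nat_bimod A)"
    by (simp add: ext_End_def bimod_End_def)
  have inv: "\<ominus>\<^bsub>nat_bimod A\<^esub> x = \<ominus> x" for x
    by (simp add: a_inv_def m_inv_def)
  have "ring (endo_ring (nat_bimod A) (carrier S))"
  proof (rule ring_endo_ring[OF nat])
    fix f g assume f: "f \<in> carrier S" and g: "g \<in> carrier S"
    note cf = S_closed[OF f] S_add[OF f] S_left[OF f] S_right[OF f] B_carrier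
    note cg = S_closed[OF g] S_add[OF g] S_left[OF g] S_right[OF g]
    show "hom_add (nat_bimod A) (nat_bimod A) f g \<in> carrier S"
      by (rule S_I) (simp_all add: hom_add_def cf cg a_ac l_distr r_distr)
    show "compose (carrier (nat_bimod A)) f g \<in> carrier S"
      by (rule S_I) (simp_all add: compose_eq cf cg)
    show "(\<lambda>x\<in>carrier (nat_bimod A). \<ominus>\<^bsub>nat_bimod A\<^esub> f x) \<in> carrier S"
      by (rule S_I) (simp_all add: inv cf l_minus r_minus minus_add)
  next
    show "id_hom (nat_bimod A) \<in> carrier S" "(\<lambda>x\<in>carrier (nat_bimod A). \<zero>\<^bsub>nat_bimod A\<^esub>) \<in> carrier S"
      by (auto intro!: S_I simp: id_hom_def B_carrier)
  qed (auto simp: S_iff)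
  then show ?thesis by (simp add: ext_End_def bimod_End_def)
qed

lemma R_iff: "r \<in> R \<longleftrightarrow> r \<in> carrier A \<and> (\<forall>b\<in>B. r \<otimes> b = b \<otimes> r)"
  by (simp add: centralizer_def)

lemma R_carrier: "r \<in> R \<Longrightarrow> r \<in> carrier A"
  and R_commute: "r \<in> R \<Longrightarrow> b \<in> B \<Longrightarrow> r \<otimes> b = b \<otimes> r"
  by (simp_all add: R_iff)

lemma Z_iff: "z \<in> carrier Z \<longleftrightarrow> z \<in> R \<and> z \<in> B"
  by (auto simp: center_def centralizer_def B_carrier)

lemma Z_simps [simp]: "add Z = add A" "zero Z = \<zero>" "one Z = \<one>" "monoid.mult Z = monoid.mult A"
  by (simp_all add: center_def)

lemma RM_simps [simp]:
  "carrier RM = R" "add RM = add A" "zero RM = \<zero>" "smult RM \<alpha> r = \<alpha> r" "rsmult RM = monoid.mult A"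
  by (simp_all add: centralizer_bimod_def)

lemma subring_R: "subring R A"
proof (rule subringI)
  fix r s assume rs: "r \<in> R" "s \<in> R"
  have "r \<otimes> s \<otimes> b = b \<otimes> (r \<otimes> s)" if "b \<in> B" for b
    using rs that by (metis R_carrier B_carrier R_commute m_assoc)
  then show "r \<otimes> s \<in> R" using rs by (simp add: R_iff)
qed (auto simp: R_iff B_carrier l_distr r_distr l_minus r_minus)

lemma subring_Z: "subring (R \<inter> B) A"
  using subringE[OF subring_R] subringE[OF subring_B] by (intro subringI) auto

lemma carrier_Z: "carrier Z = R \<inter> B"
  by (auto simp: Z_iff)

lemma ring_Z: "ring Z"
proof -
  have "Z = A\<lparr>carrier := R \<inter> B\<rparr>"
    using carrier_Z by (simp add: center_def)
  then show ?thesis using subring_is_ring[OF subring_Z] by simp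
qed

lemma abelian_group_RM: "abelian_group RM"
  using ring.is_abelian_group[OF subring_is_ring[OF subring_R]]
  by (rule abelian_group_cong) simp_all

lemma S_R: "\<alpha> \<in> carrier S \<Longrightarrow> r \<in> R \<Longrightarrow> \<alpha> r \<in> R"
  using R_commute[of r] by (auto simp: R_iff S_closed simp flip: S_left S_right)

lemma left_module_RM: "left_module S RM"
  using ring_S abelian_group_RM
  by (auto simp: left_module_def left_module_axioms_def S_R S_add R_carrier compose_eq)

lemma right_module_RM: "left_module (opp_ring Z) (right_mod RM)"
proof -
  have "abelian_group (right_mod RM)"
    using abelian_group_RM by (rule abelian_group_cong) simp_all
  then show ?thesis
    using ring_opp_ring[OF ring_Z] subringE(6)[OF subring_R]
    by (auto simp: left_module_def left_module_axioms_def Z_iff R_carrier B_carrier m_assoc l_distr r_distr)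
qed

lemma bimodule_RM: "is_bimodule S Z RM"
  using left_module_RM right_module_RM ring_Z
  by (auto simp: is_bimodule_def S_right Z_iff R_carrier)

lemma finsum_right_RM: "(\<And>i. i \<in> I \<Longrightarrow> f i \<in> R) \<Longrightarrow> (\<Oplus>\<^bsub>right_mod RM\<^esub>i\<in>I. f i) = (\<Oplus>i\<in>I. f i)"
  by (rule additive_finsum[where h = "\<lambda>x. x"])
    (auto simp: left_module_abelian_group[OF right_module_RM] R_carrier abelian_group_axioms)

lemma finsum_S_apply:
  assumes "\<And>i. i \<in> I \<Longrightarrow> \<alpha> i \<in> carrier S" "x \<in> carrier A"
  shows "(\<Oplus>\<^bsub>S\<^esub>i\<in>I. \<alpha> i) x = (\<Oplus>i\<in>I. \<alpha> i x)"
  using assms by (intro additive_finsum[where h = "\<lambda>\<alpha>. \<alpha> x"] ring.is_abelian_group[OF ring_S])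
    (auto simp: S_closed abelian_group_axioms)

text \<open>
  The dual of the bimodule \<open>A\<close>, that is, the bimodule maps \<open>A \<rightarrow> B\<close>, inside the ring \<open>S\<close>.
\<close>
definition forms :: "('a \<Rightarrow> 'a) set"
  where "forms = {\<phi> \<in> carrier S. \<forall>x\<in>carrier A. \<phi> x \<in> B}"

lemma forms_S: "\<phi> \<in> forms \<Longrightarrow> \<phi> \<in> carrier S"
  and forms_B: "\<phi> \<in> forms \<Longrightarrow> x \<in> carrier A \<Longrightarrow> \<phi> x \<in> B"
  by (simp_all add: forms_def)

lemma forms_Z: "\<phi> \<in> forms \<Longrightarrow> r \<in> R \<Longrightarrow> \<phi> r \<in> carrier Z"
  by (simp add: Z_iff S_R forms_S forms_B R_carrier)

definition outer :: "('a \<Rightarrow> 'a) \<Rightarrow> 'a \<Rightarrow> 'a \<Rightarrow> 'a"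
  where "outer \<phi> r = (\<lambda>x\<in>carrier A. \<phi> x \<otimes> r)"

lemma outer_S:
  assumes \<phi>: "\<phi> \<in> forms" and r: "r \<in> R"
  shows "outer \<phi> r \<in> carrier S"
proof -
  have c: "\<phi> x \<in> carrier A" if "x \<in> carrier A" for x
    using S_closed[OF forms_S[OF \<phi>] that] .
  have "\<phi> x \<otimes> b \<otimes> r = \<phi> x \<otimes> r \<otimes> b" if "x \<in> carrier A" "b \<in> B" for x b
    using that r by (simp add: m_assoc c B_carrier R_carrier R_commute)
  then show ?thesis
    using r by (simp add: S_iff outer_def c B_carrier R_carrier S_add[OF forms_S[OF \<phi>]] S_left[OF forms_S[OF \<phi>]]
      S_right[OF forms_S[OF \<phi>]] l_distr m_assoc)
qed

text \<open>Values of \<open>\<phi>\<close> lie in \<open>B\<close>, so \<open>\<alpha> (\<phi> x \<cdot> r) = \<phi> x \<cdot> \<alpha> r\<close>.\<close>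
lemma S_outer:
  assumes \<alpha>: "\<alpha> \<in> carrier S" and \<phi>: "\<phi> \<in> forms" and r: "r \<in> R"
  shows "\<alpha> \<otimes>\<^bsub>S\<^esub> outer \<phi> r = outer \<phi> (\<alpha> r)"
  using S_left[OF \<alpha> forms_B[OF \<phi>]] r by (auto simp: outer_def compose_def R_carrier)

lemma outer_hom:
  assumes \<phi>: "\<phi> \<in> forms"
  shows "(\<lambda>r\<in>R. outer \<phi> r) \<in> mod_hom S RM (nat_bimod S)"
  using subringE(7)[OF subring_R]
  by (intro mod_homI) (simp_all add: outer_S[OF \<phi>] S_R S_outer[OF _ \<phi>, unfolded S_mult],
      auto simp: outer_def r_distr R_carrier S_closed forms_S[OF \<phi>] intro!: restrict_ext)

lemma form_hom:
  assumes \<phi>: "\<phi> \<in> forms"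
  shows "restrict \<phi> R \<in> mod_hom (opp_ring Z) (right_mod RM) (nat_bimod (opp_ring Z))"
  using subringE(6,7)[OF subring_R]
  by (intro mod_homI) (simp_all add: forms_Z[OF \<phi>, unfolded Z_iff] S_add[OF forms_S[OF \<phi>]] S_right[OF forms_S[OF \<phi>]] R_carrier Z_iff)

lemma split_ext_form:
  assumes "split_ext A B"
  obtains p where "p \<in> forms" "\<And>b. b \<in> B \<Longrightarrow> p b = b"
proof -
  obtain p where p: "p \<in> bimod_hom (A\<lparr>carrier := B\<rparr>) (A\<lparr>carrier := B\<rparr>) (nat_bimod A) (nat_bimod (A\<lparr>carrier := B\<rparr>))"
    and id: "compose B p (\<lambda>b\<in>B. b) = id_hom (nat_bimod (A\<lparr>carrier := B\<rparr>))"
    using assms by (auto simp: split_ext_def split_mono_def)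
  have "p b = b" if "b \<in> B" for b
    using fun_cong[OF id, of b] that by (simp add: compose_eq id_hom_def)
  moreover have "p \<in> forms"
    using p by (auto simp: forms_def S_iff bimod_hom_nat_iff B_carrier PiE_iff)
  ultimately show thesis using that by blast
qed

text \<open>
  Apply the retraction of \<open>B\<^sup>n\<close> onto \<open>A\<close> to \<open>F a = (\<Sum>i. F a i \<cdot> e i)\<close>, where \<open>e i\<close> are the
  unit vectors. As \<open>b \<cdot> e i = e i \<cdot> b\<close> for \<open>b \<in> B\<close>, their images centralize \<open>B\<close>.
\<close>
lemma centrally_projective_coordinates:
  assumes "centrally_projective A B"
  obtains n :: nat and f r where "\<And>i. i < n \<Longrightarrow> f i \<in> forms" "\<And>i. i < n \<Longrightarrow> r i \<in> R"
    and "\<And>a. a \<in> carrier A \<Longrightarrow> (\<Oplus>i\<in>{..<n}. f i a \<otimes> r i) = a"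
proof -
  let ?B = "A\<lparr>carrier := B\<rparr>"
  have ring_B: "ring ?B" by (rule subring_is_ring[OF subring_B])
  have nat_B: "is_bimodule ?B ?B (nat_bimod ?B)"
    using is_bimodule_nat_bimod[OF ring_B ring.carrier_is_subring[OF ring_B]] by simp
  have nat_A: "is_bimodule ?B ?B (nat_bimod A)"
    by (rule is_bimodule_nat_bimod[OF ring_axioms subring_B])
  obtain n where "iso_direct_summand ?B ?B (nat_bimod A) (bimod_power n (nat_bimod ?B))"
    using assms by (auto simp: centrally_projective_def)
  let ?N = "bimod_power n (nat_bimod ?B)"
  from \<open>iso_direct_summand ?B ?B (nat_bimod A) ?N\<close> obtain F G where F: "F \<in> bimod_hom ?B ?B (nat_bimod A) ?N"
    and G: "G \<in> bimod_hom ?B ?B ?N (nat_bimod A)" and GF: "\<And>a. a \<in> carrier A \<Longrightarrow> G (F a) = a"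
    using direct_summand_retract[OF nat_A is_bimodule_power[OF nat_B]] by (metis nat_bimod_simps(1))
  have N: "abelian_group ?N"
    using is_bimodule_power[OF nat_B] left_module_abelian_group by (fastforce simp: is_bimodule_def)
  note zero_B = B_closed(1) and one_B = B_closed(2)
  define e where "e i = (\<lambda>j\<in>{..<n}. if j = i then \<one> else \<zero>)" for i
  have e: "e i \<in> carrier ?N" for i
    by (simp add: e_def zero_B one_B)
  have G_left: "G (b \<odot>\<^bsub>?N\<^esub> x) = b \<otimes> G x" and G_right: "G (rsmult ?N x b) = G x \<otimes> b"
    and G_closed: "G x \<in> carrier A" if "b \<in> B" "x \<in> carrier ?N" for b x
    using G that by (auto simp: bimod_hom_def mod_hom_def simp del: bimod_power_simps(4,5))
  have G_add: "G (x \<oplus>\<^bsub>?N\<^esub> y) = G x \<oplus> G y" if "x \<in> carrier ?N" "y \<in> carrier ?N" for x y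
    using G that by (auto simp: bimod_hom_def mod_hom_def simp del: bimod_power_simps(3))
  have F_B: "F a i \<in> B" if "a \<in> carrier A" "i < n" for a i
    using F that by (auto simp: bimod_hom_nat_iff)
  show thesis
  proof (rule that)
    fix i assume i: "i < n"
    show "(\<lambda>a\<in>carrier A. F a i) \<in> forms"
      using F i F_B by (auto simp: forms_def S_iff bimod_hom_nat_iff B_carrier)
    have "b \<odot>\<^bsub>?N\<^esub> e i = rsmult ?N (e i) b" if "b \<in> B" for b
      using that by (auto simp: e_def B_carrier intro!: restrict_ext)
    then have "G (e i) \<otimes> b = b \<otimes> G (e i)" if "b \<in> B" for b
      using that e[of i] by (metis G_left G_right)
    then show "G (e i) \<in> R"
      using G_closed[OF one_B e] by (simp add: R_iff)
  next
    fix a assume a: "a \<in> carrier A"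
    define x where "x = F a"
    have x: "x \<in> carrier ?N" "\<And>i. i < n \<Longrightarrow> x i \<in> B"
      using a F by (auto simp: x_def bimod_hom_nat_iff F_B)
    have xe: "x i \<odot>\<^bsub>?N\<^esub> e i \<in> carrier ?N" if "i < n" for i
      using x(2)[OF that] by (simp add: e_def B_closed)
    have "(\<Oplus>\<^bsub>?N\<^esub>i\<in>{..<n}. x i \<odot>\<^bsub>?N\<^esub> e i) = x"
    proof (rule extensionalityI[of _ "{..<n}"])
      have c: "(\<Oplus>\<^bsub>?N\<^esub>i\<in>{..<n}. x i \<odot>\<^bsub>?N\<^esub> e i) \<in> carrier ?N"
        using xe by (intro finsum_in_carrier N) auto
      then show "(\<Oplus>\<^bsub>?N\<^esub>i\<in>{..<n}. x i \<odot>\<^bsub>?N\<^esub> e i) \<in> extensional {..<n}"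
        by (simp add: PiE_def)
      show "x \<in> extensional {..<n}" using x(1) by (simp add: PiE_def)
      fix j assume j: "j \<in> {..<n}"
      have "(\<Oplus>\<^bsub>?N\<^esub>i\<in>{..<n}. x i \<odot>\<^bsub>?N\<^esub> e i) j = (\<Oplus>i\<in>{..<n}. (x i \<odot>\<^bsub>?N\<^esub> e i) j)"
        using j xe B_carrier
        by (intro additive_finsum[where h = "\<lambda>x. x j"] N abelian_group_axioms) (auto simp: PiE_mem)
      also have "\<dots> = (\<Oplus>i\<in>{..<n}. if j = i then x i else \<zero>)"
        using j x(2) B_carrier by (intro finsum_eqI abelian_group_axioms) (auto simp: e_def)
      also have "\<dots> = x j"
        using j x(2) B_carrier by (intro finsum_singleton) auto
      finally show "(\<Oplus>\<^bsub>?N\<^esub>i\<in>{..<n}. x i \<odot>\<^bsub>?N\<^esub> e i) j = x j" .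
    qed
    then have "G x = (\<Oplus>i\<in>{..<n}. G (x i \<odot>\<^bsub>?N\<^esub> e i))"
      using additive_finsum[OF N abelian_group_axioms, of G "\<lambda>i. x i \<odot>\<^bsub>?N\<^esub> e i" "{..<n}"] xe G_add
        G_closed[OF one_B] by (auto simp del: bimod_power_simps)
    also have "\<dots> = (\<Oplus>i\<in>{..<n}. x i \<otimes> G (e i))"
      using x(2) e G_closed[OF one_B e] B_carrier
      by (intro finsum_eqI abelian_group_axioms) (auto simp: G_left simp del: bimod_power_simps)
    finally show "(\<Oplus>i\<in>{..<n}. (\<lambda>a\<in>carrier A. F a i) a \<otimes> G (e i)) = a"
      using GF[OF a] a by (simp add: x_def)
  qed
qed

lemma one_R: "\<one> \<in> R" and one_B: "\<one> \<in> B"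
  using subringE(3)[OF subring_R] subringE(3)[OF subring_B] by auto

lemma outer_apply: "x \<in> carrier A \<Longrightarrow> outer \<phi> r x = \<phi> x \<otimes> r"
  by (simp add: outer_def)

context
  fixes p :: "'a \<Rightarrow> 'a"
  assumes p: "p \<in> forms" and p_B: "\<And>b. b \<in> B \<Longrightarrow> p b = b"
begin

lemma p_one: "p \<one> = \<one>"
  by (rule p_B[OF one_B])

text \<open>A dual basis with one element: \<open>R\<close> is a direct summand of \<open>S\<close>, generated by \<open>1\<close>.\<close>
lemma left_expand:
  assumes r: "r \<in> R"
  shows "(\<Oplus>\<^bsub>RM\<^esub>i\<in>{()}. (\<lambda>r\<in>R. outer p r) r \<odot>\<^bsub>RM\<^esub> \<one>) = r"
  using r by (subst finsum_unit) (simp_all add: abelian_group_RM outer_apply p_one R_carrier)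

lemma left_fin_gen: "fin_gen S RM"
  using left_expand outer_hom[OF p] one_R left_module_RM
  by (intro dual_basis_imp_fin_gen[where I = "{()}" and m = "\<lambda>_. \<one>" and \<phi> = "\<lambda>_. \<lambda>r\<in>R. outer p r"]) simp_all

lemma left_projective: "projective_mod TYPE('u::infinite) S RM"
  using left_expand outer_hom[OF p] one_R left_module_RM
  by (intro dual_basis_imp_projective[where I = "{()}" and m = "\<lambda>_. \<one>" and \<phi> = "\<lambda>_. \<lambda>r\<in>R. outer p r"]) simp_all

lemma right_generator: "generator_mod TYPE('u::infinite) (opp_ring Z) (right_mod RM)"
proof (rule unit_trace_imp_generator[where I = "{()}" and m = "\<lambda>_. \<one>" and \<phi> = "\<lambda>_. restrict p R"])
  have "\<one> \<in> carrier Z" by (simp add: Z_iff one_R one_B)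
  then show "(\<Oplus>\<^bsub>opp_ring Z\<^esub>i\<in>{()}. restrict p R \<one>) = \<one>\<^bsub>opp_ring Z\<^esub>"
    by (subst finsum_unit) (simp_all add: ring.is_abelian_group[OF ring_opp_ring[OF ring_Z]] one_R p_one)
qed (simp_all add: right_module_RM one_R form_hom[OF p])

text \<open>
  An \<open>S\<close>-linear \<open>\<theta>\<close> is determined by \<open>\<theta> 1\<close>, since \<open>1\<close> generates \<open>R\<close>. That \<open>\<theta>\<close> is
  multiplication by the central element \<open>p (\<theta> 1)\<close> follows by letting \<open>outer p r\<close> act on \<open>1\<close>
  before and after \<open>\<theta>\<close>.
\<close>
lemma right_mult_iso: "(\<lambda>z. \<lambda>x\<in>carrier RM. rsmult RM x z) \<in> ring_iso Z (opp_ring (mod_End S RM))"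
proof -
  let ?h = "\<lambda>z. \<lambda>x\<in>R. x \<otimes> z"
  have cl: "?h z \<in> mod_hom S RM RM" if z: "z \<in> carrier Z" for z
    using z subringE(6)[OF subring_R]
    by (intro mod_homI) (auto simp: Z_iff R_carrier B_carrier l_distr S_right S_R subringE(7)[OF subring_R])
  have "?h \<in> ring_hom Z (opp_ring (mod_End S RM))"
    using subringE(6)[OF subring_R]
    by (intro ring_hom_memI)
      (auto simp: mod_End_def cl hom_add_def id_hom_def compose_def Z_iff R_carrier m_assoc r_distr
        intro!: restrict_ext)
  moreover have "bij_betw ?h (carrier Z) (carrier (opp_ring (mod_End S RM)))"
  proof (rule bij_betwI'[of _ ?h])
    fix z z' assume z: "z \<in> carrier Z" "z' \<in> carrier Z"
    show "?h z = ?h z' \<longleftrightarrow> z = z'"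
    proof
      assume "?h z = ?h z'"
      from fun_cong[OF this, of \<one>] show "z = z'" using z one_R by (simp add: Z_iff R_carrier)
    qed simp
  next
    fix \<theta> assume "\<theta> \<in> carrier (opp_ring (mod_End S RM))"
    then have \<theta>: "\<theta> \<in> mod_hom S RM RM" by (simp add: mod_End_def)
    have t: "\<theta> \<one> \<in> R" using mod_hom_closed[OF \<theta>] one_R by simp
    have z: "p (\<theta> \<one>) \<in> carrier Z" by (rule forms_Z[OF p t])
    have "\<theta> r = r \<otimes> p (\<theta> \<one>)" if r: "r \<in> R" for r
    proof -
      have "\<theta> r = \<theta> (outer p r \<one>)" using r by (simp add: outer_apply p_one R_carrier)
      also have "\<dots> = outer p r (\<theta> \<one>)"
        using mod_hom_smult[OF \<theta>, of "outer p r" \<one>] outer_S[OF p r] one_R by simp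
      also have "\<dots> = r \<otimes> p (\<theta> \<one>)"
        using t z r R_commute[OF r, of "p (\<theta> \<one>)"] by (simp add: outer_apply R_carrier Z_iff)
      finally show ?thesis .
    qed
    then have "\<theta> = ?h (p (\<theta> \<one>))"
      using mod_hom_extensional[OF \<theta>] by (intro extensionalityI[of _ R]) auto
    then show "\<exists>z\<in>carrier Z. \<theta> = ?h z" using z by blast
  qed (simp add: mod_End_def cl)
  ultimately show ?thesis by (simp add: ring_iso_def)
qed

end

context
  fixes n :: nat and f :: "nat \<Rightarrow> 'a \<Rightarrow> 'a" and r :: "nat \<Rightarrow> 'a"
  assumes f: "\<And>i. i < n \<Longrightarrow> f i \<in> forms" and r: "\<And>i. i < n \<Longrightarrow> r i \<in> R"
    and expand: "\<And>a. a \<in> carrier A \<Longrightarrow> (\<Oplus>i\<in>{..<n}. f i a \<otimes> r i) = a"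
begin

lemma f_closed: "i < n \<Longrightarrow> a \<in> carrier A \<Longrightarrow> f i a \<in> carrier A"
  using S_closed[OF forms_S[OF f]] by blast

lemma sum_outer: "(\<Oplus>\<^bsub>S\<^esub>i\<in>{..<n}. outer (f i) (r i)) = \<one>\<^bsub>S\<^esub>"
proof (rule S_eqI)
  show "(\<Oplus>\<^bsub>S\<^esub>i\<in>{..<n}. outer (f i) (r i)) \<in> carrier S"
    using outer_S f r by (intro finsum_in_carrier ring.is_abelian_group[OF ring_S]) auto
  show "\<one>\<^bsub>S\<^esub> \<in> carrier S" by (rule monoid.one_closed[OF ring.is_monoid[OF ring_S]])
  show "\<forall>x\<in>carrier A. (\<Oplus>\<^bsub>S\<^esub>i\<in>{..<n}. outer (f i) (r i)) x = \<one>\<^bsub>S\<^esub> x"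
  proof
    fix x assume x: "x \<in> carrier A"
    have "(\<Oplus>\<^bsub>S\<^esub>i\<in>{..<n}. outer (f i) (r i)) x = (\<Oplus>i\<in>{..<n}. outer (f i) (r i) x)"
      using outer_S f r x by (intro finsum_S_apply) auto
    then show "(\<Oplus>\<^bsub>S\<^esub>i\<in>{..<n}. outer (f i) (r i)) x = \<one>\<^bsub>S\<^esub> x"
      using x by (simp add: outer_apply expand)
  qed
qed

lemma left_generator: "generator_mod TYPE('u::infinite) S RM"
proof (rule unit_trace_imp_generator[where I = "{..<n}" and m = r and \<phi> = "\<lambda>i. \<lambda>x\<in>R. outer (f i) x"])
  have "(\<Oplus>\<^bsub>S\<^esub>i\<in>{..<n}. (\<lambda>x\<in>R. outer (f i) x) (r i)) = (\<Oplus>\<^bsub>S\<^esub>i\<in>{..<n}. outer (f i) (r i))"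
    using outer_S f r by (intro finsum_eqI ring.is_abelian_group[OF ring_S]) auto
  then show "(\<Oplus>\<^bsub>S\<^esub>i\<in>{..<n}. (\<lambda>x\<in>R. outer (f i) x) (r i)) = \<one>\<^bsub>S\<^esub>"
    by (simp only: sum_outer)
qed (use r outer_hom[OF f] left_module_RM in auto)

lemma right_expand:
  assumes x: "x \<in> R"
  shows "(\<Oplus>\<^bsub>right_mod RM\<^esub>i\<in>{..<n}. restrict (f i) R x \<odot>\<^bsub>right_mod RM\<^esub> r i) = x"
proof -
  have fZ: "f i x \<in> R" "f i x \<in> B" if "i < n" for i
    using forms_Z[OF f[OF that] x] by (simp_all add: Z_iff)
  have "(\<Oplus>\<^bsub>right_mod RM\<^esub>i\<in>{..<n}. restrict (f i) R x \<odot>\<^bsub>right_mod RM\<^esub> r i)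
      = (\<Oplus>i\<in>{..<n}. restrict (f i) R x \<odot>\<^bsub>right_mod RM\<^esub> r i)"
    using x fZ r subringE(6)[OF subring_R] by (intro finsum_right_RM) auto
  also have "\<dots> = (\<Oplus>i\<in>{..<n}. f i x \<otimes> r i)"
  proof (rule finsum_eqI[OF abelian_group_axioms])
    fix i assume i: "i \<in> {..<n}"
    then show "f i x \<otimes> r i \<in> carrier A" using fZ r R_carrier by simp
    show "restrict (f i) R x \<odot>\<^bsub>right_mod RM\<^esub> r i = f i x \<otimes> r i"
      using i x R_commute[OF r fZ(2), of i i] by simp
  qed
  finally show ?thesis using expand[of x] x by (simp add: R_carrier)
qed

lemma right_fin_gen: "fin_gen (opp_ring Z) (right_mod RM)"
  using right_expand form_hom[OF f] r right_module_RM
  by (intro dual_basis_imp_fin_gen[where I = "{..<n}" and m = r and \<phi> = "\<lambda>i. restrict (f i) R"]) auto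

lemma right_projective: "projective_mod TYPE('u::infinite) (opp_ring Z) (right_mod RM)"
  using right_expand form_hom[OF f] r right_module_RM
  by (intro dual_basis_imp_projective[where I = "{..<n}" and m = r and \<phi> = "\<lambda>i. restrict (f i) R"]) auto

text \<open>
  \<open>Z\<close>-linearity of \<open>\<theta>\<close> applied to \<open>x = (\<Sum>i. r i \<cdot> f i x)\<close> gives the formula for an extension
  to \<open>A\<close>, with coefficients \<open>f i x \<in> Z\<close> that commute with the \<open>\<theta> (r i)\<close>.
\<close>
lemma extend_endo:
  assumes \<theta>: "\<theta> \<in> mod_hom (opp_ring Z) (right_mod RM) (right_mod RM)"
  obtains \<alpha> where "\<alpha> \<in> carrier S" "\<And>x. x \<in> R \<Longrightarrow> \<alpha> x = \<theta> x"
proof -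
  have \<theta>R: "\<theta> x \<in> R" if "x \<in> R" for x
    using mod_hom_closed[OF \<theta>] that by simp
  define \<alpha> where "\<alpha> = (\<Oplus>\<^bsub>S\<^esub>i\<in>{..<n}. outer (f i) (\<theta> (r i)))"
  have "\<alpha> \<in> carrier S"
    unfolding \<alpha>_def using outer_S f r \<theta>R
    by (intro finsum_in_carrier ring.is_abelian_group[OF ring_S]) auto
  moreover have "\<alpha> x = \<theta> x" if x: "x \<in> R" for x
  proof -
    have fZ: "f i x \<in> R" "f i x \<in> B" if "i < n" for i
      using forms_Z[OF f[OF that] x] by (simp_all add: Z_iff)
    have "\<theta> x = \<theta> (\<Oplus>\<^bsub>right_mod RM\<^esub>i\<in>{..<n}. restrict (f i) R x \<odot>\<^bsub>right_mod RM\<^esub> r i)"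
      by (simp only: right_expand[OF x])
    also have "\<dots> = (\<Oplus>\<^bsub>right_mod RM\<^esub>i\<in>{..<n}. \<theta> (restrict (f i) R x \<odot>\<^bsub>right_mod RM\<^esub> r i))"
      using x fZ r subringE(6)[OF subring_R]
      by (intro mod_hom_finsum[OF right_module_RM right_module_RM \<theta>]) auto
    also have "\<dots> = (\<Oplus>i\<in>{..<n}. \<theta> (restrict (f i) R x \<odot>\<^bsub>right_mod RM\<^esub> r i))"
      using x fZ r subringE(6)[OF subring_R] \<theta>R by (intro finsum_right_RM) auto
    also have "\<dots> = (\<Oplus>i\<in>{..<n}. f i x \<otimes> \<theta> (r i))"
    proof (rule finsum_eqI[OF abelian_group_axioms])
      fix i assume i: "i \<in> {..<n}"
      then show "f i x \<otimes> \<theta> (r i) \<in> carrier A"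
        using fZ \<theta>R r R_carrier by simp
      show "\<theta> (restrict (f i) R x \<odot>\<^bsub>right_mod RM\<^esub> r i) = f i x \<otimes> \<theta> (r i)"
        using i x fZ[of i] r[of i] mod_hom_smult[OF \<theta>, of "f i x" "r i"] R_commute[OF \<theta>R[OF r], of i "f i x"]
        by (simp add: Z_iff)
    qed
    also have "\<dots> = \<alpha> x"
    proof -
      have "\<alpha> x = (\<Oplus>i\<in>{..<n}. outer (f i) (\<theta> (r i)) x)"
        unfolding \<alpha>_def using outer_S f r \<theta>R R_carrier[OF x] by (intro finsum_S_apply) auto
      then show ?thesis using R_carrier[OF x] by (simp add: outer_apply)
    qed
    finally show ?thesis by simp
  qed
  ultimately show thesis using that by blast
qed

text \<open>As a left \<open>B\<close>-module, \<open>A\<close> is generated by the \<open>r i \<in> R\<close>.\<close>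
lemma S_determined_by_R:
  assumes \<alpha>: "\<alpha> \<in> carrier S" and \<beta>: "\<beta> \<in> carrier S" and eq: "\<And>x. x \<in> R \<Longrightarrow> \<alpha> x = \<beta> x"
  shows "\<alpha> = \<beta>"
proof (rule S_eqI[OF \<alpha> \<beta>], rule ballI)
  have *: "\<gamma> a = (\<Oplus>i\<in>{..<n}. f i a \<otimes> \<gamma> (r i))" if \<gamma>: "\<gamma> \<in> carrier S" and a: "a \<in> carrier A" for \<gamma> a
  proof -
    have "\<gamma> a = \<gamma> (\<Oplus>i\<in>{..<n}. f i a \<otimes> r i)" by (simp only: expand[OF a])
    also have "\<dots> = (\<Oplus>i\<in>{..<n}. \<gamma> (f i a \<otimes> r i))"
      using a f_closed r R_carrier
      by (intro additive_finsum abelian_group_axioms) (auto simp: S_closed[OF \<gamma>] S_add[OF \<gamma>])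
    also have "\<dots> = (\<Oplus>i\<in>{..<n}. f i a \<otimes> \<gamma> (r i))"
      using a f_closed r R_carrier forms_B[OF f]
      by (intro finsum_eqI abelian_group_axioms) (auto simp: S_closed[OF \<gamma>] S_left[OF \<gamma>])
    finally show ?thesis .
  qed
  fix a assume a: "a \<in> carrier A"
  have "(\<Oplus>i\<in>{..<n}. f i a \<otimes> \<alpha> (r i)) = (\<Oplus>i\<in>{..<n}. f i a \<otimes> \<beta> (r i))"
    using a r eq f_closed S_closed[OF \<beta>] R_carrier by (intro finsum_eqI abelian_group_axioms) auto
  then show "\<alpha> a = \<beta> a" using *[OF \<alpha> a] *[OF \<beta> a] by simp
qed

lemma evaluation_iso: "(\<lambda>\<alpha>. \<lambda>x\<in>carrier RM. \<alpha> \<odot>\<^bsub>RM\<^esub> x) \<in> ring_iso S (mod_End (opp_ring Z) (right_mod RM))"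
proof -
  let ?h = "\<lambda>\<alpha>. restrict \<alpha> R"
  have cl: "?h \<alpha> \<in> mod_hom (opp_ring Z) (right_mod RM) (right_mod RM)" if \<alpha>: "\<alpha> \<in> carrier S" for \<alpha>
    using subringE(6,7)[OF subring_R]
    by (intro mod_homI) (simp_all add: Z_iff S_R[OF \<alpha>] R_carrier S_add[OF \<alpha>] S_right[OF \<alpha>])
  have "?h \<in> ring_hom S (mod_End (opp_ring Z) (right_mod RM))"
    by (intro ring_hom_memI)
      (auto simp: mod_End_def cl hom_add_def id_hom_def compose_def R_carrier S_R intro!: restrict_ext)
  moreover have "bij_betw ?h (carrier S) (carrier (mod_End (opp_ring Z) (right_mod RM)))"
  proof (rule bij_betwI'[of _ ?h])
    fix \<alpha> \<beta> assume ab: "\<alpha> \<in> carrier S" "\<beta> \<in> carrier S"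
    show "?h \<alpha> = ?h \<beta> \<longleftrightarrow> \<alpha> = \<beta>"
    proof
      assume "?h \<alpha> = ?h \<beta>"
      then show "\<alpha> = \<beta>" by (intro S_determined_by_R ab) (metis restrict_apply')
    qed simp
  next
    fix \<theta> assume "\<theta> \<in> carrier (mod_End (opp_ring Z) (right_mod RM))"
    then have \<theta>: "\<theta> \<in> mod_hom (opp_ring Z) (right_mod RM) (right_mod RM)" by (simp add: mod_End_def)
    obtain \<alpha> where \<alpha>: "\<alpha> \<in> carrier S" "\<And>x. x \<in> R \<Longrightarrow> \<alpha> x = \<theta> x"
      using extend_endo[OF \<theta>] by blast
    have "\<theta> = ?h \<alpha>"
      using mod_hom_extensional[OF \<theta>] \<alpha>(2) by (intro extensionalityI[of _ R]) auto
    then show "\<exists>\<alpha>\<in>carrier S. \<theta> = ?h \<alpha>" using \<alpha>(1) by blast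
  qed (simp add: mod_End_def cl)
  ultimately show ?thesis by (simp add: ring_iso_def)
qed

text \<open>
  The idempotent is \<open>e = outer p 1\<close>, which is \<open>p\<close>. Its corner consists of the \<open>outer p z\<close> with
  \<open>z \<in> Z\<close> because \<open>e \<circ> \<alpha> \<circ> e = outer p (p (\<alpha> 1))\<close>, and it is full with \<open>u i = outer p (r i)\<close>
  and \<open>v i = f i\<close>.
\<close>
lemma S_Z_morita:
  assumes p: "p \<in> forms" and p_B: "\<And>b. b \<in> B \<Longrightarrow> p b = b"
  shows "morita_equivalent TYPE('u::infinite) S Z"
proof -
  have p1: "p \<one> = \<one>" by (rule p_B[OF one_B])
  note o = outer_S[OF p]
  have oo: "outer p s \<otimes>\<^bsub>S\<^esub> outer p s' = outer p (p s' \<otimes> s)" if "s \<in> R" "s' \<in> R" for s s'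
    using S_outer[OF o[OF that(1)] p that(2)] that by (simp add: outer_apply R_carrier)
  have absorb: "outer p \<one> \<otimes>\<^bsub>S\<^esub> \<phi> = \<phi>" if \<phi>: "\<phi> \<in> forms" for \<phi>
  proof (rule S_eqI)
    show "outer p \<one> \<otimes>\<^bsub>S\<^esub> \<phi> \<in> carrier S" "\<phi> \<in> carrier S"
      using o[OF one_R] forms_S[OF \<phi>] monoid.m_closed[OF ring.is_monoid[OF ring_S]] by blast+
    show "\<forall>x\<in>carrier A. (outer p \<one> \<otimes>\<^bsub>S\<^esub> \<phi>) x = \<phi> x"
      using S_closed[OF forms_S[OF \<phi>]] forms_B[OF \<phi>] by (simp add: compose_eq outer_apply p_B)
  qed
  have "full_corner S Z (outer p) {..<n} (\<lambda>i. outer p (r i)) f"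
  proof (intro full_corner.intro full_corner_axioms.intro ring_S ring_Z)
    fix t t' assume t: "t \<in> carrier Z" and t': "t' \<in> carrier Z"
    note tc = t[unfolded Z_iff] t'[unfolded Z_iff]
    show "outer p t \<in> carrier S" using o tc by simp
    show "outer p (t \<oplus>\<^bsub>Z\<^esub> t') = outer p t \<oplus>\<^bsub>S\<^esub> outer p t'"
      using tc S_closed[OF forms_S[OF p]] by (auto simp: outer_def R_carrier r_distr intro!: restrict_ext)
    show "outer p (t \<otimes>\<^bsub>Z\<^esub> t') = outer p t \<otimes>\<^bsub>S\<^esub> outer p t'"
      using oo[of t t'] tc by (simp add: p_B R_commute)
  next
    show "inj_on (outer p) (carrier Z)"
    proof (rule inj_onI)
      fix t t' assume t: "t \<in> carrier Z" "t' \<in> carrier Z" and "outer p t = outer p t'"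
      from fun_cong[OF this(3), of \<one>] show "t = t'"
        using t by (simp add: outer_apply p1 Z_iff R_carrier)
    qed
  next
    fix \<alpha> assume \<alpha>: "\<alpha> \<in> carrier S"
    have e\<alpha>: "outer p \<one> \<otimes>\<^bsub>S\<^esub> \<alpha> \<in> carrier S"
      using o[OF one_R] \<alpha> monoid.m_closed[OF ring.is_monoid[OF ring_S]] by blast
    have \<alpha>1: "\<alpha> \<one> \<in> R" by (rule S_R[OF \<alpha> one_R])
    have "outer p \<one> \<otimes>\<^bsub>S\<^esub> \<alpha> \<otimes>\<^bsub>S\<^esub> outer p \<one> = outer p (p (\<alpha> \<one>))"
      using S_outer[OF e\<alpha> p one_R] \<alpha>1 S_closed[OF forms_S[OF p]]
      by (simp add: compose_eq outer_apply R_carrier)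
    then show "outer p \<one>\<^bsub>Z\<^esub> \<otimes>\<^bsub>S\<^esub> \<alpha> \<otimes>\<^bsub>S\<^esub> outer p \<one>\<^bsub>Z\<^esub> \<in> outer p ` carrier Z"
      using forms_Z[OF p \<alpha>1] by simp
  next
    fix i assume "i \<in> {..<n}"
    then have i: "i < n" by simp
    show "outer p (r i) \<in> carrier S" by (rule o[OF r[OF i]])
    show "f i \<in> carrier S" by (rule forms_S[OF f[OF i]])
    show "outer p (r i) \<otimes>\<^bsub>S\<^esub> outer p \<one>\<^bsub>Z\<^esub> = outer p (r i)"
      using oo[OF r[OF i] one_R] r[OF i] by (simp add: p1 R_carrier)
    show "outer p \<one>\<^bsub>Z\<^esub> \<otimes>\<^bsub>S\<^esub> f i = f i"
      using absorb[OF f[OF i]] by simp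
  next
    have "outer p (r i) \<otimes>\<^bsub>S\<^esub> f i = outer (f i) (r i)" if "i < n" for i
      using that f_closed forms_B[OF f] by (auto simp: compose_def outer_def p_B intro!: restrict_ext)
    then have "(\<Oplus>\<^bsub>S\<^esub>i\<in>{..<n}. outer p (r i) \<otimes>\<^bsub>S\<^esub> f i) = (\<Oplus>\<^bsub>S\<^esub>i\<in>{..<n}. outer (f i) (r i))"
      using outer_S f r by (intro finsum_eqI ring.is_abelian_group[OF ring_S]) (auto simp del: S_mult)
    then show "(\<Oplus>\<^bsub>S\<^esub>i\<in>{..<n}. outer p (r i) \<otimes>\<^bsub>S\<^esub> f i) = \<one>\<^bsub>S\<^esub>"
      by (simp only: sum_outer)
  qed simp
  then show ?thesis by (rule full_corner.morita_equivalent)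
qed

end

end

theorem lemma1p1:
  fixes A :: "('a, 'e) ring_scheme" and B :: "'a set"
  assumes "ring A" and "subring B A"
  shows
    "(split_ext A B \<longrightarrow>
        fin_gen (ext_End A B) (centralizer_bimod A B) \<and>
        projective_mod TYPE('u::infinite) (ext_End A B) (centralizer_bimod A B)) \<and>
     (centrally_projective A B \<longrightarrow>
        generator_mod TYPE('u) (ext_End A B) (centralizer_bimod A B)) \<and>
     (split_ext A B \<and> centrally_projective A B \<longrightarrow>
        faithfully_balanced (ext_End A B) (center (A\<lparr>carrier := B\<rparr>)) (centralizer_bimod A B) \<and>
        progenerator_bimod TYPE('u) (ext_End A B) (center (A\<lparr>carrier := B\<rparr>)) (centralizer_bimod A B) \<and>
        morita_equivalent TYPE('u) (ext_End A B) (center (A\<lparr>carrier := B\<rparr>)))"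
proof -
  interpret ring_extension A B
    using assms by (simp add: ring_extension_def ring_extension_axioms_def)
  have split: "fin_gen S RM \<and> projective_mod TYPE('u) S RM" if s: "split_ext A B"
  proof -
    obtain p where p: "p \<in> forms" "\<And>b. b \<in> B \<Longrightarrow> p b = b" using split_ext_form[OF s] by blast
    show ?thesis using left_fin_gen[OF p] left_projective[OF p] by blast
  qed
  have central: "generator_mod TYPE('u) S RM" if c: "centrally_projective A B"
  proof -
    obtain n f r where fr: "\<And>i. i < n \<Longrightarrow> f i \<in> forms" "\<And>i. i < n \<Longrightarrow> r i \<in> R"
      "\<And>a. a \<in> carrier A \<Longrightarrow> (\<Oplus>\<^bsub>A\<^esub>i\<in>{..<n::nat}. f i a \<otimes>\<^bsub>A\<^esub> r i) = a"
      using centrally_projective_coordinates[OF c] by blast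
    show ?thesis by (rule left_generator[OF fr])
  qed
  have both: "faithfully_balanced S Z RM \<and> progenerator_bimod TYPE('u) S Z RM \<and> morita_equivalent TYPE('u) S Z"
    if s: "split_ext A B" and c: "centrally_projective A B"
  proof -
    obtain p where p: "p \<in> forms" "\<And>b. b \<in> B \<Longrightarrow> p b = b" using split_ext_form[OF s] by blast
    obtain n f r where fr: "\<And>i. i < n \<Longrightarrow> f i \<in> forms" "\<And>i. i < n \<Longrightarrow> r i \<in> R"
      "\<And>a. a \<in> carrier A \<Longrightarrow> (\<Oplus>\<^bsub>A\<^esub>i\<in>{..<n::nat}. f i a \<otimes>\<^bsub>A\<^esub> r i) = a"
      using centrally_projective_coordinates[OF c] by blast
    have "faithfully_balanced S Z RM"
      unfolding faithfully_balanced_def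
      using bimodule_RM evaluation_iso[OF fr] right_mult_iso[OF p] by blast
    moreover have "progenerator_bimod TYPE('u) S Z RM"
      unfolding progenerator_bimod_def progenerator_mod_def
      using bimodule_RM split[OF s] central[OF c] right_fin_gen[OF fr] right_projective[OF fr]
        right_generator[OF p] by blast
    ultimately show ?thesis using S_Z_morita[OF fr p] by blast
  qed
  show ?thesis using split central both by blast
qed

end
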